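(* Let $k$ be a fixed positive integer. There exists a randomized algorithm running in $\tilde{O}(mn + n^{k/2 + 1})$ time that, with high probability, computes a $\left(2 - \frac{1}{2k-1}, 1 - \frac{1}{2k-1}\right)$-approximation to the $k$-center of any unweighted, undirected graph with $n$ vertices and $m$ edges.
   Context: $G=(V,E)$ is an undirected unweighted graph with $n$ vertices and $m\ge n-1$ edges, $d$ its shortest-path distance. $R_k(G)=\min_{C\subseteq V,|C|=k}\max_{v\in V} d(v,C)$ with $d(v,C)=\min_{c\in C}d(v,c)$ (the $k$-radius). An $(\alpha,\beta)$-approximation to the $k$-center is a value $\tilde R$ (witnessed by $k$ vertices covering all vertices within distance $\tilde R$) with $R_k(G)\le \tilde R\le \alpha R_k(G)+\beta$. $\tilde O$ hides polylogarithmic factors; "with high probability" means with probability at least $1-1/n^{c}$ for a constant $c>0$. *)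

theory Defs
  imports "HOL-Probability.Probability" "HOL-Library.Log_Nat"
begin

section \<open>Graphs and the k-center problem\<close>

text \<open>Graphs have vertex set \<open>{..<n}\<close>; they need not be connected, so distances are extended
  naturals, with \<open>\<infinity>\<close> (the infimum of the empty set) between different components.\<close>

definition simple_graph :: "nat \<Rightarrow> nat set set \<Rightarrow> bool" where
  "simple_graph n E \<longleftrightarrow> (\<forall>e\<in>E. \<exists>u v. e = {u, v} \<and> u \<noteq> v \<and> u < n \<and> v < n)"

definition walk :: "nat set set \<Rightarrow> nat list \<Rightarrow> bool" where
  "walk E p \<longleftrightarrow> p \<noteq> [] \<and> successively (\<lambda>u v. {u, v} \<in> E) p"

definition gdist :: "nat set set \<Rightarrow> nat \<Rightarrow> nat \<Rightarrow> enat" where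
  "gdist E u v = (INF p\<in>{p. walk E p \<and> hd p = u \<and> last p = v}. enat (length p - 1))"

definition set_gdist :: "nat set set \<Rightarrow> nat \<Rightarrow> nat set \<Rightarrow> enat" where
  "set_gdist E v C = (INF c\<in>C. gdist E v c)"

definition k_radius :: "nat \<Rightarrow> nat set set \<Rightarrow> nat \<Rightarrow> enat" where
  "k_radius n E k = (INF C\<in>{C. C \<subseteq> {..<n} \<and> card C = k}. SUP v\<in>{..<n}. set_gdist E v C)"

definition k_center_approx ::
  "real \<Rightarrow> real \<Rightarrow> nat \<Rightarrow> nat set set \<Rightarrow> nat \<Rightarrow> enat \<Rightarrow> nat set \<Rightarrow> bool" where
  "k_center_approx \<alpha> \<beta> n E k R C \<longleftrightarrow>
     C \<subseteq> {..<n} \<and> card C = k \<and> (\<forall>v<n. set_gdist E v C \<le> R) \<and>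
     k_radius n E k \<le> R \<and>
     ereal_of_enat R \<le> ereal \<alpha> * ereal_of_enat (k_radius n E k) + ereal \<beta>"

section \<open>Randomized word RAM\<close>

text \<open>Programs act on registers and on a random-access memory, both holding \<open>w\<close>-bit words;
  arithmetic is modulo \<open>2 ^ w\<close>. Every instruction, and every evaluation of a branch or loop
  condition (register nonzero), takes one step.\<close>

datatype binop = OpAdd | OpSub | OpMul | OpDiv | OpMod | OpLess | OpEq

datatype instr =
    Const nat nat
  | Move nat nat
  | Bin binop nat nat nat
  | Load nat nat
  | Store nat nat
  | Rand nat
  | Cond nat "instr list" "instr list"
  | While nat "instr list"

record ram_state =
  reg :: "nat \<Rightarrow> nat"
  mem :: "nat \<Rightarrow> nat"

text \<open>A configuration consists of the instructions still to be executed and the state.\<close>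

type_synonym config = "instr list \<times> ram_state"

fun eval_op :: "nat \<Rightarrow> binop \<Rightarrow> nat \<Rightarrow> nat \<Rightarrow> nat" where
  "eval_op w OpAdd a b = (a + b) mod 2 ^ w"
| "eval_op w OpSub a b = nat ((int a - int b) mod 2 ^ w)"
| "eval_op w OpMul a b = (a * b) mod 2 ^ w"
| "eval_op w OpDiv a b = a div b"
| "eval_op w OpMod a b = a mod b"
| "eval_op w OpLess a b = of_bool (a < b)"
| "eval_op w OpEq a b = of_bool (a = b)"

definition set_reg :: "nat \<Rightarrow> nat \<Rightarrow> ram_state \<Rightarrow> ram_state" where
  "set_reg x a s = s\<lparr>reg := (reg s)(x := a)\<rparr>"

definition set_mem :: "nat \<Rightarrow> nat \<Rightarrow> ram_state \<Rightarrow> ram_state" where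
  "set_mem i a s = s\<lparr>mem := (mem s)(i := a)\<rparr>"

fun step :: "nat \<Rightarrow> config \<Rightarrow> config pmf" where
  "step w ([], s) = return_pmf ([], s)"
| "step w (Const x a # K, s) = return_pmf (K, set_reg x (a mod 2 ^ w) s)"
| "step w (Move x y # K, s) = return_pmf (K, set_reg x (reg s y) s)"
| "step w (Bin f x y z # K, s) = return_pmf (K, set_reg x (eval_op w f (reg s y) (reg s z)) s)"
| "step w (Load x y # K, s) = return_pmf (K, set_reg x (mem s (reg s y)) s)"
| "step w (Store x y # K, s) = return_pmf (K, set_mem (reg s x) (reg s y) s)"
| "step w (Rand x # K, s) = map_pmf (\<lambda>a. (K, set_reg x a s)) (pmf_of_set {..<2 ^ w})"
| "step w (Cond x A B # K, s) = return_pmf ((if reg s x \<noteq> 0 then A else B) @ K, s)"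
| "step w (While x A # K, s) = return_pmf (if reg s x \<noteq> 0 then A @ While x A # K else K, s)"

definition run :: "nat \<Rightarrow> nat \<Rightarrow> config \<Rightarrow> config pmf" where
  "run w t c = ((\<lambda>p. bind_pmf p (step w)) ^^ t) (return_pmf c)"

definition halted :: "config \<Rightarrow> bool" where
  "halted c \<longleftrightarrow> fst c = []"

section \<open>Input, output and running time\<close>

text \<open>The input is an arbitrary listing of the edges, each once and in arbitrary orientation.\<close>

definition edge_listing :: "nat set set \<Rightarrow> (nat \<times> nat) list \<Rightarrow> bool" where
  "edge_listing E es \<longleftrightarrow>
     distinct (map (\<lambda>(u, v). {u, v}) es) \<and> set (map (\<lambda>(u, v). {u, v}) es) = E"

definition input_state :: "nat \<Rightarrow> (nat \<times> nat) list \<Rightarrow> ram_state" where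
  "input_state n es =
     \<lparr>reg = (\<lambda>_. 0)(0 := n, 1 := length es),
      mem = (\<lambda>i. if i < 2 * length es
                  then (if even i then fst (es ! (i div 2)) else snd (es ! (i div 2))) else 0)\<rparr>"

text \<open>The output value is read off register 0, where the word \<open>0\<close> stands for \<open>\<infinity>\<close> and
  \<open>r + 1\<close> stands for \<open>r\<close>; the centers are read off the first \<open>k\<close> memory cells.\<close>

definition output_value :: "config \<Rightarrow> enat" where
  "output_value c = (case reg (snd c) 0 of 0 \<Rightarrow> \<infinity> | Suc r \<Rightarrow> enat r)"

definition output_centers :: "nat \<Rightarrow> config \<Rightarrow> nat set" where
  "output_centers k c = mem (snd c) ` {..<k}"

text \<open>The polylogarithmic factor is a power of \<open>1 + log 2 n\<close>, so that it does not vanish at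
  \<open>n = 1\<close>.\<close>

definition soft_O :: "(nat \<Rightarrow> nat \<Rightarrow> real) \<Rightarrow> (nat \<Rightarrow> nat \<Rightarrow> nat) set" where
  "soft_O f = {T. \<exists>a b::nat. \<forall>n\<ge>1. \<forall>m.
     real (T n m) \<le> real a * f n m * (1 + log 2 (real n)) ^ b}"

text \<open>The word length is \<open>\<kappa>\<close> times the bit length of \<open>n\<close>; for \<open>\<kappa> \<ge> 2\<close> all input
  words and input addresses fit. The time bound holds for every outcome of the random choices.\<close>

definition solves_k_center_whp ::
  "instr list \<Rightarrow> nat \<Rightarrow> (nat \<Rightarrow> nat \<Rightarrow> nat) \<Rightarrow> real \<Rightarrow> nat \<Rightarrow> real \<Rightarrow> real \<Rightarrow> bool" where
  "solves_k_center_whp P \<kappa> T c k \<alpha> \<beta> \<longleftrightarrow>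
     (\<forall>n E es. simple_graph n E \<and> k \<le> n \<and> n \<le> card E + 1 \<and> edge_listing E es \<longrightarrow>
        (let D = run (\<kappa> * floorlog 2 n) (T n (card E)) (P, input_state n es) in
           (\<forall>cf\<in>set_pmf D. halted cf) \<and>
           measure_pmf.prob D
             {cf. k_center_approx \<alpha> \<beta> n E k (output_value cf) (output_centers k cf)}
             \<ge> 1 - 1 / real n powr c))"

end

theory Submission imports Defs begin

text \<open>
The program is deterministic. It computes all distances by breadth-first search and keeps, for every
vertex \<open>v\<close>, the row \<open>N v\<close> of its \<open>q\<close> nearest vertices, where \<open>q\<close> is about \<open>sqrt n\<close>. A greedy set \<open>S\<close> of
about \<open>(n / q) * ln n\<close> vertices hits all these rows; hence a vertex \<open>v\<close> at distance more than \<open>r\<close> from \<open>S\<close> has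
its whole ball of radius \<open>r\<close> inside \<open>N v\<close>.

Binary search guesses the optimal radius \<open>R\<close>. Let \<open>h = R div (2 * k - 1)\<close> and \<open>D = 2 * R - h\<close>, the radius aimed at.
Centers \<open>x\<^sub>1, x\<^sub>2, \<dots>\<close> are chosen one after the other. If the optimal centers that are still needed all lie
within \<open>R - h\<close> of \<open>S\<close>, they may be replaced by elements of \<open>S\<close>. Otherwise let \<open>c\<close> be one that does not, covering a
vertex \<open>v\<close> at distance more than \<open>D\<close> from the \<open>i\<close> vertices chosen so far. The point at distance \<open>2 * i * h\<close>
from \<open>c\<close> on the way to \<open>v\<close> is not covered by the optimal centers already approximated, and it is still far from \<open>S\<close>.
So the vertex \<open>w\<close> that is farthest from \<open>S\<close> among the vertices at distance more than \<open>R + (2 * i - 1) * h\<close> from the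
chosen ones is covered by a new optimal center \<open>c'\<close>, and \<open>N w\<close> contains a vertex within \<open>(2 * i + 1) * h\<close> of
\<open>c'\<close>. In both cases \<open>S \<union> N w\<close>, of size about \<open>sqrt n\<close>, contains a suitable next choice.

The last center is found in time about \<open>n * sqrt n\<close>. If some uncovered \<open>w\<close> is at distance more than
\<open>rho = (R - h) div 2\<close> from \<open>S\<close>, then \<open>N w\<close> contains a good choice. Otherwise each uncovered vertex has a
representative in \<open>S\<close> within \<open>rho\<close>, and it suffices to test, for all vertices \<open>u\<close>, whether \<open>u\<close> is within
\<open>R + rho\<close> of these representatives.
\<close>

section \<open>Compiling expressions and a budgeted program logic\<close>

text \<open>The radii are forced by one chain of inequalities. At level \<open>i\<close> an optimal
  center is approximated with error at most \<open>(2 * i + 1) * h\<close>, because the ball known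
  to lie in \<open>N w\<close> has radius \<open>R - (2 * i + 1) * h\<close>. These radii are
  nonnegative for all \<open>i < k\<close> exactly if \<open>(2 * k - 1) * h \<le> R\<close>, which
  explains the divisor in \<open>h\<close>. Moving by \<open>2 * i * h\<close> from \<open>c\<close>
  towards \<open>v\<close> turns the distance \<open>D = 2 * R - h\<close> into
  \<open>R + (2 * i - 1) * h\<close>, which is the radius within which the earlier choices take over
  from their optimal centers; so the levels fit together. The obstacle is the last level. With about
  \<open>sqrt n\<close> candidates at each of the \<open>k - 1\<close> levels above it, a test of
  all vertices against all vertices at every leaf would exceed \<open>n powr (k / 2 + 1)\<close> by
  a factor of about \<open>sqrt n\<close>. Hence the case split by \<open>rho\<close>, where either
  the candidates or the tests come from a set of size about \<open>sqrt n\<close>. Finding the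
  hitting set greedily costs about \<open>n * n\<close> up to logarithms; this is affordable because
  \<open>m \<ge> n - 1\<close> puts \<open>n * n\<close> below the claimed bound.\<close>

text \<open>Otherwise step counts would be rewritten from numerals to successor form.\<close>

declare One_nat_def [simp del]

lemma run_0: "run w 0 c = return_pmf c"
  by (simp add: run_def)

lemma run_Suc: "run w (Suc t) c = bind_pmf (run w t c) (step w)"
  by (simp add: run_def)

lemma run_add: "run w (a + b) c = bind_pmf (run w a c) (run w b)"
proof (induction b)
  case 0
  then show ?case by (simp add: run_0 bind_return_pmf')
next
  case (Suc b)
  have "run w (Suc b) = (\<lambda>x. bind_pmf (run w b x) (step w))"
    by (rule ext) (rule run_Suc)
  then show ?case
    using Suc by (simp add: run_Suc bind_assoc_pmf)
qed

lemma run_trans: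
  assumes "run w a c = return_pmf c'" "run w b c' = p"
  shows "run w (a + b) c = p"
  using assms by (simp add: run_add bind_return_pmf)

lemma run_1: "run w 1 c = step w c"
  by (simp add: One_nat_def run_Suc run_0 bind_return_pmf)

lemma run_halted: "run w t ([], s) = return_pmf ([], s)"
  by (induction t) (simp_all add: run_0 run_Suc bind_return_pmf)

section \<open>Expressions and their evaluation by straight-line code\<close>

datatype expr = Lit nat | Var nat | Cell expr | Opr binop expr expr

text \<open>Variables \<open>0\<close> and \<open>1\<close> are the input registers; the odd registers from \<open>3\<close> on are
  scratch space for expression evaluation.\<close>

definition vreg :: "nat \<Rightarrow> nat" where "vreg x = (if x = 1 then 1 else 2 * x)"
definition treg :: "nat \<Rightarrow> nat" where "treg d = 2 * d + 3"

lemma vreg_eq [simp]: "vreg x = vreg y \<longleftrightarrow> x = y"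
  by (auto simp: vreg_def split: if_splits)

lemma vreg_neq_treg [simp]: "vreg x \<noteq> treg d" "treg d \<noteq> vreg x"
  by (auto simp: vreg_def treg_def) presburger+

lemma treg_eq [simp]: "treg x = treg y \<longleftrightarrow> x = y"
  by (auto simp: treg_def)

fun compile :: "expr \<Rightarrow> nat \<Rightarrow> instr list" where
  "compile (Lit a) d = [Const (treg d) a]"
| "compile (Var x) d = [Move (treg d) (vreg x)]"
| "compile (Cell e) d = compile e d @ [Load (treg d) (treg d)]"
| "compile (Opr f a b) d = compile a d @ compile b (Suc d) @ [Bin f (treg d) (treg d) (treg (Suc d))]"

fun esz :: "expr \<Rightarrow> nat" where
  "esz (Lit a) = 1"
| "esz (Var x) = 1"
| "esz (Cell e) = esz e + 1"
| "esz (Opr f a b) = esz a + esz b + 1"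

text \<open>Arithmetic on unbounded naturals. \<open>safe_op\<close> tells when the modular machine
  operation agrees with it, so that specifications never mention the modulus.\<close>

fun iop :: "binop \<Rightarrow> nat \<Rightarrow> nat \<Rightarrow> nat" where
  "iop OpAdd a b = a + b"
| "iop OpSub a b = a - b"
| "iop OpMul a b = a * b"
| "iop OpDiv a b = a div b"
| "iop OpMod a b = a mod b"
| "iop OpLess a b = of_bool (a < b)"
| "iop OpEq a b = of_bool (a = b)"

fun safe_op :: "nat \<Rightarrow> binop \<Rightarrow> nat \<Rightarrow> nat \<Rightarrow> bool" where
  "safe_op w OpAdd a b \<longleftrightarrow> a + b < 2 ^ w"
| "safe_op w OpSub a b \<longleftrightarrow> b \<le> a \<and> a < 2 ^ w"
| "safe_op w OpMul a b \<longleftrightarrow> a * b < 2 ^ w"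
| "safe_op w _ a b \<longleftrightarrow> True"

lemma eval_op_safe:
  assumes "safe_op w f a b"
  shows "eval_op w f a b = iop f a b"
proof (cases f)
  case OpSub
  then have "b \<le> a" "a < 2 ^ w" using assms by auto
  then have 1: "int a - int b = int (a - b)" and "a - b < 2 ^ w"
    by auto
  then have "int (a - b) < int (2 ^ w)"
    by (simp only: of_nat_less_iff)
  then have "int (a - b) mod 2 ^ w = int (a - b)"
    by (intro mod_pos_pos_trivial) auto
  then show ?thesis by (simp only: OpSub eval_op.simps iop.simps 1 nat_int)
qed (use assms in \<open>simp_all\<close>)

fun iv :: "expr \<Rightarrow> (nat \<Rightarrow> nat) \<Rightarrow> (nat \<Rightarrow> nat) \<Rightarrow> nat" where
  "iv (Lit a) \<sigma> \<mu> = a"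
| "iv (Var x) \<sigma> \<mu> = \<sigma> x"
| "iv (Cell e) \<sigma> \<mu> = \<mu> (iv e \<sigma> \<mu>)"
| "iv (Opr f a b) \<sigma> \<mu> = iop f (iv a \<sigma> \<mu>) (iv b \<sigma> \<mu>)"

fun ok :: "nat \<Rightarrow> expr \<Rightarrow> (nat \<Rightarrow> nat) \<Rightarrow> (nat \<Rightarrow> nat) \<Rightarrow> bool" where
  "ok w (Lit a) \<sigma> \<mu> \<longleftrightarrow> a < 2 ^ w"
| "ok w (Var x) \<sigma> \<mu> \<longleftrightarrow> True"
| "ok w (Cell e) \<sigma> \<mu> \<longleftrightarrow> ok w e \<sigma> \<mu>"
| "ok w (Opr f a b) \<sigma> \<mu> \<longleftrightarrow> ok w a \<sigma> \<mu> \<and> ok w b \<sigma> \<mu> \<and> safe_op w f (iv a \<sigma> \<mu>) (iv b \<sigma> \<mu>)"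

definition sim :: "ram_state \<Rightarrow> (nat \<Rightarrow> nat) \<Rightarrow> (nat \<Rightarrow> nat) \<Rightarrow> bool" where
  "sim r \<sigma> \<mu> \<longleftrightarrow> mem r = \<mu> \<and> (\<forall>x. reg r (vreg x) = \<sigma> x)"

text \<open>The clause on \<open>d' < d\<close> keeps the left operand of \<open>Opr\<close> alive
  while the right one is evaluated at depth \<open>Suc d\<close>. Expressions compile to
  straight-line code, hence the exact step count \<open>esz e\<close>.\<close>

lemma run_compile:
  assumes "sim r \<sigma> \<mu>" "ok w e \<sigma> \<mu>"
  shows "\<exists>r'. sim r' \<sigma> \<mu> \<and> reg r' (treg d) = iv e \<sigma> \<mu> \<and> (\<forall>d'<d. reg r' (treg d') = reg r (treg d')) \<and>
    run w (esz e) (compile e d @ K, r) = return_pmf (K, r')"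
  using assms
proof (induction e arbitrary: r d K)
  case (Lit a)
  then show ?case
    by (intro exI[of _ "set_reg (treg d) a r"]) (auto simp: run_1 sim_def set_reg_def)
next
  case (Var x)
  then show ?case
    by (intro exI[of _ "set_reg (treg d) (\<sigma> x) r"]) (auto simp: run_1 sim_def set_reg_def)
next
  case (Cell e)
  obtain r1 where r1: "sim r1 \<sigma> \<mu>" "reg r1 (treg d) = iv e \<sigma> \<mu>"
    "\<forall>d'<d. reg r1 (treg d') = reg r (treg d')"
    "run w (esz e) (compile e d @ Load (treg d) (treg d) # K, r) = return_pmf (Load (treg d) (treg d) # K, r1)"
    using Cell.IH[OF Cell.prems(1), of d "Load (treg d) (treg d) # K"] Cell.prems(2) by auto
  have "run w (esz e + 1) (compile e d @ Load (treg d) (treg d) # K, r) =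
      return_pmf (K, set_reg (treg d) (\<mu> (iv e \<sigma> \<mu>)) r1)"
    by (rule run_trans[OF r1(4)]) (use r1 in \<open>simp only: run_1, simp add: sim_def\<close>)
  then show ?case
    using r1 by (intro exI[of _ "set_reg (treg d) (\<mu> (iv e \<sigma> \<mu>)) r1"]) (auto simp: sim_def set_reg_def)
next
  case (Opr f a b)
  let ?I = "Bin f (treg d) (treg d) (treg (Suc d))"
  obtain r1 where r1: "sim r1 \<sigma> \<mu>" "reg r1 (treg d) = iv a \<sigma> \<mu>"
    "\<forall>d'<d. reg r1 (treg d') = reg r (treg d')"
    "run w (esz a) (compile a d @ compile b (Suc d) @ ?I # K, r) = return_pmf (compile b (Suc d) @ ?I # K, r1)"
    using Opr.IH(1)[OF Opr.prems(1), of d "compile b (Suc d) @ ?I # K"] Opr.prems by auto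
  obtain r2 where r2: "sim r2 \<sigma> \<mu>" "reg r2 (treg (Suc d)) = iv b \<sigma> \<mu>"
    "\<forall>d'<Suc d. reg r2 (treg d') = reg r1 (treg d')"
    "run w (esz b) (compile b (Suc d) @ ?I # K, r1) = return_pmf (?I # K, r2)"
    using Opr.IH(2)[OF r1(1), of "Suc d" "?I # K"] Opr.prems by auto
  have e: "eval_op w f (iv a \<sigma> \<mu>) (iv b \<sigma> \<mu>) = iop f (iv a \<sigma> \<mu>) (iv b \<sigma> \<mu>)"
    using Opr.prems by (intro eval_op_safe) auto
  let ?r = "set_reg (treg d) (iop f (iv a \<sigma> \<mu>) (iv b \<sigma> \<mu>)) r2"
  have "run w 1 (?I # K, r2) = return_pmf (K, ?r)"
    using r1 r2 e by (simp only: run_1) simp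
  then have "run w (esz a + (esz b + 1)) (compile a d @ compile b (Suc d) @ ?I # K, r) = return_pmf (K, ?r)"
    by (intro run_trans[OF r1(4)] run_trans[OF r2(4)])
  then show ?case
    using r1 r2 by (intro exI[of _ ?r]) (auto simp: sim_def set_reg_def add.assoc)
qed

text \<open>\<open>T\<close> is a step budget; the postcondition sees what is left of it.\<close>

definition wp :: "nat \<Rightarrow> instr list \<Rightarrow> (nat \<Rightarrow> (nat \<Rightarrow> nat) \<Rightarrow> (nat \<Rightarrow> nat) \<Rightarrow> bool) \<Rightarrow> nat \<Rightarrow>
    (nat \<Rightarrow> nat) \<Rightarrow> (nat \<Rightarrow> nat) \<Rightarrow> bool" where
  "wp w P Q T \<sigma> \<mu> \<longleftrightarrow> (\<exists>t \<sigma>' \<mu>'. t \<le> T \<and> Q (T - t) \<sigma>' \<mu>' \<and>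
     (\<forall>r K. sim r \<sigma> \<mu> \<longrightarrow> (\<exists>r'. sim r' \<sigma>' \<mu>' \<and> run w t (P @ K, r) = return_pmf (K, r'))))"

lemma wp_append:
  assumes "wp w A (wp w B Q) T \<sigma> \<mu>"
  shows "wp w (A @ B) Q T \<sigma> \<mu>"
proof -
  obtain t \<sigma>' \<mu>' where 1: "t \<le> T" "wp w B Q (T - t) \<sigma>' \<mu>'"
    "\<And>r K. sim r \<sigma> \<mu> \<Longrightarrow> \<exists>r'. sim r' \<sigma>' \<mu>' \<and> run w t (A @ K, r) = return_pmf (K, r')"
    using assms unfolding wp_def[of w A] by blast
  obtain t2 \<sigma>2 \<mu>2 where 2: "t2 \<le> T - t" "Q (T - t - t2) \<sigma>2 \<mu>2"
    "\<And>r K. sim r \<sigma>' \<mu>' \<Longrightarrow> \<exists>r'. sim r' \<sigma>2 \<mu>2 \<and> run w t2 (B @ K, r) = return_pmf (K, r')"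
    using 1(2) unfolding wp_def by blast
  have "\<exists>r'. sim r' \<sigma>2 \<mu>2 \<and> run w (t + t2) ((A @ B) @ K, r) = return_pmf (K, r')"
    if r: "sim r \<sigma> \<mu>" for r K
  proof -
    obtain r1 where r1: "sim r1 \<sigma>' \<mu>'" "run w t (A @ (B @ K), r) = return_pmf (B @ K, r1)"
      using 1(3)[OF r] by blast
    obtain r2 where r2: "sim r2 \<sigma>2 \<mu>2" "run w t2 (B @ K, r1) = return_pmf (K, r2)"
      using 2(3)[OF r1(1)] by blast
    show ?thesis using run_trans[OF r1(2) r2(2)] r2(1) by auto
  qed
  then show ?thesis
    unfolding wp_def using 1(1) 2(1,2)
    by (intro exI[of _ "t + t2"] exI[of _ \<sigma>2] exI[of _ \<mu>2]) (auto simp: diff_diff_left)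
qed

lemma wp_Nil: "Q T \<sigma> \<mu> \<Longrightarrow> wp w [] Q T \<sigma> \<mu>"
  unfolding wp_def by (intro exI[of _ 0]) (auto simp: run_0)

section \<open>Structured commands and their proof rules\<close>

definition asg :: "nat \<Rightarrow> expr \<Rightarrow> instr list" where
  "asg x e = compile e 0 @ [Move (vreg x) (treg 0)]"

definition sto :: "expr \<Rightarrow> expr \<Rightarrow> instr list" where
  "sto a e = compile a 0 @ compile e 1 @ [Store (treg 0) (treg 1)]"

definition ite :: "expr \<Rightarrow> instr list \<Rightarrow> instr list \<Rightarrow> instr list" where
  "ite e A B = compile e 0 @ [Cond (treg 0) A B]"

text \<open>\<open>While\<close> tests a register only, so the condition is computed before the loop
  and once more at the end of each round.\<close>

definition whl :: "expr \<Rightarrow> instr list \<Rightarrow> instr list" where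
  "whl e A = compile e 0 @ [While (treg 0) (A @ compile e 0)]"

lemma wp_asg:
  assumes "ok w e \<sigma> \<mu>" "esz e < T" "Q (T - (esz e + 1)) (\<sigma>(x := iv e \<sigma> \<mu>)) \<mu>"
  shows "wp w (asg x e) Q T \<sigma> \<mu>"
proof -
  have "\<exists>r'. sim r' (\<sigma>(x := iv e \<sigma> \<mu>)) \<mu> \<and> run w (esz e + 1) (asg x e @ K, r) = return_pmf (K, r')"
    if r: "sim r \<sigma> \<mu>" for r K
  proof -
    obtain r1 where r1: "sim r1 \<sigma> \<mu>" "reg r1 (treg 0) = iv e \<sigma> \<mu>"
      "run w (esz e) (compile e 0 @ Move (vreg x) (treg 0) # K, r) = return_pmf (Move (vreg x) (treg 0) # K, r1)"
      using run_compile[OF r assms(1), of 0] by blast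
    have "run w 1 (Move (vreg x) (treg 0) # K, r1) = return_pmf (K, set_reg (vreg x) (iv e \<sigma> \<mu>) r1)"
      using r1 by (simp only: run_1) simp
    from run_trans[OF r1(3) this] show ?thesis
      using r1 by (intro exI[of _ "set_reg (vreg x) (iv e \<sigma> \<mu>) r1"]) (auto simp: asg_def sim_def set_reg_def)
  qed
  then show ?thesis
    unfolding wp_def using assms
    by (intro exI[of _ "esz e + 1"] exI[of _ "\<sigma>(x := iv e \<sigma> \<mu>)"] exI[of _ \<mu>]) auto
qed

lemma wp_sto:
  assumes "ok w a \<sigma> \<mu>" "ok w e \<sigma> \<mu>" "esz a + esz e < T"
    "Q (T - (esz a + esz e + 1)) \<sigma> (\<mu>(iv a \<sigma> \<mu> := iv e \<sigma> \<mu>))"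
  shows "wp w (sto a e) Q T \<sigma> \<mu>"
proof -
  have "\<exists>r'. sim r' \<sigma> (\<mu>(iv a \<sigma> \<mu> := iv e \<sigma> \<mu>)) \<and>
      run w (esz a + (esz e + 1)) (sto a e @ K, r) = return_pmf (K, r')"
    if r: "sim r \<sigma> \<mu>" for r K
  proof -
    let ?I = "Store (treg 0) (treg 1)"
    obtain r1 where r1: "sim r1 \<sigma> \<mu>" "reg r1 (treg 0) = iv a \<sigma> \<mu>"
      "run w (esz a) (compile a 0 @ compile e 1 @ ?I # K, r) = return_pmf (compile e 1 @ ?I # K, r1)"
      using run_compile[OF r assms(1), of 0] by blast
    obtain r2 where r2: "sim r2 \<sigma> \<mu>" "reg r2 (treg 1) = iv e \<sigma> \<mu>" "reg r2 (treg 0) = reg r1 (treg 0)"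
      "run w (esz e) (compile e 1 @ ?I # K, r1) = return_pmf (?I # K, r2)"
      using run_compile[OF r1(1) assms(2), of 1 "?I # K"] by auto
    have "run w 1 (?I # K, r2) = return_pmf (K, set_mem (iv a \<sigma> \<mu>) (iv e \<sigma> \<mu>) r2)"
      using r1 r2 by (simp only: run_1) simp
    from run_trans[OF r1(3) run_trans[OF r2(4) this]] show ?thesis
      using r1 r2 by (intro exI[of _ "set_mem (iv a \<sigma> \<mu>) (iv e \<sigma> \<mu>) r2"]) (auto simp: sto_def sim_def set_mem_def)
  qed
  then show ?thesis
    unfolding wp_def using assms
    by (intro exI[of _ "esz a + (esz e + 1)"] exI[of _ \<sigma>] exI[of _ "\<mu>(iv a \<sigma> \<mu> := iv e \<sigma> \<mu>)"])
      (simp add: add.assoc)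
qed

text \<open>Evaluating a condition touches only scratch registers: the abstract state stays the same
  while the code \<open>A\<close> turns into \<open>B\<close>. Both branching and the unfolding of a
  loop have this form.\<close>

lemma wp_prefix:
  assumes "t \<le> T" "wp w B Q (T - t) \<sigma> \<mu>"
    and "\<And>r K. sim r \<sigma> \<mu> \<Longrightarrow> \<exists>r'. sim r' \<sigma> \<mu> \<and> run w t (A @ K, r) = return_pmf (B @ K, r')"
  shows "wp w A Q T \<sigma> \<mu>"
proof -
  obtain t2 \<sigma>2 \<mu>2 where 2: "t2 \<le> T - t" "Q (T - t - t2) \<sigma>2 \<mu>2"
    "\<And>r K. sim r \<sigma> \<mu> \<Longrightarrow> \<exists>r'. sim r' \<sigma>2 \<mu>2 \<and> run w t2 (B @ K, r) = return_pmf (K, r')"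
    using assms(2) unfolding wp_def by blast
  have "\<exists>r'. sim r' \<sigma>2 \<mu>2 \<and> run w (t + t2) (A @ K, r) = return_pmf (K, r')" if r: "sim r \<sigma> \<mu>" for r K
  proof -
    obtain r1 where r1: "sim r1 \<sigma> \<mu>" "run w t (A @ K, r) = return_pmf (B @ K, r1)"
      using assms(3)[OF r] by blast
    obtain r2 where r2: "sim r2 \<sigma>2 \<mu>2" "run w t2 (B @ K, r1) = return_pmf (K, r2)"
      using 2(3)[OF r1(1)] by blast
    show ?thesis using run_trans[OF r1(2) r2(2)] r2(1) by blast
  qed
  then show ?thesis
    unfolding wp_def using assms(1) 2(1,2)
    by (intro exI[of _ "t + t2"] exI[of _ \<sigma>2] exI[of _ \<mu>2]) (auto simp: diff_diff_left)
qed

lemma wp_ite: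
  assumes "ok w e \<sigma> \<mu>" "esz e < T"
    "iv e \<sigma> \<mu> \<noteq> 0 \<Longrightarrow> wp w A Q (T - (esz e + 1)) \<sigma> \<mu>"
    "iv e \<sigma> \<mu> = 0 \<Longrightarrow> wp w B Q (T - (esz e + 1)) \<sigma> \<mu>"
  shows "wp w (ite e A B) Q T \<sigma> \<mu>"
proof (rule wp_prefix)
  show "esz e + 1 \<le> T" using assms by simp
  show "wp w (if iv e \<sigma> \<mu> \<noteq> 0 then A else B) Q (T - (esz e + 1)) \<sigma> \<mu>" using assms by simp
  fix r K assume "sim r \<sigma> \<mu>"
  then obtain r1 where r1: "sim r1 \<sigma> \<mu>" "reg r1 (treg 0) = iv e \<sigma> \<mu>"
    "run w (esz e) (compile e 0 @ Cond (treg 0) A B # K, r) = return_pmf (Cond (treg 0) A B # K, r1)"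
    using run_compile[of r \<sigma> \<mu> w e 0] assms(1) by blast
  have "run w 1 (Cond (treg 0) A B # K, r1) = return_pmf ((if iv e \<sigma> \<mu> \<noteq> 0 then A else B) @ K, r1)"
    using r1 by (simp only: run_1) simp
  from run_trans[OF r1(3) this] show "\<exists>r'. sim r' \<sigma> \<mu> \<and>
      run w (esz e + 1) (ite e A B @ K, r) = return_pmf ((if iv e \<sigma> \<mu> \<noteq> 0 then A else B) @ K, r')"
    using r1 by (intro exI[of _ r1]) (auto simp: ite_def)
qed

lemma wp_mono:
  assumes "wp w P Q T \<sigma> \<mu>" "T \<le> T'" "\<And>t \<sigma>' \<mu>'. t \<le> T \<Longrightarrow> Q t \<sigma>' \<mu>' \<Longrightarrow> Q' (t + (T' - T)) \<sigma>' \<mu>'"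
  shows "wp w P Q' T' \<sigma> \<mu>"
proof -
  obtain t \<sigma>' \<mu>' where 1: "t \<le> T" "Q (T - t) \<sigma>' \<mu>'"
    "\<forall>r K. sim r \<sigma> \<mu> \<longrightarrow> (\<exists>r'. sim r' \<sigma>' \<mu>' \<and> run w t (P @ K, r) = return_pmf (K, r'))"
    using assms unfolding wp_def by blast
  have "T' - t = (T - t) + (T' - T)" using 1(1) assms(2) by simp
  then have "Q' (T' - t) \<sigma>' \<mu>'" using assms(3)[OF _ 1(2)] by simp
  moreover have "t \<le> T'" using 1(1) assms(2) by simp
  ultimately show ?thesis using 1(3) unfolding wp_def by blast
qed

text \<open>Every iteration consumes budget, so the budget is the termination measure.\<close>

lemma wp_whl:
  assumes I: "I T \<sigma> \<mu>"
    and step: "\<And>T \<sigma> \<mu>. I T \<sigma> \<mu> \<Longrightarrow> ok w e \<sigma> \<mu> \<and> esz e < T \<and>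
      (if iv e \<sigma> \<mu> \<noteq> 0 then wp w A I (T - (esz e + 1)) \<sigma> \<mu> else Q (T - (esz e + 1)) \<sigma> \<mu>)"
  shows "wp w (whl e A) Q T \<sigma> \<mu>"
  using I
proof (induction T arbitrary: \<sigma> \<mu> rule: less_induct)
  case (less T)
  let ?W = "While (treg 0) (A @ compile e 0)"
  note s = step[OF less.prems]
  have prefix: "\<exists>r'. sim r' \<sigma> \<mu> \<and> run w (esz e + 1) (whl e A @ K, r) =
      return_pmf ((if iv e \<sigma> \<mu> \<noteq> 0 then (A @ whl e A) @ K else K), r')" if r: "sim r \<sigma> \<mu>" for r K
  proof -
    obtain r1 where r1: "sim r1 \<sigma> \<mu>" "reg r1 (treg 0) = iv e \<sigma> \<mu>"
      "run w (esz e) (compile e 0 @ ?W # K, r) = return_pmf (?W # K, r1)"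
      using run_compile[OF r, of w e 0] s by blast
    have "run w 1 (?W # K, r1) =
        return_pmf ((if iv e \<sigma> \<mu> \<noteq> 0 then (A @ whl e A) @ K else K), r1)"
      using r1 by (simp only: run_1) (simp add: whl_def)
    from run_trans[OF r1(3) this] show ?thesis
      using r1(1) by (intro exI[of _ r1]) (simp add: whl_def)
  qed
  show ?case
  proof (cases "iv e \<sigma> \<mu> = 0")
    case True
    with prefix s show ?thesis
      unfolding wp_def by (intro exI[of _ "esz e + 1"] exI[of _ \<sigma>] exI[of _ \<mu>]) auto
  next
    case False
    have "wp w A I (T - (esz e + 1)) \<sigma> \<mu>" using s False by simp
    then have "wp w A (wp w (whl e A) Q) (T - (esz e + 1)) \<sigma> \<mu>"
      using s by (rule_tac wp_mono[where T = "T - (esz e + 1)" and Q = I]) (auto intro!: less.IH)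
    then have "wp w (A @ whl e A) Q (T - (esz e + 1)) \<sigma> \<mu>" by (rule wp_append)
    then show ?thesis
      by (rule wp_prefix[rotated]) (use s prefix False in auto)
  qed
qed

subsection \<open>Frame conditions\<close>

fun wri :: "instr \<Rightarrow> nat set" where
  "wri (Const x a) = {x}"
| "wri (Move x y) = {x}"
| "wri (Bin f x y z) = {x}"
| "wri (Load x y) = {x}"
| "wri (Store x y) = {}"
| "wri (Rand x) = {x}"
| "wri (Cond x A B) = (\<Union>i\<in>set A. wri i) \<union> (\<Union>i\<in>set B. wri i)"
| "wri (While x A) = (\<Union>i\<in>set A. wri i)"

fun storing :: "instr \<Rightarrow> bool" where
  "storing (Store x y) \<longleftrightarrow> True"
| "storing (Cond x A B) \<longleftrightarrow> (\<exists>i\<in>set A. storing i) \<or> (\<exists>i\<in>set B. storing i)"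
| "storing (While x A) \<longleftrightarrow> (\<exists>i\<in>set A. storing i)"
| "storing _ \<longleftrightarrow> False"

definition nosto :: "instr list \<Rightarrow> bool" where
  "nosto P \<longleftrightarrow> (\<forall>i\<in>set P. \<not> storing i)"

definition vw :: "instr list \<Rightarrow> nat set" where
  "vw P = {x. \<exists>i\<in>set P. vreg x \<in> wri i}"

lemma step_frame:
  assumes "(P', s') \<in> set_pmf (step w (P, s))"
  shows "(\<Union>i\<in>set P'. wri i) \<subseteq> (\<Union>i\<in>set P. wri i) \<and>
    (\<forall>x. x \<notin> (\<Union>i\<in>set P. wri i) \<longrightarrow> reg s' x = reg s x) \<and>
    (nosto P \<longrightarrow> nosto P' \<and> mem s' = mem s)"
proof (cases P)
  case Nil
  then show ?thesis using assms by simp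
next
  case (Cons i K)
  then show ?thesis using assms
    by (cases i) (auto simp: set_reg_def set_mem_def nosto_def split: if_splits)
qed

lemma run_frame:
  assumes "(P', s') \<in> set_pmf (run w t (P, s))"
  shows "(\<Union>i\<in>set P'. wri i) \<subseteq> (\<Union>i\<in>set P. wri i) \<and>
    (\<forall>x. x \<notin> (\<Union>i\<in>set P. wri i) \<longrightarrow> reg s' x = reg s x) \<and>
    (nosto P \<longrightarrow> nosto P' \<and> mem s' = mem s)"
  using assms
proof (induction t arbitrary: P' s')
  case 0
  then show ?case by (simp add: run_0)
next
  case (Suc t)
  then obtain P1 s1 where 1: "(P1, s1) \<in> set_pmf (run w t (P, s))" "(P', s') \<in> set_pmf (step w (P1, s1))"
    by (auto simp: run_Suc)
  have a: "(\<Union>i\<in>set P'. wri i) \<subseteq> (\<Union>i\<in>set P1. wri i)" "(\<Union>i\<in>set P1. wri i) \<subseteq> (\<Union>i\<in>set P. wri i)"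
    using step_frame[OF 1(2)] Suc.IH[OF 1(1)] by auto
  have b: "reg s' x = reg s x" if "x \<notin> (\<Union>i\<in>set P. wri i)" for x
  proof -
    have "x \<notin> (\<Union>i\<in>set P1. wri i)" using that a by blast
    then have "reg s' x = reg s1 x" using step_frame[OF 1(2)] by blast
    moreover have "reg s1 x = reg s x" using Suc.IH[OF 1(1)] that by blast
    ultimately show ?thesis by simp
  qed
  have c: "nosto P' \<and> mem s' = mem s" if "nosto P"
    using that step_frame[OF 1(2)] Suc.IH[OF 1(1)] by metis
  show ?case using subset_trans[OF a] b c by blast
qed

lemma wp_frame:
  assumes "wp w P Q T \<sigma> \<mu>"
  shows "wp w P (\<lambda>t \<sigma>' \<mu>'. Q t \<sigma>' \<mu>' \<and> (\<forall>x. x \<notin> vw P \<longrightarrow> \<sigma>' x = \<sigma> x) \<and> (nosto P \<longrightarrow> \<mu>' = \<mu>)) T \<sigma> \<mu>"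
proof -
  obtain t \<sigma>' \<mu>' where 1: "t \<le> T" "Q (T - t) \<sigma>' \<mu>'"
    "\<And>r K. sim r \<sigma> \<mu> \<Longrightarrow> (\<exists>r'. sim r' \<sigma>' \<mu>' \<and> run w t (P @ K, r) = return_pmf (K, r'))"
    using assms unfolding wp_def by blast
  \<comment> \<open>The final abstract state is the same for all concrete states that simulate the
    initial one, so the frame facts of a single run carry over. This state inverts
    \<open>vreg\<close>.\<close>
  define r where "r = \<lparr>reg = (\<lambda>y. \<sigma> (if y = 1 then 1 else y div 2)), mem = \<mu>\<rparr>"
  have r: "sim r \<sigma> \<mu>" by (auto simp: r_def sim_def vreg_def)
  obtain r' where r': "sim r' \<sigma>' \<mu>'" "run w t (P @ [], r) = return_pmf ([], r')"
    using 1(3)[OF r] by blast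
  have "([], r') \<in> set_pmf (run w t (P, r))" using r'(2) by simp
  from run_frame[OF this]
  have f: "reg r' x = reg r x" if "x \<notin> (\<Union>i\<in>set P. wri i)" for x
    using that by blast
  have m: "nosto P \<longrightarrow> mem r' = mem r" using run_frame[OF \<open>([], r') \<in> _\<close>] by blast
  have "\<sigma>' x = \<sigma> x" if "x \<notin> vw P" for x
  proof -
    have "reg r' (vreg x) = reg r (vreg x)" using that by (intro f) (auto simp: vw_def)
    then show ?thesis using r r' by (simp add: sim_def)
  qed
  moreover have "nosto P \<longrightarrow> \<mu>' = \<mu>" using m r r' by (simp add: sim_def)
  ultimately show ?thesis
    unfolding wp_def using 1 by (intro exI[of _ t] exI[of _ \<sigma>'] exI[of _ \<mu>']) auto
qed

lemma vw_append [simp]: "vw (A @ B) = vw A \<union> vw B"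
  by (auto simp: vw_def)

lemma vw_Nil [simp]: "vw [] = {}"
  by (auto simp: vw_def)

lemma nosto_append [simp]: "nosto (A @ B) \<longleftrightarrow> nosto A \<and> nosto B"
  by (auto simp: nosto_def)

lemma nosto_Nil [simp]: "nosto []"
  by (auto simp: nosto_def)

lemma vw_compile [simp]: "vw (compile e d) = {}"
  by (induction e arbitrary: d) (auto simp: vw_def)

lemma nosto_compile [simp]: "nosto (compile e d)"
  by (induction e arbitrary: d) (auto simp: nosto_def)

lemma vw_asg [simp]: "vw (asg x e) = {x}"
  by (simp add: asg_def) (auto simp: vw_def)

lemma nosto_asg [simp]: "nosto (asg x e)"
  by (simp add: asg_def) (auto simp: nosto_def)

lemma vw_sto [simp]: "vw (sto a e) = {}"
  by (simp add: sto_def) (auto simp: vw_def)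

lemma vw_ite [simp]: "vw (ite e A B) = vw A \<union> vw B"
  by (simp add: ite_def) (auto simp: vw_def)

lemma nosto_ite [simp]: "nosto (ite e A B) \<longleftrightarrow> nosto A \<and> nosto B"
  by (simp add: ite_def) (auto simp: nosto_def)

lemma vw_whl [simp]: "vw (whl e A) = vw A"
proof -
  have "vw (whl e A) = vw (A @ compile e 0)"
    unfolding whl_def vw_append vw_compile using vw_compile[of e 0] by (auto simp: vw_def)
  then show ?thesis by simp
qed

lemma nosto_whl [simp]: "nosto (whl e A) \<longleftrightarrow> nosto A"
proof -
  have "nosto (whl e A) \<longleftrightarrow> nosto (A @ compile e 0)"
    unfolding whl_def nosto_append using nosto_compile[of e 0] by (auto simp: nosto_def)
  then show ?thesis by simp
qed

lemma wp_call:
  assumes "wp w P Q0 C \<sigma> \<mu>" "C \<le> T"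
    and "\<And>t \<sigma>' \<mu>'. T - C \<le> t \<Longrightarrow> t \<le> T \<Longrightarrow> (\<And>x. x \<notin> vw P \<Longrightarrow> \<sigma>' x = \<sigma> x) \<Longrightarrow>
      (nosto P \<Longrightarrow> \<mu>' = \<mu>) \<Longrightarrow> Q0 (t - (T - C)) \<sigma>' \<mu>' \<Longrightarrow> Q t \<sigma>' \<mu>'"
  shows "wp w P Q T \<sigma> \<mu>"
  using assms(2) by (intro wp_mono[OF wp_frame[OF assms(1)]]) (auto intro!: assms(3))

definition for_loop :: "nat \<Rightarrow> nat \<Rightarrow> instr list \<Rightarrow> instr list" where
  "for_loop x h A = asg x (Lit 0) @ whl (Opr OpLess (Var x) (Var h)) (A @ asg x (Opr OpAdd (Var x) (Lit 1)))"

lemma vw_for [simp]: "vw (for_loop x h A) = insert x (vw A)"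
  by (auto simp: for_loop_def)

lemma nosto_for [simp]: "nosto (for_loop x h A) \<longleftrightarrow> nosto A"
  by (auto simp: for_loop_def)

text \<open>Beyond the body's \<open>C\<close> steps, a round pays 4 for the test and 4 for the
  increment. The constant 6 pays 2 for setting the counter to 0 and 4 for the final, failing
  test.\<close>

lemma wp_for:
  assumes h: "\<sigma> h = N" "N < 2 ^ w" "1 < (2::nat) ^ w" "x \<noteq> h" "x \<notin> vw A" "h \<notin> vw A"
    and T: "N * (C + 8) + 6 \<le> T"
    and init: "I 0 (\<sigma>(x := 0)) \<mu>"
    and step: "\<And>j \<sigma>1 \<mu>1. j < N \<Longrightarrow> \<sigma>1 x = j \<Longrightarrow> (\<And>y. y \<noteq> x \<Longrightarrow> y \<notin> vw A \<Longrightarrow> \<sigma>1 y = \<sigma> y) \<Longrightarrow>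
      (nosto A \<Longrightarrow> \<mu>1 = \<mu>) \<Longrightarrow> I j \<sigma>1 \<mu>1 \<Longrightarrow>
      wp w A (\<lambda>t \<sigma>2 \<mu>2. I (Suc j) (\<sigma>2(x := Suc j)) \<mu>2) C \<sigma>1 \<mu>1"
    and post: "\<And>t \<sigma>1 \<mu>1. T - (N * (C + 8) + 6) \<le> t \<Longrightarrow> t \<le> T \<Longrightarrow> \<sigma>1 x = N \<Longrightarrow>
      (\<And>y. y \<noteq> x \<Longrightarrow> y \<notin> vw A \<Longrightarrow> \<sigma>1 y = \<sigma> y) \<Longrightarrow> (nosto A \<Longrightarrow> \<mu>1 = \<mu>) \<Longrightarrow> I N \<sigma>1 \<mu>1 \<Longrightarrow> Q t \<sigma>1 \<mu>1"
  shows "wp w (for_loop x h A) Q T \<sigma> \<mu>"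
  unfolding for_loop_def
proof (intro wp_append wp_asg)
  show "ok w (Lit 0) \<sigma> \<mu>" by simp
  show "esz (Lit 0) < T" using T by simp
  let ?J = "\<lambda>t \<sigma>1 \<mu>1. \<exists>j\<le>N. \<sigma>1 x = j \<and> (\<forall>y. y \<noteq> x \<longrightarrow> y \<notin> vw A \<longrightarrow> \<sigma>1 y = \<sigma> y) \<and> (nosto A \<longrightarrow> \<mu>1 = \<mu>) \<and>
     I j \<sigma>1 \<mu>1 \<and> (N - j) * (C + 8) + 4 + (T - (N * (C + 8) + 6)) \<le> t \<and> t \<le> T"
  show "wp w (whl (Opr OpLess (Var x) (Var h)) (A @ asg x (Opr OpAdd (Var x) (Lit 1)))) Q
     (T - (esz (Lit 0) + 1)) (\<sigma>(x := iv (Lit 0) \<sigma> \<mu>)) \<mu>"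
  proof (rule wp_whl[where I = ?J])
    show "?J (T - (esz (Lit 0) + 1)) (\<sigma>(x := iv (Lit 0) \<sigma> \<mu>)) \<mu>"
      using T init by auto
    fix t \<sigma>1 \<mu>1 assume "?J t \<sigma>1 \<mu>1"
    then obtain j where j: "j \<le> N" "\<sigma>1 x = j" "\<And>y. y \<noteq> x \<Longrightarrow> y \<notin> vw A \<Longrightarrow> \<sigma>1 y = \<sigma> y" "nosto A \<longrightarrow> \<mu>1 = \<mu>"
      "I j \<sigma>1 \<mu>1" "(N - j) * (C + 8) + 4 + (T - (N * (C + 8) + 6)) \<le> t" "t \<le> T" by blast
    have h1: "\<sigma>1 h = N" using j(3)[of h] h by auto
    have fin: "Q (t - 4) \<sigma>1 \<mu>1" if "j = N"
      by (rule post) (use j that in auto)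
    have bod: "wp w (A @ asg x (Opr OpAdd (Var x) (Lit 1))) ?J (t - 4) \<sigma>1 \<mu>1" if "j < N"
    proof -
      have eq: "(N - j) * (C + 8) = (N - Suc j) * (C + 8) + (C + 8)"
        using that by (metis Suc_diff_Suc mult_Suc add.commute)
      have "wp w A (\<lambda>t \<sigma>2 \<mu>2. I (Suc j) (\<sigma>2(x := Suc j)) \<mu>2) C \<sigma>1 \<mu>1"
        using j that by (intro step) auto
      then show ?thesis
      proof (intro wp_append, elim wp_call)
        show "C \<le> t - 4" using j(6) eq by simp
        fix t' \<sigma>2 \<mu>2
        assume 2: "t - 4 - C \<le> t'" "t' \<le> t - 4" "\<And>y. y \<notin> vw A \<Longrightarrow> \<sigma>2 y = \<sigma>1 y"
          "nosto A \<Longrightarrow> \<mu>2 = \<mu>1" "I (Suc j) (\<sigma>2(x := Suc j)) \<mu>2"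
        have x: "\<sigma>2 x = j" using 2(3)[of x] h j by auto
        have t': "(N - Suc j) * (C + 8) + 4 + (T - (N * (C + 8) + 6)) \<le> t' - 4" "4 \<le> t'" "t' - 4 \<le> T"
          using 2(1,2) j(6,7) eq by simp_all
        have f: "\<forall>y. y \<noteq> x \<longrightarrow> y \<notin> vw A \<longrightarrow> (\<sigma>2(x := Suc j)) y = \<sigma> y"
          using 2(3) j(3) by simp
        have m: "nosto A \<longrightarrow> \<mu>2 = \<mu>" using 2(4) j(4) by blast
        have "?J (t' - 4) (\<sigma>2(x := Suc j)) \<mu>2"
          using 2(5) f m t' that by (intro exI[of _ "Suc j"]) simp
        then show "wp w (asg x (Opr OpAdd (Var x) (Lit 1))) ?J t' \<sigma>2 \<mu>2"
          using x t' that h by (intro wp_asg) (simp_all add: Suc_eq_plus1)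
      qed
    qed
    show "ok w (Opr OpLess (Var x) (Var h)) \<sigma>1 \<mu>1 \<and> esz (Opr OpLess (Var x) (Var h)) < t \<and>
      (if iv (Opr OpLess (Var x) (Var h)) \<sigma>1 \<mu>1 \<noteq> 0
       then wp w (A @ asg x (Opr OpAdd (Var x) (Lit 1))) ?J (t - (esz (Opr OpLess (Var x) (Var h)) + 1)) \<sigma>1 \<mu>1
       else Q (t - (esz (Opr OpLess (Var x) (Var h)) + 1)) \<sigma>1 \<mu>1)"
      using j(1,2,6) h1 fin bod by (simp add: of_bool_def)
  qed
qed

text \<open>The frame property is built in, so that invariants do not have to repeat the values of
  variables outside \<open>vw A\<close>.\<close>

lemma wp_while:
  assumes I: "I T \<sigma> \<mu>"
    and step: "\<And>T1 \<sigma>1 \<mu>1. (\<And>x. x \<notin> vw A \<Longrightarrow> \<sigma>1 x = \<sigma> x) \<Longrightarrow> I T1 \<sigma>1 \<mu>1 \<Longrightarrow>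
      ok w e \<sigma>1 \<mu>1 \<and> esz e < T1 \<and>
      (iv e \<sigma>1 \<mu>1 \<noteq> 0 \<longrightarrow> wp w A I (T1 - (esz e + 1)) \<sigma>1 \<mu>1) \<and>
      (iv e \<sigma>1 \<mu>1 = 0 \<longrightarrow> Q (T1 - (esz e + 1)) \<sigma>1 \<mu>1)"
  shows "wp w (whl e A) Q T \<sigma> \<mu>"
proof (rule wp_whl[where I = "\<lambda>T1 \<sigma>1 \<mu>1. (\<forall>x. x \<notin> vw A \<longrightarrow> \<sigma>1 x = \<sigma> x) \<and> I T1 \<sigma>1 \<mu>1"], goal_cases)
  case 1
  then show ?case using I by simp
next
  case (2 T1 \<sigma>1 \<mu>1)
  then have f: "\<And>x. x \<notin> vw A \<Longrightarrow> \<sigma>1 x = \<sigma> x" and I1: "I T1 \<sigma>1 \<mu>1" by auto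
  note s = step[OF f I1]
  have "wp w A (\<lambda>T1 \<sigma>1 \<mu>1. (\<forall>x. x \<notin> vw A \<longrightarrow> \<sigma>1 x = \<sigma> x) \<and> I T1 \<sigma>1 \<mu>1) (T1 - (esz e + 1)) \<sigma>1 \<mu>1"
    if "iv e \<sigma>1 \<mu>1 \<noteq> 0"
  proof (rule wp_call)
    show "wp w A I (T1 - (esz e + 1)) \<sigma>1 \<mu>1" using s that by simp
  qed (use f in auto)
  then show ?case using s by auto
qed

abbreviation eadd (infixl "\<oplus>" 65) where "a \<oplus> b \<equiv> Opr OpAdd a b"
abbreviation esub (infixl "\<ominus>" 65) where "a \<ominus> b \<equiv> Opr OpSub a b"
abbreviation emul (infixl "\<otimes>" 70) where "a \<otimes> b \<equiv> Opr OpMul a b"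
abbreviation ediv (infixl "\<oslash>" 70) where "a \<oslash> b \<equiv> Opr OpDiv a b"
abbreviation eless (infix "\<prec>" 50) where "a \<prec> b \<equiv> Opr OpLess a b"
abbreviation eeq (infix "\<doteq>" 50) where "a \<doteq> b \<equiv> Opr OpEq a b"

section \<open>Graph distances\<close>

lemma gdist_attained:
  assumes "gdist E u v = enat r"
  obtains p where "walk E p" "hd p = u" "last p = v" "length p = Suc r"
proof -
  let ?A = "(\<lambda>p. enat (length p - 1)) ` {p. walk E p \<and> hd p = u \<and> last p = v}"
  have 1: "Inf ?A = enat r" using assms by (simp add: gdist_def)
  then have ne: "?A \<noteq> {}" unfolding Inf_enat_def by (metis enat.distinct(1))
  then have "Inf ?A \<in> ?A"
    unfolding Inf_enat_def by (metis (mono_tags, lifting) LeastI ex_in_conv)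
  then obtain p where p: "walk E p" "hd p = u" "last p = v" "length p - 1 = r"
    using 1 by auto
  then have "length p = Suc r" by (cases p) (auto simp: walk_def)
  with p that show thesis by blast
qed

lemma gdist_le_walk:
  assumes "walk E p" "hd p = u" "last p = v"
  shows "gdist E u v \<le> enat (length p - 1)"
  unfolding gdist_def by (rule INF_lower) (use assms in auto)

lemma gdist_refl [simp]: "gdist E u u = 0"
  using gdist_le_walk[of E "[u]" u u] by (simp add: walk_def flip: zero_enat_def)

lemma gdist_commute_le: "gdist E u v \<le> gdist E v u"
proof (cases "gdist E v u")
  case (enat r)
  then obtain p where p: "walk E p" "hd p = v" "last p = u" "length p = Suc r"
    by (rule gdist_attained)
  have "walk E (rev p)"
    using p(1) by (auto simp: walk_def successively_rev insert_commute)
  then show ?thesis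
    using gdist_le_walk[of E "rev p" u v] p enat by (simp add: hd_rev last_rev walk_def)
qed simp

lemma gdist_commute: "gdist E u v = gdist E v u"
  by (rule antisym; rule gdist_commute_le)

lemma gdist_triangle: "gdist E u x \<le> gdist E u v + gdist E v x"
proof (cases "gdist E u v")
  case a: (enat a)
  show ?thesis
  proof (cases "gdist E v x")
    case b: (enat b)
    obtain p where p: "walk E p" "hd p = u" "last p = v" "length p = Suc a"
      using a by (rule gdist_attained)
    obtain p' where p': "walk E p'" "hd p' = v" "last p' = x" "length p' = Suc b"
      using b by (rule gdist_attained)
    obtain p2 where p2: "p' = v # p2" using p' by (cases p') (auto simp: walk_def)
    have "walk E (p @ p2)" "hd (p @ p2) = u" "last (p @ p2) = x"
      using p p' by (auto simp: p2 walk_def successively_append_iff successively_Cons split: if_splits)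
    then show ?thesis
      using gdist_le_walk[of E "p @ p2" u x] p p' a b by (simp add: p2)
  qed simp
qed simp

lemma gdist_edge: "{u, v} \<in> E \<Longrightarrow> gdist E u v \<le> 1"
  using gdist_le_walk[of E "[u, v]" u v] by (simp add: walk_def one_enat_def One_nat_def)

lemma gdist_1_edge:
  assumes "gdist E u v = enat 1"
  shows "{u, v} \<in> E"
proof -
  obtain p where p: "walk E p" "hd p = u" "last p = v" "length p = 2"
    using gdist_attained[OF assms] by (auto simp: numeral_2_eq_2 One_nat_def)
  then obtain a b where "p = [a, b]" by (auto simp: length_Suc_conv numeral_2_eq_2)
  with p show ?thesis by (simp add: walk_def)
qed

locale kgraph =
  fixes n :: nat and E :: "nat set set"
  assumes simple: "simple_graph n E" and n_pos: "1 \<le> n"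
begin

text \<open>The value \<open>2 * n\<close> stands for \<open>\<infinity>\<close>; it is large enough to keep the triangle inequality.\<close>

definition d :: "nat \<Rightarrow> nat \<Rightarrow> nat" where
  "d u v = (case gdist E u v of enat r \<Rightarrow> r | \<infinity> \<Rightarrow> 2 * n)"

lemma edge_less: "{u, v} \<in> E \<Longrightarrow> u < n" "{u, v} \<in> E \<Longrightarrow> v < n"
  using simple by (auto simp: simple_graph_def doubleton_eq_iff)

text \<open>Cutting a shortest walk at position \<open>y\<close> leaves walks of lengths
  \<open>y\<close> and \<open>r - y\<close>; by the triangle inequality neither end point can be
  closer than that.\<close>

lemma gdist_geodesic:
  assumes "u < n" "gdist E u v = enat r" "y \<le> r"
  obtains x where "x < n" "gdist E u x = enat y" "gdist E x v = enat (r - y)"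
proof -
  obtain p where p: "walk E p" "hd p = u" "last p = v" "length p = Suc r"
    using assms by (elim gdist_attained)
  define x where "x = p ! y"
  have p_ne: "p \<noteq> []" using p by auto
  have "walk E (take (Suc y) p)"
    using p by (auto simp: walk_def successively_conv_nth)
  moreover have "hd (take (Suc y) p) = u" using p by simp
  moreover have "last (take (Suc y) p) = x"
    using p assms(3) by (simp add: x_def take_Suc_conv_app_nth)
  ultimately have 1: "gdist E u x \<le> enat y"
    using gdist_le_walk[of E "take (Suc y) p" u x] p assms(3) by (simp add: min_def split: if_splits)
  have "walk E (drop y p)"
    using p assms(3) by (auto simp: walk_def successively_conv_nth)
  moreover have "hd (drop y p) = x" using p assms(3) by (simp add: x_def hd_drop_conv_nth)
  moreover have "last (drop y p) = v" using p assms(3) by (simp add: last_drop)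
  ultimately have 2: "gdist E x v \<le> enat (r - y)"
    using gdist_le_walk[of E "drop y p" x v] p by simp
  have 3: "enat r \<le> gdist E u x + gdist E x v"
    using gdist_triangle[of E u v x] assms by simp
  obtain a b where ab: "gdist E u x = enat a" "gdist E x v = enat b"
    using 1 2 by (metis enat_ord_simps(5) not_infinity_eq enat.exhaust infinity_ileE)
  have "x < n"
  proof (cases y)
    case 0
    then show ?thesis using p assms(1) p_ne by (simp add: x_def hd_conv_nth)
  next
    case (Suc j)
    then have "{p ! j, x} \<in> E"
      using p assms(3) unfolding x_def walk_def successively_conv_nth by auto
    then show ?thesis by (rule edge_less)
  qed
  then show thesis
    using 1 2 3 ab assms(3) by (intro that[of x]) auto
qed

text \<open>A geodesic supplies a vertex at each of the distances \<open>0, ..., r\<close>, and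
  these \<open>r + 1\<close> vertices are distinct.\<close>

lemma gdist_finite_less:
  assumes "u < n" "gdist E u v = enat r"
  shows "r < n"
proof -
  have "\<forall>y\<in>{..r}. \<exists>x. x < n \<and> gdist E u x = enat y"
    using assms by (auto elim: gdist_geodesic)
  then obtain f where f: "\<And>y. y \<le> r \<Longrightarrow> f y < n \<and> gdist E u (f y) = enat y"
    by (metis atMost_iff)
  have "inj_on f {..r}"
    by (rule inj_onI) (metis f atMost_iff enat.inject)
  moreover have "f ` {..r} \<subseteq> {..<n}" using f by auto
  ultimately have "card {..r} \<le> card {..<n}" by (metis card_inj_on_le finite_lessThan)
  then show ?thesis by simp
qed

lemma d_self [simp]: "d u u = 0"
  by (simp add: d_def zero_enat_def)

lemma d_commute: "d u v = d v u"
  by (simp add: d_def gdist_commute)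

lemma d_less_or_inf: "u < n \<Longrightarrow> d u v < n \<or> d u v = 2 * n"
  by (cases "gdist E u v") (auto simp: d_def dest: gdist_finite_less)

lemma d_le_inf: "u < n \<Longrightarrow> d u v \<le> 2 * n"
  using d_less_or_inf[of u v] by auto

lemma d_triangle: "u < n \<Longrightarrow> d u x \<le> d u v + d v x"
  using gdist_triangle[of E u x v] d_le_inf[of u x]
  by (auto simp: d_def split: enat.splits)

lemma d_gdist_le: "u < n \<Longrightarrow> r < 2 * n \<Longrightarrow> d u v \<le> r \<longleftrightarrow> gdist E u v \<le> enat r"
  by (auto simp: d_def split: enat.splits)

lemma d_geodesic:
  assumes "u < n" "d u v < 2 * n" "y \<le> d u v"
  shows "\<exists>x<n. d u x = y \<and> d x v = d u v - y"
proof (cases "gdist E u v")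
  case (enat r)
  then have "y \<le> r" using assms(3) by (simp add: d_def)
  from gdist_geodesic[OF assms(1) enat this] obtain x
    where "x < n" "gdist E u x = enat y" "gdist E x v = enat (r - y)" .
  then show ?thesis using enat by (intro exI[of _ x]) (simp_all add: d_def)
qed (use assms in \<open>simp add: d_def\<close>)

lemma d_edge: "{u, v} \<in> E \<Longrightarrow> d u v \<le> 1"
  using gdist_edge[of u v E] by (auto simp: d_def one_enat_def split: enat.splits)

lemma d_predecessor:
  assumes "u < n" "d u v = Suc r" "Suc r < 2 * n"
  obtains x where "x < n" "d u x = r" "{x, v} \<in> E"
proof -
  obtain x where x: "x < n" "d u x = r" "d x v = 1"
    using d_geodesic[of u v r] assms by (auto simp: One_nat_def)
  have "gdist E x v = enat 1"
    using x d_less_or_inf[OF x(1), of v] by (cases "gdist E x v") (auto simp: d_def)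
  then show thesis using that x gdist_1_edge by blast
qed

end

section \<open>The search tree\<close>

text \<open>\<open>S\<close> is the hitting set, \<open>N v\<close> the table row of vertices near \<open>v\<close>, and \<open>dS\<close> the
  distance to \<open>S\<close>.\<close>

locale ksearch = kgraph +
  fixes k :: nat and S :: "nat set" and N :: "nat \<Rightarrow> nat set" and dS :: "nat \<Rightarrow> nat" and R :: nat
  assumes k_pos: "1 \<le> k" and R_less: "R < n"
    and S_less: "\<And>s. s \<in> S \<Longrightarrow> s < n"
    and N_less: "\<And>v x. v < n \<Longrightarrow> x \<in> N v \<Longrightarrow> x < n"
    and N_ne: "\<And>v. v < n \<Longrightarrow> N v \<noteq> {}"
    and dS_le: "\<And>v s. v < n \<Longrightarrow> s \<in> S \<Longrightarrow> dS v \<le> d v s"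
    and dS_le_inf: "\<And>v. v < n \<Longrightarrow> dS v \<le> 2 * n"
    and dS_attained: "\<And>v. v < n \<Longrightarrow> dS v < 2 * n \<Longrightarrow> \<exists>s\<in>S. d v s = dS v"
    and N_ball: "\<And>v r x. v < n \<Longrightarrow> r < 2 * n \<Longrightarrow> r < dS v \<Longrightarrow> x < n \<Longrightarrow> d v x \<le> r \<Longrightarrow> x \<in> N v"
    and dS_k1: "\<And>v. v < n \<Longrightarrow> k = 1 \<Longrightarrow> dS v = 0"
begin

definition "h = R div (2 * k - 1)"
definition "D = 2 * R - h"
text \<open>The two ways to find the last center pull \<open>rho\<close> in opposite directions:
  \<open>R + 2 * rho \<le> D\<close> for tests through representatives, \<open>h \<le> rho\<close>
  for a choice from \<open>N w\<close>. Half of \<open>R - h\<close> meets the first, and also the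
  second as soon as \<open>3 * h \<le> R\<close>.\<close>

definition "rho = (R - h) div 2"

lemma h_bound: "(2 * k - 1) * h \<le> R"
  unfolding h_def by simp

text \<open>This makes every difference \<open>R - h - 2 * i * h\<close> that occurs below a true
  one rather than one truncated at 0.\<close>

lemma h_bound': "i < k \<Longrightarrow> 2 * i * h + h \<le> R"
proof -
  assume "i < k"
  then have "2 * i + 1 \<le> 2 * k - 1" by simp
  then have "(2 * i + 1) * h \<le> (2 * k - 1) * h" by (rule mult_le_mono1)
  then show ?thesis using h_bound by (simp add: algebra_simps)
qed

lemma h_le: "h \<le> R"
  using h_bound'[of 0] k_pos by simp

text \<open>The prefix \<open>X 0, \<dots>, X (i - 1)\<close> can be completed within radius \<open>D\<close>: in the first case
  the missing centers need only be looked up in \<open>S\<close>, in the second they are still arbitrary.\<close>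

definition near_completable :: "nat \<Rightarrow> (nat \<Rightarrow> nat) \<Rightarrow> bool" where
  "near_completable i X \<longleftrightarrow> (\<exists>C. finite C \<and> C \<subseteq> {..<n} \<and> card C \<le> k - i \<and>
     (\<forall>v<n. (\<forall>l<i. D < d (X l) v) \<longrightarrow> (\<exists>c\<in>C. d v c \<le> R)) \<and>
     (Suc i < k \<longrightarrow> (\<forall>c\<in>C. dS c \<le> R - h)))"

definition far_completable :: "nat \<Rightarrow> (nat \<Rightarrow> nat) \<Rightarrow> bool" where
  "far_completable i X \<longleftrightarrow> (\<exists>C. finite C \<and> C \<subseteq> {..<n} \<and> card C \<le> k - i \<and>
     (\<forall>v<n. (\<forall>l<i. R + 2 * i * h - h < d (X l) v) \<longrightarrow> (\<exists>c\<in>C. d v c \<le> R)))"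

definition completable :: "nat \<Rightarrow> (nat \<Rightarrow> nat) \<Rightarrow> bool" where
  "completable i X \<longleftrightarrow> near_completable i X \<or> far_completable i X"

text \<open>The value \<open>b\<close> is one more than the largest \<open>dS\<close> among the
  vertices beyond the threshold \<open>t\<close>, so that 0 can mean that there are none. In that
  case \<open>w\<close> is an arbitrary vertex, and \<open>N w\<close> still makes sense.\<close>

definition farthest :: "nat \<Rightarrow> (nat \<Rightarrow> nat) \<Rightarrow> nat \<Rightarrow> nat \<Rightarrow> nat \<Rightarrow> bool" where
  "farthest i X t b w \<longleftrightarrow> w < n \<and>
     (\<forall>z<n. (\<forall>l<i. t < d (X l) z) \<longrightarrow> dS z < b) \<and>
     (b \<noteq> 0 \<longrightarrow> b = dS w + 1 \<and> (\<forall>l<i. t < d (X l) w))"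

text \<open>If a center \<open>c\<close> has some \<open>s\<close> of \<open>S\<close> within
  \<open>R - h\<close>, then all that \<open>c\<close> covers lies within
  \<open>R + (R - h) = D\<close> of \<open>s\<close>; so \<open>s\<close> can take its
  place.\<close>

lemma near_completable_step:
  assumes "near_completable i X" "Suc i < k" "w < n"
  shows "\<exists>x\<in>S \<union> N w. near_completable (Suc i) (X(i := x))"
proof -
  obtain C where C: "finite C" "C \<subseteq> {..<n}" "card C \<le> k - i"
    "\<And>v. v < n \<Longrightarrow> \<forall>l<i. D < d (X l) v \<Longrightarrow> \<exists>c\<in>C. d v c \<le> R" "\<forall>c\<in>C. dS c \<le> R - h"
    using assms(1,2) unfolding near_completable_def by blast
  show ?thesis
  proof (cases "C = {}")
    \<comment> \<open>Everything is covered already, so any candidate keeps the prefix completable;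
      \<open>N w\<close> supplies one even if \<open>S\<close> is empty.\<close>
    case True
    obtain x where "x \<in> N w" using N_ne assms(3) by blast
    have "near_completable (Suc i) (X(i := x))"
      unfolding near_completable_def using C(4) True by (intro exI[of _ "{}"]) (auto simp: less_Suc_eq)
    then show ?thesis using \<open>x \<in> N w\<close> by blast
  next
    case False
    then obtain c where c: "c \<in> C" by blast
    then have cn: "c < n" using C by auto
    have "dS c < 2 * n" using C(5) c R_less by fastforce
    then obtain s where s: "s \<in> S" "d c s = dS c" using dS_attained cn by blast
    have "near_completable (Suc i) (X(i := s))"
      unfolding near_completable_def
    proof (intro exI[of _ "C - {c}"] conjI allI impI)
      show "card (C - {c}) \<le> k - Suc i" using C c by simp
      show "\<forall>c\<in>C - {c}. dS c \<le> R - h" using C by blast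
      fix v assume v: "v < n" "\<forall>l<Suc i. D < d ((X(i := s)) l) v"
      then have "\<forall>l<i. D < d (X l) v"
        by (metis fun_upd_other less_SucI nat_neq_iff)
      then obtain c' where c': "c' \<in> C" "d v c' \<le> R" using C v by blast
      have "c' \<noteq> c"
      proof
        assume "c' = c"
        then have "d v s \<le> R + dS c" using d_triangle[OF v(1), of s c] c' s by simp
        moreover have "D < d s v" using v(2) by force
        moreover have "dS c \<le> R - h" using C c by blast
        ultimately show False using h_le d_commute[of s v] by (simp add: D_def)
      qed
      then show "\<exists>c\<in>C - {c}. d v c \<le> R" using c' by blast
    qed (use C in auto)
    then show ?thesis using s by blast
  qed
qed

lemma far_completable_step:
  assumes "far_completable i X" "Suc i < k" "farthest i X (R + 2 * i * h - h) b w" "\<forall>l<i. X l < n"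
  shows "\<exists>x\<in>S \<union> N w. completable (Suc i) (X(i := x))"
proof -
  let ?t = "R + 2 * i * h - h"
  obtain C where C: "finite C" "C \<subseteq> {..<n}" "card C \<le> k - i"
    "\<And>v. v < n \<Longrightarrow> \<forall>l<i. ?t < d (X l) v \<Longrightarrow> \<exists>c\<in>C. d v c \<le> R"
    using assms(1) unfolding far_completable_def by blast
  have w: "w < n" using assms(3) by (simp add: farthest_def)
  have ih: "2 * Suc i * h + h \<le> R" "2 * i * h + h \<le> R"
    using h_bound'[of "Suc i"] h_bound'[of i] assms(2) by simp_all
  have tD: "?t \<le> D" using ih by (simp add: D_def)
  \<comment> \<open>Centers that cover nothing new can be dropped.\<close>
  define C' where "C' = {c\<in>C. \<exists>v<n. (\<forall>l<i. D < d (X l) v) \<and> d v c \<le> R}"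
  have sub: "C' \<subseteq> C" by (auto simp: C'_def)
  show ?thesis
  proof (cases "\<forall>c\<in>C'. dS c \<le> R - h")
    case True
    have "near_completable i X"
      unfolding near_completable_def
    proof (intro exI[of _ C'] conjI allI impI)
      show "finite C'" "C' \<subseteq> {..<n}" using sub C by (auto intro: finite_subset)
      show "card C' \<le> k - i" using C sub by (meson card_mono le_trans)
      show "\<forall>c\<in>C'. dS c \<le> R - h" by (rule True)
      fix v assume v: "v < n" "\<forall>l<i. D < d (X l) v"
      then have "\<forall>l<i. ?t < d (X l) v" using tD by (meson le_less_trans)
      then obtain c where "c \<in> C" "d v c \<le> R" using C v by blast
      then show "\<exists>c\<in>C'. d v c \<le> R" using v by (auto simp: C'_def)
    qed
    from near_completable_step[OF this assms(2) w] show ?thesis by (auto simp: completable_def)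
  next
    case False
    then obtain c where c: "c \<in> C'" "R - h < dS c" by (meson not_le)
    then obtain v where v: "v < n" "\<forall>l<i. D < d (X l) v" "d v c \<le> R" by (auto simp: C'_def)
    have cn: "c < n" using c sub C by auto
    \<comment> \<open>A point on the way from \<open>c\<close> to \<open>v\<close>, far enough from \<open>X\<close> and from \<open>S\<close>.\<close>
    obtain x where x: "x < n" "d c x = min (2 * i * h) (d c v)" "d x v = d c v - min (2 * i * h) (d c v)"
      using d_geodesic[OF cn, of v "min (2 * i * h) (d c v)"] v(3) R_less by (auto simp: d_commute)
    \<comment> \<open>If \<open>d c v \<le> 2 * i * h\<close>, then \<open>x\<close> is at distance
      0 from \<open>v\<close> and \<open>?t \<le> D\<close> suffices. Otherwise
      \<open>d x v \<le> R - 2 * i * h\<close>, and \<open>D - (R - 2 * i * h)\<close> is exactly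
      \<open>?t\<close>.\<close>
    have "?t < d (X l) x" if l: "l < i" for l
    proof -
      have "d (X l) v \<le> d (X l) x + d x v" using d_triangle assms(4) l by blast
      moreover have "D < d (X l) v" using v l by blast
      ultimately show ?thesis
        using x v(3) ih h_le by (auto simp: D_def d_commute[of v c] min_def split: if_splits)
    qed
    then have dSx: "dS x < b" using assms(3) x by (auto simp: farthest_def)
    \<comment> \<open>\<open>dS\<close> is 1-Lipschitz, also where it takes the value for
      infinity.\<close>
    have "dS c \<le> d c x + dS x"
    proof (cases "dS x < 2 * n")
      case True
      then obtain s where s: "s \<in> S" "d x s = dS x" using dS_attained x by blast
      then show ?thesis using dS_le[OF cn s(1)] d_triangle[OF cn, of s x] by simp
    next
      case False
      then show ?thesis using dS_le_inf[OF cn] by simp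
    qed
    moreover have "dS x \<le> dS w" using dSx assms(3) by (auto simp: farthest_def)
    moreover have "d c x \<le> 2 * i * h" using x(2) by simp
    \<comment> \<open>The choice of \<open>w\<close> as farthest from \<open>S\<close> enters here:
      \<open>R - h < dS c \<le> 2 * i * h + dS x\<close> and \<open>dS x \<le> dS w\<close>.\<close>
    ultimately have dSw: "R - h - 2 * i * h < dS w" using c(2) ih(2) by linarith
    have "\<forall>l<i. ?t < d (X l) w" using assms(3) dSx by (auto simp: farthest_def)
    then obtain c' where c': "c' \<in> C" "d w c' \<le> R" using C(4)[OF w] by blast
    \<comment> \<open>The point \<open>a\<close> goes from \<open>w\<close> towards
      \<open>c'\<close> as far as the ball known to lie in \<open>N w\<close> reaches; at most
      \<open>(2 * i + 1) * h\<close> of the way remains.\<close>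
    obtain a where a: "a < n" "d w a = min (R - h - 2 * i * h) (d w c')"
      "d a c' = d w c' - min (R - h - 2 * i * h) (d w c')"
      using d_geodesic[OF w, of c' "min (R - h - 2 * i * h) (d w c')"] c' R_less by auto
    have aN: "a \<in> N w"
      using N_ball[OF w _ dSw a(1)] a(2) R_less by auto
    have ac: "d a c' \<le> 2 * i * h + h"
      using a(3) c'(2) ih by (auto simp: min_def)
    \<comment> \<open>The threshold of level \<open>Suc i\<close> is
      \<open>R + (2 * i + 1) * h\<close>, the radius of \<open>c'\<close> plus the bound on its
      distance from \<open>a\<close>. Vertices beyond it are not served by \<open>c'\<close>, which
      can therefore be dropped.\<close>
    have "far_completable (Suc i) (X(i := a))"
      unfolding far_completable_def
    proof (intro exI[of _ "C - {c'}"] conjI allI impI)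
      show "card (C - {c'}) \<le> k - Suc i" using C c' by simp
      fix v assume v: "v < n" "\<forall>l<Suc i. R + 2 * Suc i * h - h < d ((X(i := a)) l) v"
      have "?t \<le> R + 2 * Suc i * h - h" by simp
      then have "\<forall>l<i. ?t < d (X l) v"
        using v(2) by (metis fun_upd_other le_less_trans less_SucI nat_neq_iff)
      then obtain c2 where c2: "c2 \<in> C" "d v c2 \<le> R" using C v by blast
      have "c2 \<noteq> c'"
      proof
        assume "c2 = c'"
        then have "d a v \<le> d a c' + R" using d_triangle[OF a(1), of v c'] c2 d_commute[of v c'] by simp
        moreover have "R + 2 * Suc i * h - h < d a v" using v(2) by force
        ultimately show False using ac by simp
      qed
      then show "\<exists>c\<in>C - {c'}. d v c \<le> R" using c2 by blast
    qed (use C in auto)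
    then show ?thesis using aN by (auto simp: completable_def)
  qed
qed

lemma completable_step:
  assumes "completable i X" "Suc i < k" "farthest i X (R + 2 * i * h - h) b w" "\<forall>l<i. X l < n"
  shows "\<exists>x\<in>S \<union> N w. completable (Suc i) (X(i := x))"
  using assms far_completable_step near_completable_step
  unfolding completable_def farthest_def by blast

text \<open>At the last level the two kinds of completion merge: the threshold
  \<open>R + 2 * i * h - h\<close> is at most \<open>D\<close> there, and no condition on the
  distance to \<open>S\<close> is imposed.\<close>

lemma completable_leaf:
  assumes "completable i X" "Suc i = k"
  shows "\<exists>c<n. \<forall>v<n. (\<forall>l<i. D < d (X l) v) \<longrightarrow> d v c \<le> R"
proof -
  have "2 * i * h + h \<le> R" using h_bound' assms(2) by auto
  then have tD: "R + 2 * i * h - h \<le> D" by (simp add: D_def)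
  have 1: "k - i = 1" using assms(2) by simp
  have 2: "(\<forall>l<i. R + 2 * i * h - h < d (X l) v)" if "\<forall>l<i. D < d (X l) v" for v
    using that tD le_less_trans by blast
  have "near_completable i X"
    using assms(1) unfolding completable_def
  proof
    assume "far_completable i X"
    then obtain C where "finite C" "C \<subseteq> {..<n}" "card C \<le> k - i"
      "\<forall>v<n. (\<forall>l<i. R + 2 * i * h - h < d (X l) v) \<longrightarrow> (\<exists>c\<in>C. d v c \<le> R)"
      unfolding far_completable_def by blast
    then show ?thesis
      unfolding near_completable_def using 2 assms(2) by (intro exI[of _ C]) simp
  qed
  then obtain C where C: "finite C" "C \<subseteq> {..<n}" "card C \<le> 1"
    "\<And>v. v < n \<Longrightarrow> \<forall>l<i. D < d (X l) v \<Longrightarrow> \<exists>c\<in>C. d v c \<le> R"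
    unfolding near_completable_def 1 by auto
  show ?thesis
  proof (cases "C = {}")
    \<comment> \<open>Without remaining centers nothing is uncovered, and any vertex will
      do.\<close>
    case True
    then show ?thesis using C n_pos by (intro exI[of _ 0]) auto
  next
    case False
    then have "card C = 1" using C by (metis One_nat_def card_0_eq le_SucE le_zero_eq)
    then obtain c where "C = {c}" by (metis card_1_singletonE)
    then show ?thesis using C by (intro exI[of _ c]) auto
  qed
qed

text \<open>The triangle through \<open>z\<close> shows that a true last center \<open>c\<close>
  passes the test against a representative \<open>s\<close> of any uncovered \<open>z\<close>; the
  test rejects no such center.\<close>

lemma leaf_near_complete:
  assumes "c < n" "\<forall>v<n. (\<forall>l<i. D < d (X l) v) \<longrightarrow> d v c \<le> R"
    and "z < n" "\<forall>l<i. D < d (X l) z" "d z s \<le> rho" "s < n"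
  shows "d c s \<le> R + rho"
  using d_triangle[OF assms(1), of s z] assms d_commute[of c z] by fastforce

text \<open>Since \<open>rho\<close> is half of \<open>R - h\<close> rounded down,
  \<open>R + 2 * rho \<le> 2 * R - h = D\<close>.\<close>

lemma leaf_near_sound:
  assumes "z < n" "d z s \<le> rho" "d u s \<le> R + rho"
  shows "d u z \<le> D"
  using d_triangle[OF assms(1), of u s] assms h_le
  by (auto simp: D_def rho_def d_commute[of s u] d_commute[of u z])

text \<open>Walking \<open>rho\<close> steps from \<open>w\<close> towards \<open>c\<close> stays
  inside \<open>N w\<close> and ends within \<open>R - rho \<le> R - h\<close> of \<open>c\<close>
  (or at \<open>c\<close>), hence within \<open>D\<close> of all that \<open>c\<close> covers. The
  inequality \<open>h \<le> rho\<close> requires \<open>k \<ge> 2\<close>; for \<open>k = 1\<close>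
  the case is void because \<open>dS\<close> vanishes.\<close>

lemma leaf_far_complete:
  assumes c: "c < n" "\<forall>v<n. (\<forall>l<i. D < d (X l) v) \<longrightarrow> d v c \<le> R"
    and w: "w < n" "\<forall>l<i. D < d (X l) w" "rho < dS w"
  shows "\<exists>u\<in>N w. \<forall>z<n. (\<forall>l<i. D < d (X l) z) \<longrightarrow> d u z \<le> D"
proof -
  have "k \<noteq> 1" using dS_k1[OF w(1)] w(3) by auto
  then have "2 * 1 * h + h \<le> R" using h_bound'[of 1] k_pos by simp
  then have hr: "h \<le> rho" by (simp add: rho_def)
  have wc: "d w c \<le> R" using c w by blast
  obtain u where u: "u < n" "d w u = min rho (d w c)" "d u c = d w c - min rho (d w c)"
    using d_geodesic[OF w(1), of c "min rho (d w c)"] wc R_less by auto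
  have "u \<in> N w"
  proof (rule N_ball[OF w(1) _ w(3) u(1)])
    have "rho \<le> R" unfolding rho_def using div_le_dividend[of "R - h" 2] by linarith
    then show "rho < 2 * n" using R_less by simp
    show "d w u \<le> rho" using u(2) by simp
  qed
  moreover have "d u z \<le> D" if "z < n" "\<forall>l<i. D < d (X l) z" for z
  proof -
    have "d z c \<le> R" using c that by blast
    then show ?thesis
      using d_triangle[OF u(1), of z c] u(3) wc hr h_le by (auto simp: D_def d_commute[of c z] min_def split: if_splits)
  qed
  ultimately show ?thesis by blast
qed

text \<open>With nothing chosen every vertex counts as uncovered, so a set of centers of radius
  \<open>R\<close> is itself a completion. This starts the search.\<close>

lemma completable_0:
  assumes "k_radius n E k \<le> enat R"
  shows "completable 0 X"
proof -
  have "k_radius n E k < enat (Suc R)" using assms by (simp add: order_le_less_trans)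
  then obtain C where C: "C \<subseteq> {..<n}" "card C = k" "(SUP v\<in>{..<n}. set_gdist E v C) < enat (Suc R)"
    unfolding k_radius_def INF_less_iff by blast
  have fin: "finite C" using C finite_subset by blast
  have "\<exists>c\<in>C. d v c \<le> R" if "v < n" for v
  proof -
    have "set_gdist E v C \<le> (SUP v\<in>{..<n}. set_gdist E v C)" using that by (intro SUP_upper) simp
    then have "set_gdist E v C < enat (Suc R)" using C(3) by (rule le_less_trans)
    then obtain c where c: "c \<in> C" "gdist E v c < enat (Suc R)"
      unfolding set_gdist_def INF_less_iff by blast
    then have "gdist E v c \<le> enat R" by (cases "gdist E v c") auto
    then show ?thesis using c d_gdist_le[OF that, of R c] R_less by auto
  qed
  then have "far_completable 0 X"
    unfolding far_completable_def using C fin by (intro exI[of _ C]) auto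
  then show ?thesis by (simp add: completable_def)
qed

end

section \<open>Breadth-first search\<close>

context kgraph begin

lemma d_eq_0: "u < n \<Longrightarrow> d u v = 0 \<Longrightarrow> v = u"
proof -
  assume "u < n" "d u v = 0"
  then have "gdist E u v = enat 0" using n_pos by (auto simp: d_def split: enat.splits)
  then obtain p where "hd p = u" "last p = v" "length p = Suc 0" by (rule gdist_attained)
  then show ?thesis by (cases p) auto
qed

text \<open>\<open>qu\<close> is the queue with write position \<open>qt\<close>, \<open>lab\<close> the distance labels so far.\<close>

definition bfs_queue :: "nat \<Rightarrow> nat \<Rightarrow> (nat \<Rightarrow> nat) \<Rightarrow> (nat \<Rightarrow> nat) \<Rightarrow> bool" where
  "bfs_queue s qt qu lab \<longleftrightarrow> 1 \<le> qt \<and> inj_on qu {..<qt} \<and>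
     (\<forall>i<qt. qu i < n \<and> d s (qu i) < 2 * n) \<and> qu 0 = s \<and>
     (\<forall>i j. i < j \<longrightarrow> j < qt \<longrightarrow> d s (qu i) \<le> d s (qu j)) \<and>
     (\<forall>u<n. lab u = (if u \<in> qu ` {..<qt} then d s u else 2 * n))"

text \<open>The two-layer invariant, with \<open>qh\<close> the read position. Once
  \<open>qh = qt\<close> only the first clause remains: the queue is closed under edges.\<close>

definition bfs_head :: "nat \<Rightarrow> nat \<Rightarrow> nat \<Rightarrow> (nat \<Rightarrow> nat) \<Rightarrow> bool" where
  "bfs_head s qh qt qu \<longleftrightarrow> (\<forall>i<qh. \<forall>u. {qu i, u} \<in> E \<longrightarrow> u \<in> qu ` {..<qt}) \<and>
     (qh < qt \<longrightarrow> (\<forall>i<qt. d s (qu i) \<le> d s (qu qh) + 1) \<and>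
       (\<forall>x<n. d s x \<le> d s (qu qh) \<longrightarrow> x \<in> qu ` {..<qt}))"

lemma bfs_queue_cong:
  assumes "\<And>i. i < qt \<Longrightarrow> qu i = qu' i" "\<And>u. u < n \<Longrightarrow> lab u = lab' u"
  shows "bfs_queue s qt qu lab \<longleftrightarrow> bfs_queue s qt qu' lab'"
proof -
  have 1: "qu ` {..<qt} = qu' ` {..<qt}" using assms(1) by force
  have 2: "inj_on qu {..<qt} = inj_on qu' {..<qt}" by (rule inj_on_cong) (use assms in auto)
  have 3: "(\<forall>i<qt. qu i < n \<and> d s (qu i) < 2 * n) = (\<forall>i<qt. qu' i < n \<and> d s (qu' i) < 2 * n)"
    using assms(1) by auto
  have 4: "(\<forall>i j. i < j \<longrightarrow> j < qt \<longrightarrow> d s (qu i) \<le> d s (qu j)) =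
      (\<forall>i j. i < j \<longrightarrow> j < qt \<longrightarrow> d s (qu' i) \<le> d s (qu' j))"
    using assms(1) by auto
  have 5: "(\<forall>u<n. lab u = (if u \<in> qu' ` {..<qt} then d s u else 2 * n)) =
     (\<forall>u<n. lab' u = (if u \<in> qu' ` {..<qt} then d s u else 2 * n))"
    using assms(2) by auto
  show ?thesis
    unfolding bfs_queue_def 1 2 3 4 5 using assms(1)[of 0] by auto
qed

lemma bfs_head_cong:
  assumes "\<And>i. i < qt \<Longrightarrow> qu i = qu' i" "qh \<le> qt"
  shows "bfs_head s qh qt qu \<longleftrightarrow> bfs_head s qh qt qu'"
proof -
  have 1: "qu ` {..<qt} = qu' ` {..<qt}" using assms(1) by force
  show ?thesis
    unfolding bfs_head_def 1 using assms by auto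
qed

lemma bfs_queue_le: "bfs_queue s qt qu lab \<Longrightarrow> qt \<le> n"
proof -
  assume "bfs_queue s qt qu lab"
  then have "inj_on qu {..<qt}" "qu ` {..<qt} \<subseteq> {..<n}" by (auto simp: bfs_queue_def)
  then have "card {..<qt} \<le> card {..<n}" by (rule card_inj_on_le) simp
  then show ?thesis by simp
qed

lemma bfs_init:
  assumes "s < n"
  shows "bfs_queue s 1 (\<lambda>_. s) ((\<lambda>_. 2 * n)(s := 0))" "bfs_head s 0 1 (\<lambda>_. s)"
proof -
  have "x = s" if "d s x = 0" for x using d_eq_0[OF assms that] .
  then show "bfs_queue s 1 (\<lambda>_. s) ((\<lambda>_. 2 * n)(s := 0))" "bfs_head s 0 1 (\<lambda>_. s)"
    using assms by (auto simp: bfs_queue_def bfs_head_def lessThan_Suc One_nat_def)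
qed

text \<open>All vertices up to the head's distance are queued, so an unqueued neighbour is strictly
  farther, and by the edge exactly one farther. Its label is therefore final.\<close>

lemma bfs_push:
  assumes q: "bfs_queue s qt qu lab" "bfs_head s qh qt qu" "qh < qt" "s < n"
    and u: "{qu qh, u} \<in> E" "u \<notin> qu ` {..<qt}"
  shows "bfs_queue s (Suc qt) (qu(qt := u)) (lab(u := d s (qu qh) + 1))"
    "bfs_head s qh (Suc qt) (qu(qt := u))"
proof -
  have un: "u < n" using u edge_less by blast
  have fin: "d s (qu qh) < n" using q d_less_or_inf[of s "qu qh"] by (auto simp: bfs_queue_def)
  have "\<not> d s u \<le> d s (qu qh)" using q u un by (auto simp: bfs_head_def)
  moreover have "d s u \<le> d s (qu qh) + 1"
    using d_triangle[OF q(4), of u "qu qh"] d_edge[OF u(1)] by simp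
  ultimately have du: "d s u = d s (qu qh) + 1" by simp
  have img: "(qu(qt := u)) ` {..<Suc qt} = insert u (qu ` {..<qt})"
    by (auto simp: lessThan_Suc)
  have inj: "inj_on (qu(qt := u)) {..<Suc qt}"
    using q u by (auto simp: bfs_queue_def inj_on_def less_Suc_eq)
  have hd: "\<forall>i<qt. d s (qu i) \<le> d s (qu qh) + 1" using q by (auto simp: bfs_head_def)
  have qt: "0 < qt" using q(3) by simp
  show "bfs_queue s (Suc qt) (qu(qt := u)) (lab(u := d s (qu qh) + 1))"
    unfolding bfs_queue_def img
    using q(1) inj un du fin hd qt by (auto simp: bfs_queue_def less_Suc_eq)
  show "bfs_head s qh (Suc qt) (qu(qt := u))"
    unfolding bfs_head_def img using q(2,3) du by (auto simp: bfs_head_def less_Suc_eq)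
qed

text \<open>The issue is a next entry that opens a new layer. A vertex of that layer has a
  predecessor in the old one, which is queued and, by sortedness, was already read; so the vertex
  has been pushed.\<close>

lemma bfs_advance:
  assumes q: "bfs_queue s qt qu lab" "bfs_head s qh qt qu" "qh < qt" "s < n"
    and nb: "\<And>u. {qu qh, u} \<in> E \<Longrightarrow> u \<in> qu ` {..<qt}"
  shows "bfs_head s (Suc qh) qt qu"
  unfolding bfs_head_def
proof (intro conjI impI allI)
  have cl: "\<And>i u. i < Suc qh \<Longrightarrow> {qu i, u} \<in> E \<Longrightarrow> u \<in> qu ` {..<qt}"
    using q(2) nb by (auto simp: bfs_head_def less_Suc_eq)
  then show "\<And>i u. i < Suc qh \<Longrightarrow> {qu i, u} \<in> E \<Longrightarrow> u \<in> qu ` {..<qt}" .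
  assume lt: "Suc qh < qt"
  have sorted: "d s (qu qh) \<le> d s (qu (Suc qh))" using q(1) lt by (auto simp: bfs_queue_def)
  show "d s (qu i) \<le> d s (qu (Suc qh)) + 1" if "i < qt" for i
    using q(2,3) sorted that by (fastforce simp: bfs_head_def)
  fix x assume x: "x < n" "d s x \<le> d s (qu (Suc qh))"
  have b: "d s (qu (Suc qh)) \<le> d s (qu qh) + 1" using q(2) lt by (auto simp: bfs_head_def)
  show "x \<in> qu ` {..<qt}"
  proof (cases "d s x \<le> d s (qu qh)")
    case True
    then show ?thesis using q(2,3) x by (auto simp: bfs_head_def)
  next
    case False
    then have e: "d s x = Suc (d s (qu qh))" "d s (qu (Suc qh)) = Suc (d s (qu qh))" using x b by auto
    have "d s (qu (Suc qh)) < 2 * n" using q(1) lt by (auto simp: bfs_queue_def)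
    then obtain y where y: "y < n" "d s y = d s (qu qh)" "{y, x} \<in> E"
      using d_predecessor[OF q(4) e(1)] e by auto
    then have "y \<in> qu ` {..<qt}" using q(2,3) by (auto simp: bfs_head_def)
    then obtain i where i: "i < qt" "y = qu i" by auto
    have "i < Suc qh"
    proof (rule ccontr)
      assume "\<not> i < Suc qh"
      then have "i = Suc qh \<or> Suc qh < i" by auto
      then have "d s (qu (Suc qh)) \<le> d s (qu i)" using q(1) i by (auto simp: bfs_queue_def)
      then show False using y i e by simp
    qed
    then show ?thesis using cl y i by blast
  qed
qed

text \<open>Induction on the distance: the queue contains \<open>s\<close> and is closed under
  edges.\<close>

lemma bfs_complete:
  assumes q: "bfs_queue s qt qu lab" "bfs_head s qt qt qu" "s < n"
    and u: "u < n" "d s u < 2 * n"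
  shows "u \<in> qu ` {..<qt}"
  using u
proof (induction "d s u" arbitrary: u)
  case 0
  then have "u = s" using d_eq_0[OF q(3), of u] by simp
  then show ?case using q(1) by (auto simp: bfs_queue_def)
next
  case (Suc r)
  then obtain x where x: "x < n" "d s x = r" "{x, u} \<in> E"
    using d_predecessor[OF q(3), of u r] by metis
  then have "x \<in> qu ` {..<qt}" using Suc by auto
  then show ?case using q(2) x by (auto simp: bfs_head_def)
qed

lemma bfs_labels:
  assumes q: "bfs_queue s qt qu lab" "bfs_head s qt qt qu" "s < n" and u: "u < n"
  shows "lab u = d s u"
proof (cases "d s u < 2 * n")
  case True
  then show ?thesis using bfs_complete[OF q u] q(1) u by (auto simp: bfs_queue_def)
next
  case False
  then have "d s u = 2 * n" using d_le_inf[OF q(3), of u] by simp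
  then show ?thesis using q(1) u by (auto simp: bfs_queue_def)
qed

text \<open>The first \<open>q\<close> queue entries are vertices nearest to \<open>s\<close>; \<open>f\<close> tells whether there are that many.\<close>

definition near_row :: "nat \<Rightarrow> nat \<Rightarrow> (nat \<Rightarrow> nat) \<Rightarrow> nat \<Rightarrow> bool" where
  "near_row q s qu f \<longleftrightarrow> (f \<noteq> 0 \<longrightarrow> inj_on qu {..<q}) \<and> (q = 1 \<longrightarrow> f \<noteq> 0) \<and>
     (\<forall>r<2 * n. (\<forall>x<n. d s x \<le> r \<longrightarrow> x \<in> qu ` {..<q}) \<or> (f \<noteq> 0 \<and> (\<forall>i<q. d s (qu i) \<le> r)))"

lemma near_row_cong:
  assumes "\<And>i. i < q \<Longrightarrow> qu i = qu' i"
  shows "near_row q s qu f \<longleftrightarrow> near_row q s qu' f"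
proof -
  have 1: "qu ` {..<q} = qu' ` {..<q}" using assms by force
  have 2: "inj_on qu {..<q} = inj_on qu' {..<q}" by (rule inj_on_cong) (use assms in auto)
  show ?thesis unfolding near_row_def 1 2 using assms by auto
qed

text \<open>A queue shorter than \<open>q\<close> contains every vertex at finite distance.
  Otherwise, if one of the first \<open>q\<close> entries is farther than \<open>r\<close>,
  sortedness puts every vertex within \<open>r\<close> before it.\<close>

lemma bfs_near_row:
  assumes q: "bfs_queue s qt qu lab" "bfs_head s qt qt qu" "s < n"
  shows "near_row q s qu (1 - of_bool (qt < q))"
  unfolding near_row_def
proof (intro conjI allI impI)
  show "inj_on qu {..<q}" if "1 - of_bool (qt < q) \<noteq> (0::nat)"
  proof (rule inj_on_subset)
    show "inj_on qu {..<qt}" using q(1) by (simp add: bfs_queue_def)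
    show "{..<q} \<subseteq> {..<qt}" using that by (cases "qt < q") auto
  qed
  \<comment> \<open>The queue contains at least \<open>s\<close>, so a row of length one is always
    full. The case \<open>k = 1\<close> relies on this.\<close>
  show "1 - of_bool (qt < q) \<noteq> (0::nat)" if "q = 1"
    using q(1) that by (simp add: bfs_queue_def)
  fix r assume r: "r < 2 * n"
  show "(\<forall>x<n. d s x \<le> r \<longrightarrow> x \<in> qu ` {..<q}) \<or> (1 - of_bool (qt < q) \<noteq> (0::nat) \<and> (\<forall>i<q. d s (qu i) \<le> r))"
  proof (cases "qt < q \<or> (\<forall>i<q. d s (qu i) \<le> r)")
    case True
    moreover have "x \<in> qu ` {..<q}" if "qt < q" "x < n" "d s x \<le> r" for x
      using bfs_complete[OF q that(2)] that r by auto
    ultimately show ?thesis by auto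
  next
    case False
    then obtain i where i: "i < q" "r < d s (qu i)" "q \<le> qt" by (auto simp: not_le)
    have "x \<in> qu ` {..<q}" if x: "x < n" "d s x \<le> r" for x
    proof -
      obtain j where j: "j < qt" "x = qu j" using bfs_complete[OF q x(1)] x r by auto
      have "\<not> i < j"
      proof
        assume "i < j"
        then have "d s (qu i) \<le> d s (qu j)" using q(1) j by (auto simp: bfs_queue_def)
        then show False using i j x by simp
      qed
      then show ?thesis using j i by auto
    qed
    then show ?thesis by blast
  qed
qed

end

subsection \<open>Adjacency lists of half-edges\<close>

text \<open>\<open>prev ep j v\<close> is one more than the last half-edge before \<open>j\<close> that leaves \<open>v\<close>, and \<open>0\<close> if there is none.\<close>

fun prev :: "(nat \<Rightarrow> nat) \<Rightarrow> nat \<Rightarrow> nat \<Rightarrow> nat" where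
  "prev ep 0 v = 0"
| "prev ep (Suc j) v = (if ep j = v then Suc j else prev ep j v)"

fun degr :: "(nat \<Rightarrow> nat) \<Rightarrow> nat \<Rightarrow> nat \<Rightarrow> nat" where
  "degr ep 0 v = 0"
| "degr ep (Suc j) v = degr ep j v + of_bool (ep j = v)"

lemma prev_le: "prev ep j v \<le> j"
  by (induction j) auto

text \<open>The half-edges between \<open>prev ep j v\<close> and \<open>j\<close> do not leave
  \<open>v\<close>, so each link followed lowers the count by exactly one. This pays for the scan of
  an adjacency list.\<close>

lemma degr_prev: "degr ep (prev ep j v) v = degr ep j v"
  by (induction j) auto

lemma prev_end: "prev ep j v = Suc e \<Longrightarrow> ep e = v"
  by (induction j) (auto split: if_splits)

lemma prev_last: "prev ep j v \<le> e \<Longrightarrow> e < j \<Longrightarrow> ep e \<noteq> v"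
  by (induction j) (auto simp: less_Suc_eq split: if_splits)

text \<open>Every half-edge leaves exactly one vertex; this bounds the total work of a breadth-first
  search.\<close>

lemma sum_degr:
  assumes "\<And>e. e < j \<Longrightarrow> ep e < n"
  shows "(\<Sum>v<n. degr ep j v) = j"
  using assms
proof (induction j)
  case (Suc j)
  have "(\<Sum>v<n. of_bool (ep j = v)) = (1::nat)"
    using Suc.prems[of j] by (simp add: of_bool_def)
  then show ?case using Suc by (simp add: sum.distrib)
qed simp

section \<open>All-pairs shortest paths\<close>

lemma row_index_less: "s < n \<Longrightarrow> u < n \<Longrightarrow> s * n + u < n * (n::nat)"
proof -
  assume "s < n" "u < n"
  then have "s * n + u < Suc s * n" "Suc s * n \<le> n * n" by (simp, intro mult_le_mono1, simp)
  then show ?thesis by (rule less_le_trans)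
qed

text \<open>Variables: 0--1 the input sizes \<open>n\<close> and \<open>m\<close>, 2--11 the array base addresses, 12 the value for
  \<open>\<infinity>\<close>, 13 the row length \<open>q\<close>, 14 the size of the hitting set, 15 its sum with \<open>q\<close>, 16--22 the
  parameters of the binary search, 23 the value \<open>n * n\<close>, and local variables from 24 on.\<close>

definition prog_fill :: "instr list" where
  "prog_fill = for_loop 24 23 (sto (Var 4 \<oplus> Var 24) (Var 12))"

text \<open>Linked adjacency lists: each half-edge stores the previous list head of its start
  vertex. Links are stored plus one, so that the initial memory content 0 ends a list.\<close>

definition prog_adj :: "instr list" where
  "prog_adj = for_loop 24 2 (asg 29 (Cell (Var 24)) @
     sto (Var 2 \<oplus> Var 24) (Cell (Var 3 \<oplus> Var 29)) @ sto (Var 3 \<oplus> Var 29) (Var 24 \<oplus> Lit 1))"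

text \<open>Half-edges \<open>2 * i\<close> and \<open>2 * i + 1\<close> are the two ends of one
  edge, so \<open>e + 1 - 2 * (e mod 2)\<close> is the partner of \<open>e\<close>.\<close>

definition prog_edges :: "instr list" where
  "prog_edges = whl (Var 31) (asg 32 (Var 31 \<ominus> Lit 1) @
     asg 33 (Cell (Var 32 \<oplus> Lit 1 \<ominus> Lit 2 \<otimes> Opr OpMod (Var 32) (Lit 2))) @
     ite (Cell (Var 25 \<oplus> Var 33) \<doteq> Var 12)
       (sto (Var 25 \<oplus> Var 33) (Var 30) @ sto (Var 26 \<oplus> Var 28) (Var 33) @ asg 28 (Var 28 \<oplus> Lit 1)) [] @
     asg 31 (Cell (Var 2 \<oplus> Var 32)))"

text \<open>The queue stays in memory afterwards: its first \<open>q\<close> cells are the row of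
  nearest vertices. The last instruction records whether it got that long.\<close>

definition prog_bfs :: "instr list" where
  "prog_bfs = asg 25 (Var 4 \<oplus> Var 24 \<otimes> Var 0) @ asg 26 (Var 5 \<oplus> Var 24 \<otimes> Var 0) @
     sto (Var 26) (Var 24) @ sto (Var 25 \<oplus> Var 24) (Lit 0) @ asg 27 (Lit 0) @ asg 28 (Lit 1) @
     whl (Var 27 \<prec> Var 28) (asg 29 (Cell (Var 26 \<oplus> Var 27)) @ asg 30 (Cell (Var 25 \<oplus> Var 29) \<oplus> Lit 1) @
       asg 31 (Cell (Var 3 \<oplus> Var 29)) @ prog_edges @ asg 27 (Var 27 \<oplus> Lit 1)) @
     sto (Var 6 \<oplus> Var 24) (Lit 1 \<ominus> (Var 28 \<prec> Var 13))"

definition prog_apsp :: "instr list" where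
  "prog_apsp = prog_fill @ prog_adj @ for_loop 24 0 prog_bfs"

text \<open>One generous bound on the word range: it exceeds all addresses and intermediate values,
  so every arithmetic operation of the program is safe.\<close>

locale kinst = kgraph +
  fixes k :: nat and es :: "(nat \<times> nat) list" and w :: nat and q :: nat
  assumes k_pos: "1 \<le> k" and k_le: "k \<le> n"
    and listing: "edge_listing E es"
    and word: "100 * (n * n + n + length es + 1) \<le> 2 ^ w"
    and q_pos: "1 \<le> q" and q_le: "q \<le> n"
begin

abbreviation "m \<equiv> length es"

text \<open>Memory layout. The input and the links of the adjacency lists take \<open>2 * m\<close>
  cells each. Then follow list heads, distance matrix, queues, row flags, greedy counters, hitting
  set, distances to it, indices of nearest members, and the marks set by the last level of the
  search.\<close>

definition "aH = 4 * m"
definition "aD = aH + n"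
definition "aQ = aD + n * n"
definition "aU = aQ + n * n"
definition "aC = aU + n"
definition "aS = aC + n"
definition "aDS = aS + n"
definition "aPS = aDS + n"
definition "aN = aPS + n"

lemmas layout = aH_def aD_def aQ_def aU_def aC_def aS_def aDS_def aPS_def aN_def

lemma one_less_word: "1 < (2::nat) ^ w"
  using word by simp

definition env :: "(nat \<Rightarrow> nat) \<Rightarrow> bool" where
  "env \<sigma> \<longleftrightarrow> \<sigma> 0 = n \<and> \<sigma> 1 = m \<and> \<sigma> 2 = 2 * m \<and> \<sigma> 3 = aH \<and> \<sigma> 4 = aD \<and> \<sigma> 5 = aQ \<and> \<sigma> 6 = aU \<and>
     \<sigma> 7 = aC \<and> \<sigma> 8 = aS \<and> \<sigma> 9 = aDS \<and> \<sigma> 10 = aPS \<and> \<sigma> 11 = aN \<and> \<sigma> 12 = 2 * n \<and> \<sigma> 13 = q \<and> \<sigma> 23 = n * n"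

lemma envD:
  assumes "env \<sigma>"
  shows "\<sigma> 0 = n" "\<sigma> 1 = m" "\<sigma> 2 = 2 * m" "\<sigma> 3 = aH" "\<sigma> 4 = aD" "\<sigma> 5 = aQ" "\<sigma> 6 = aU"
     "\<sigma> 7 = aC" "\<sigma> 8 = aS" "\<sigma> 9 = aDS" "\<sigma> 10 = aPS" "\<sigma> 11 = aN" "\<sigma> 12 = 2 * n" "\<sigma> 13 = q" "\<sigma> 23 = n * n"
  using assms by (auto simp: env_def)

lemma env_frame:
  assumes "env \<sigma>" "\<And>x. x < 14 \<or> x = 23 \<Longrightarrow> \<sigma>' x = \<sigma> x"
  shows "env \<sigma>'"
  using assms by (simp add: env_def)

text \<open>The start vertex of half-edge \<open>e\<close>, which is also the initial content of
  memory cell \<open>e\<close>.\<close>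

definition ep :: "nat \<Rightarrow> nat" where
  "ep e = (if even e then fst (es ! (e div 2)) else snd (es ! (e div 2)))"

abbreviation opposite :: "nat \<Rightarrow> nat" where
  "opposite e \<equiv> e + 1 - 2 * (e mod 2)"

lemma E_eq: "E = (\<lambda>x. {fst x, snd x}) ` set es"
  using listing by (simp add: edge_listing_def case_prod_beta)

lemma opposite_less: "e < 2 * m \<Longrightarrow> opposite e < 2 * m"
  by presburger

lemma half_edge: "e < 2 * m \<Longrightarrow> {ep e, ep (opposite e)} \<in> E"
proof -
  assume e: "e < 2 * m"
  then have x: "es ! (e div 2) \<in> set es" by (intro nth_mem) linarith
  show ?thesis
  proof (cases "even e")
    case True
    then have "opposite e = e + 1" "odd (e + 1)" "(e + 1) div 2 = e div 2" by (auto simp: even_iff_mod_2_eq_zero)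
    then show ?thesis using imageI[OF x] True by (simp add: E_eq ep_def)
  next
    case False
    then have "opposite e = e - 1" "even (e - 1)" "(e - 1) div 2 = e div 2" by (auto elim!: oddE)
    then show ?thesis using imageI[OF x] False by (simp add: E_eq ep_def insert_commute)
  qed
qed

lemma half_edge_ex:
  assumes "{u, v} \<in> E"
  obtains e where "e < 2 * m" "ep e = u" "ep (opposite e) = v"
proof -
  obtain x where x: "x \<in> set es" "{u, v} = {fst x, snd x}" using assms by (auto simp: E_eq)
  then obtain i where i: "i < m" "es ! i = x" by (auto simp: in_set_conv_nth)
  have "ep (2 * i) = fst x" "ep (2 * i + 1) = snd x" using i by (auto simp: ep_def)
  moreover have "opposite (2 * i) = 2 * i + 1" "opposite (2 * i + 1) = 2 * i" by auto
  moreover have "u = fst x \<and> v = snd x \<or> u = snd x \<and> v = fst x" using x by (auto simp: doubleton_eq_iff)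
  ultimately show thesis
    using i that[of "2 * i"] that[of "2 * i + 1"] by auto
qed

lemma ep_less: "e < 2 * m \<Longrightarrow> ep e < n"
  using half_edge edge_less by blast

lemma fill_spec:
  assumes "env \<sigma>"
  shows "wp w prog_fill (\<lambda>_ \<sigma>' \<mu>'. \<forall>a. \<mu>' a = (if aD \<le> a \<and> a < aD + n * n then 2 * n else \<mu> a))
     (n * n * 13 + 6) \<sigma> \<mu>"
  unfolding prog_fill_def
proof (rule wp_for[where N = "n * n" and C = 5 and I = "\<lambda>j \<sigma>1 \<mu>1. \<forall>a. \<mu>1 a = (if aD \<le> a \<and> a < aD + j then 2 * n else \<mu> a)"])
  fix j \<sigma>1 \<mu>1
  assume j: "j < n * n" "\<sigma>1 24 = j" "\<And>y. y \<noteq> 24 \<Longrightarrow> y \<notin> vw (sto (Var 4 \<oplus> Var 24) (Var 12)) \<Longrightarrow> \<sigma>1 y = \<sigma> y"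
    "\<forall>a. \<mu>1 a = (if aD \<le> a \<and> a < aD + j then 2 * n else \<mu> a)"
  have "\<sigma>1 4 = aD" "\<sigma>1 12 = 2 * n" using j(3) envD[OF assms] by auto
  then show "wp w (sto (Var 4 \<oplus> Var 24) (Var 12)) (\<lambda>t \<sigma>2 \<mu>2. \<forall>a. \<mu>2 a = (if aD \<le> a \<and> a < aD + Suc j then 2 * n else \<mu> a)) 5 \<sigma>1 \<mu>1"
    using j word by (intro wp_sto) (auto simp: layout)
qed (use word envD[OF assms] in auto)

definition adj_mem :: "(nat \<Rightarrow> nat) \<Rightarrow> bool" where
  "adj_mem \<mu> \<longleftrightarrow> (\<forall>e<2 * m. \<mu> e = ep e \<and> \<mu> (2 * m + e) = prev ep e (ep e)) \<and>
     (\<forall>v<n. \<mu> (aH + v) = prev ep (2 * m) v)"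

lemma adj_spec:
  assumes env: "env \<sigma>" and ini: "\<And>e. e < 2 * m \<Longrightarrow> \<mu> e = ep e" "\<And>v. v < n \<Longrightarrow> \<mu> (aH + v) = 0"
  shows "wp w prog_adj (\<lambda>_ \<sigma>' \<mu>'. adj_mem \<mu>' \<and> (\<forall>a\<ge>aD. \<mu>' a = \<mu> a)) (m * 64 + 6) \<sigma> \<mu>"
  unfolding prog_adj_def
proof (rule wp_for[where N = "2 * m" and C = 24 and I = "\<lambda>j \<sigma>1 \<mu>1. (\<forall>e<2 * m. \<mu>1 e = ep e) \<and>
    (\<forall>e<j. \<mu>1 (2 * m + e) = prev ep e (ep e)) \<and> (\<forall>v<n. \<mu>1 (aH + v) = prev ep j v) \<and> (\<forall>a\<ge>aD. \<mu>1 a = \<mu> a)"])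
  let ?A = "asg 29 (Cell (Var 24)) @ sto (Var 2 \<oplus> Var 24) (Cell (Var 3 \<oplus> Var 29)) @ sto (Var 3 \<oplus> Var 29) (Var 24 \<oplus> Lit 1)"
  fix j \<sigma>1 \<mu>1
  assume j: "j < 2 * m" "\<sigma>1 24 = j" "\<And>y. y \<noteq> 24 \<Longrightarrow> y \<notin> vw ?A \<Longrightarrow> \<sigma>1 y = \<sigma> y"
    and I: "(\<forall>e<2 * m. \<mu>1 e = ep e) \<and>
    (\<forall>e<j. \<mu>1 (2 * m + e) = prev ep e (ep e)) \<and> (\<forall>v<n. \<mu>1 (aH + v) = prev ep j v) \<and> (\<forall>a\<ge>aD. \<mu>1 a = \<mu> a)"
  have r: "\<sigma>1 2 = 2 * m" "\<sigma>1 3 = aH" using j(3) envD[OF env] by auto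
  have e: "\<mu>1 j = ep j" "\<mu>1 (aH + ep j) = prev ep j (ep j)" using I j ep_less by auto
  have ej: "ep j < n" using ep_less j by blast
  have b: "aH + ep j < 2 ^ w" "2 * m + j < 2 ^ w" "j + 1 < 2 ^ w"
    using word j ej by (auto simp: layout)
  show "wp w ?A (\<lambda>t \<sigma>2 \<mu>2. (\<forall>e<2 * m. \<mu>2 e = ep e) \<and>
    (\<forall>e<Suc j. \<mu>2 (2 * m + e) = prev ep e (ep e)) \<and> (\<forall>v<n. \<mu>2 (aH + v) = prev ep (Suc j) v) \<and> (\<forall>a\<ge>aD. \<mu>2 a = \<mu> a)) 24 \<sigma>1 \<mu>1"
    using j(1,2) I r e ej b one_less_word
    by (intro wp_append wp_asg wp_sto) (auto simp: less_Suc_eq layout)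
qed (use word envD[OF env] ini in \<open>auto simp: layout adj_mem_def\<close>)


definition row_frame :: "nat \<Rightarrow> (nat \<Rightarrow> nat) \<Rightarrow> (nat \<Rightarrow> nat) \<Rightarrow> bool" where
  "row_frame s \<mu> \<mu>' \<longleftrightarrow> (\<forall>a. \<not> (aD + s * n \<le> a \<and> a < aD + s * n + n) \<longrightarrow>
     \<not> (aQ + s * n \<le> a \<and> a < aQ + s * n + n) \<longrightarrow> \<mu>' a = \<mu> a)"

lemma row_le: "s < n \<Longrightarrow> s * n + n \<le> n * n"
  using row_index_less[of s n "n - 1"] n_pos by simp

lemma adj_mem_frame:
  assumes "adj_mem \<mu>" "row_frame s \<mu> \<mu>'" "s < n"
  shows "adj_mem \<mu>'"
proof -
  have "\<mu>' a = \<mu> a" if "a < aD" for a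
    using assms(2) that by (auto simp: row_frame_def layout)
  then show ?thesis using assms(1) by (auto simp: adj_mem_def layout)
qed

text \<open>All \<open>n\<close> cells of the queue row hold vertices, including those behind the
  write position; so even a short row can be read up to index \<open>q\<close>.\<close>

definition bfs_state :: "nat \<Rightarrow> nat \<Rightarrow> nat \<Rightarrow> (nat \<Rightarrow> nat) \<Rightarrow> bool" where
  "bfs_state s qh qt \<mu> \<longleftrightarrow> bfs_queue s qt (\<lambda>i. \<mu> (aQ + s * n + i)) (\<lambda>u. \<mu> (aD + s * n + u)) \<and>
     bfs_head s qh qt (\<lambda>i. \<mu> (aQ + s * n + i)) \<and> (\<forall>i<n. \<mu> (aQ + s * n + i) < n)"

text \<open>The list is walked from the last half-edge of \<open>v\<close> down. In the invariant,
  half-edges not below the link \<open>\<sigma>1 31\<close> are done, and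
  \<open>degr ep (\<sigma>1 31) v\<close> counts those still ahead, at 60 steps each.
  \<open>T0\<close> is the part of the budget reserved for the caller.\<close>

lemma edges_spec:
  assumes env: "env \<sigma>" and adj: "adj_mem \<mu>" and s: "s < n" and qh: "qh < \<sigma> 28" "\<mu> (aQ + s * n + qh) = v"
    and st: "bfs_state s qh (\<sigma> 28) \<mu>" and v: "v < n"
    and r: "\<sigma> 25 = aD + s * n" "\<sigma> 26 = aQ + s * n" "\<sigma> 30 = d s v + 1" "\<sigma> 31 = prev ep (2 * m) v"
    and T: "60 * degr ep (2 * m) v + 2 + T0 \<le> T"
  shows "wp w prog_edges (\<lambda>t \<sigma>' \<mu>'. T0 \<le> t \<and> row_frame s \<mu> \<mu>' \<and> qh < \<sigma>' 28 \<and> bfs_state s qh (\<sigma>' 28) \<mu>' \<and>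
     (\<forall>i\<le>qh. \<mu>' (aQ + s * n + i) = \<mu> (aQ + s * n + i)) \<and>
     (\<forall>u. {v, u} \<in> E \<longrightarrow> u \<in> (\<lambda>i. \<mu>' (aQ + s * n + i)) ` {..<\<sigma>' 28})) T \<sigma> \<mu>"
  unfolding prog_edges_def
proof (rule wp_while[where I = "\<lambda>t \<sigma>1 \<mu>1. 60 * degr ep (\<sigma>1 31) v + 2 + T0 \<le> t \<and> row_frame s \<mu> \<mu>1 \<and> qh < \<sigma>1 28 \<and>
     bfs_state s qh (\<sigma>1 28) \<mu>1 \<and> (\<forall>i\<le>qh. \<mu>1 (aQ + s * n + i) = \<mu> (aQ + s * n + i)) \<and> \<sigma>1 31 \<le> 2 * m \<and> (\<forall>e. \<sigma>1 31 = Suc e \<longrightarrow> ep e = v) \<and>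
     (\<forall>e<2 * m. \<sigma>1 31 \<le> e \<longrightarrow> ep e = v \<longrightarrow> ep (opposite e) \<in> (\<lambda>i. \<mu>1 (aQ + s * n + i)) ` {..<\<sigma>1 28})"], goal_cases)
  case 1
  show ?case
    using T qh st r prev_last[of ep "2 * m" v] prev_le[of ep "2 * m" v] prev_end[of ep "2 * m" v]
    by (auto simp: row_frame_def degr_prev)
next
  case (2 T1 \<sigma>1 \<mu>1)
  have f: "\<sigma>1 2 = 2 * m" "\<sigma>1 12 = 2 * n" "\<sigma>1 25 = aD + s * n" "\<sigma>1 26 = aQ + s * n" "\<sigma>1 30 = d s v + 1"
    using 2(1) envD[OF env] r by simp_all
  define qt where "qt = \<sigma>1 28"
  note I = 2(2)[folded qt_def]
  show ?case
  proof (cases "\<sigma>1 31")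
    case 0
    have "u \<in> (\<lambda>i. \<mu>1 (aQ + s * n + i)) ` {..<qt}" if "{v, u} \<in> E" for u
    proof -
      from that obtain e where "e < 2 * m" "ep e = v" "ep (opposite e) = u" by (rule half_edge_ex)
      then show ?thesis using I 0 by fastforce
    qed
    then show ?thesis using I 0 by (auto simp: qt_def)
  next
    case (Suc e)
    have e: "e < 2 * m" "ep e = v" using I Suc by auto
    define u where "u = ep (opposite e)"
    have u: "u < n" "{v, u} \<in> E" using half_edge[OF e(1)] edge_less e by (auto simp: u_def)
    have adj1: "adj_mem \<mu>1" using adj_mem_frame[OF adj _ s] I by blast
    have m1: "\<mu>1 (opposite e) = u" "\<mu>1 (2 * m + e) = prev ep e v"
      using adj1 e opposite_less by (auto simp: adj_mem_def u_def)
    have bq: "bfs_queue s qt (\<lambda>i. \<mu>1 (aQ + s * n + i)) (\<lambda>u. \<mu>1 (aD + s * n + u))"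
      and bh: "bfs_head s qh qt (\<lambda>i. \<mu>1 (aQ + s * n + i))" and bn: "\<forall>i<n. \<mu>1 (aQ + s * n + i) < n"
      using I by (auto simp: bfs_state_def)
    \<comment> \<open>Labels of queued vertices are finite, so the value \<open>2 * n\<close> marks
      exactly the others.\<close>
    have unvisited: "\<mu>1 (aD + s * n + u) = 2 * n \<longleftrightarrow> u \<notin> (\<lambda>i. \<mu>1 (aQ + s * n + i)) ` {..<qt}"
      using bq u by (auto simp: bfs_queue_def)
    have rl: "s * n + n \<le> n * n" using row_le s by blast
    have b: "aD + s * n + u < 2 ^ w" "aQ + s * n + n < 2 ^ w" "2 * m + e < 2 ^ w" "e + 1 < 2 ^ w" "2 * (e mod 2) \<le> e + 1"
      "2 * (e mod 2) < 2 ^ w"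
      using word rl u e by (auto simp: layout)
    have deg: "degr ep (Suc e) v = degr ep e v + 1" "degr ep (prev ep e v) v = degr ep e v"
      using e by (auto simp: degr_prev)
    have t: "60 * degr ep e v + 62 + T0 \<le> T1" using I Suc deg by auto
    have prv: "prev ep e v \<le> 2 * m" "\<And>e'. prev ep e v = Suc e' \<Longrightarrow> ep e' = v"
      "\<And>e'. e' < 2 * m \<Longrightarrow> prev ep e v \<le> e' \<Longrightarrow> ep e' = v \<Longrightarrow> e' = e \<or> Suc e \<le> e'"
      using prev_le[of ep e v] e prev_end[of ep e v] prev_last[of ep e v] by (force, force, metis not_less_eq_eq nat_neq_iff less_eq_Suc_le)
    have vis: "\<And>e'. e' < 2 * m \<Longrightarrow> Suc e \<le> e' \<Longrightarrow> ep e' = v \<Longrightarrow> ep (opposite e') \<in> (\<lambda>i. \<mu>1 (aQ + s * n + i)) ` {..<qt}"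
      using I Suc by auto
    let ?I = "\<lambda>t (\<sigma>1 :: nat \<Rightarrow> nat) \<mu>1. 60 * degr ep (\<sigma>1 31) v + 2 + T0 \<le> t \<and> row_frame s \<mu> \<mu>1 \<and> qh < \<sigma>1 28 \<and>
     bfs_state s qh (\<sigma>1 28) \<mu>1 \<and> (\<forall>i\<le>qh. \<mu>1 (aQ + s * n + i) = \<mu> (aQ + s * n + i)) \<and> \<sigma>1 31 \<le> 2 * m \<and> (\<forall>e. \<sigma>1 31 = Suc e \<longrightarrow> ep e = v) \<and>
     (\<forall>e<2 * m. \<sigma>1 31 \<le> e \<longrightarrow> ep e = v \<longrightarrow> ep (opposite e) \<in> (\<lambda>i. \<mu>1 (aQ + s * n + i)) ` {..<\<sigma>1 28})"
    have finish: "wp w (asg 31 (Cell (Var 2 \<oplus> Var 32))) ?I t \<sigma>2 \<mu>2"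
      if "60 * degr ep e v + 20 + T0 \<le> t" "row_frame s \<mu> \<mu>2" "qh < \<sigma>2 28" "bfs_state s qh (\<sigma>2 28) \<mu>2"
        "\<forall>i\<le>qh. \<mu>2 (aQ + s * n + i) = \<mu> (aQ + s * n + i)" "u \<in> (\<lambda>i. \<mu>2 (aQ + s * n + i)) ` {..<\<sigma>2 28}"
        "\<sigma>2 2 = 2 * m" "\<sigma>2 32 = e"
        "(\<lambda>i. \<mu>1 (aQ + s * n + i)) ` {..<qt} \<subseteq> (\<lambda>i. \<mu>2 (aQ + s * n + i)) ` {..<\<sigma>2 28}" for t \<sigma>2 \<mu>2
    proof -
      have "\<mu>2 (2 * m + e) = prev ep e v"
        using adj_mem_frame[OF adj that(2) s] e by (auto simp: adj_mem_def)
      moreover have "ep (opposite e') \<in> (\<lambda>i. \<mu>2 (aQ + s * n + i)) ` {..<\<sigma>2 28}"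
        if "e' < 2 * m" "prev ep e v \<le> e'" "ep e' = v" for e'
        using prv(3)[OF that]
      proof
        assume "e' = e"
        then show ?thesis using \<open>u \<in> _\<close> by (simp only: u_def)
      next
        assume "Suc e \<le> e'"
        from vis[OF that(1) this that(3)] show ?thesis using \<open>_ \<subseteq> _\<close> by (rule rev_subsetD)
      qed
      ultimately show ?thesis
        using that b prv(1,2) deg by (intro wp_asg) simp_all
    qed
    define L where "L = asg 31 (Cell (Var 2 \<oplus> Var 32))"
    define J where "J = ?I"
    have "wp w (asg 32 (Var 31 \<ominus> Lit 1) @
       asg 33 (Cell (Var 32 \<oplus> Lit 1 \<ominus> Lit 2 \<otimes> Opr OpMod (Var 32) (Lit 2))) @
       ite (Cell (Var 25 \<oplus> Var 33) \<doteq> Var 12)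
         (sto (Var 25 \<oplus> Var 33) (Var 30) @ sto (Var 26 \<oplus> Var 28) (Var 33) @ asg 28 (Var 28 \<oplus> Lit 1)) [] @
       L) J (T1 - 2) \<sigma>1 \<mu>1"
    proof (cases "\<mu>1 (aD + s * n + u) = 2 * n")
      case True
      then have new: "u \<notin> (\<lambda>i. \<mu>1 (aQ + s * n + i)) ` {..<qt}" using unvisited by blast
      have vq: "\<mu>1 (aQ + s * n + qh) = v" "qh < qt" using I qh(2) by auto
      let ?\<mu> = "\<mu>1(aD + s * n + u := d s v + 1, aQ + s * n + qt := u)"
      note push = bfs_push[OF bq bh vq(2) s u(2)[folded vq(1)] new, unfolded vq(1)]
      have qtn: "qt < n" using bfs_queue_le[OF push(1)] by simp
      have row: "?\<mu> (aQ + s * n + i) = ((\<lambda>i. \<mu>1 (aQ + s * n + i))(qt := u)) i" for i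
        using rl u by (auto simp: layout)
      have lab: "?\<mu> (aD + s * n + u') = ((\<lambda>u. \<mu>1 (aD + s * n + u))(u := d s v + 1)) u'" if "u' < n" for u'
        using rl u that by (auto simp: layout)
      have q1: "bfs_queue s (Suc qt) (\<lambda>i. ?\<mu> (aQ + s * n + i)) (\<lambda>u. ?\<mu> (aD + s * n + u))"
        using push(1) by (subst bfs_queue_cong[OF row lab]) auto
      have q2: "bfs_head s qh (Suc qt) (\<lambda>i. ?\<mu> (aQ + s * n + i))"
        using push(2) vq by (subst bfs_head_cong[OF row]) auto
      have q3: "\<forall>i<n. ?\<mu> (aQ + s * n + i) < n"
        using bn u by (simp only: row) simp
      have st': "bfs_state s qh (qt + 1) ?\<mu>"
        using q1 q2 q3 by (simp only: bfs_state_def Suc_eq_plus1 simp_thms)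
      have fr: "row_frame s \<mu> ?\<mu>" using I u qtn by (auto simp: row_frame_def)
      have img: "(\<lambda>i. ?\<mu> (aQ + s * n + i)) ` {..<qt + 1} = insert u ((\<lambda>i. \<mu>1 (aQ + s * n + i)) ` {..<qt})"
        unfolding row by (auto simp: lessThan_Suc simp flip: Suc_eq_plus1)
      have v': "\<forall>i\<le>qh. ?\<mu> (aQ + s * n + i) = \<mu> (aQ + s * n + i)" unfolding row using vq I by auto
      have "wp w L J t (\<sigma>1(32 := e, 33 := u, 28 := qt + 1)) ?\<mu>" if "60 * degr ep e v + 20 + T0 \<le> t" for t
        unfolding L_def J_def by (rule finish) (use that fr vq st' img f v' in auto)
      then show ?thesis
        using t f Suc m1 b word True qtn
        by (intro wp_append wp_asg wp_ite wp_sto wp_Nil) (simp_all add: qt_def[symmetric])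
    next
      case False
      then have old: "u \<in> (\<lambda>i. \<mu>1 (aQ + s * n + i)) ` {..<qt}" using unvisited by blast
      have "wp w L J t (\<sigma>1(32 := e, 33 := u)) \<mu>1" if "60 * degr ep e v + 20 + T0 \<le> t" for t
        unfolding L_def J_def by (rule finish) (use that I old f in \<open>simp_all add: qt_def\<close>)
      then show ?thesis
        using t f Suc m1 b word False by (intro wp_append wp_asg wp_ite wp_sto wp_Nil) simp_all
    qed
    then show ?thesis using Suc t by (simp add: L_def J_def)
  qed
qed

lemma bfs_spec:
  assumes env: "env \<sigma>" and adj: "adj_mem \<mu>" and s: "s < n" "\<sigma> 24 = s"
    and ini: "\<And>u. u < n \<Longrightarrow> \<mu> (aD + s * n + u) = 2 * n" "\<And>i. i < n \<Longrightarrow> \<mu> (aQ + s * n + i) < n"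
  shows "wp w prog_bfs (\<lambda>_ \<sigma>' \<mu>'. (\<forall>u<n. \<mu>' (aD + s * n + u) = d s u) \<and> (\<forall>i<n. \<mu>' (aQ + s * n + i) < n) \<and>
     near_row q s (\<lambda>i. \<mu>' (aQ + s * n + i)) (\<mu>' (aU + s)) \<and> (\<exists>\<mu>1. row_frame s \<mu> \<mu>1 \<and> (\<forall>a. a \<noteq> aU + s \<longrightarrow> \<mu>' a = \<mu>1 a)))
     (120 * m + 60 * n + 60) \<sigma> \<mu>"
proof -
  have rl: "s * n + n \<le> n * n" using row_le s by blast
  define \<mu>0 where "\<mu>0 = \<mu>(aQ + s * n := s, aD + s * n + s := 0)"
  define \<sigma>0 where "\<sigma>0 = \<sigma>(25 := aD + s * n, 26 := aQ + s * n, 27 := 0, 28 := 1)"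
  have fr0: "row_frame s \<mu> \<mu>0" using s by (auto simp: row_frame_def \<mu>0_def)
  have row0: "\<mu>0 (aQ + s * n + i) = s" if "i < 1" for i
    using that s rl by (auto simp: \<mu>0_def layout)
  have lab0: "\<mu>0 (aD + s * n + u) = ((\<lambda>_. 2 * n)(s := 0)) u" if "u < n" for u
    using that s rl ini by (auto simp: \<mu>0_def layout)
  have q0: "\<forall>i<n. \<mu>0 (aQ + s * n + i) < n"
    using ini s rl by (auto simp: \<mu>0_def layout)
  have st0: "bfs_state s 0 1 \<mu>0"
  proof -
    have "bfs_queue s 1 (\<lambda>i. \<mu>0 (aQ + s * n + i)) (\<lambda>u. \<mu>0 (aD + s * n + u))"
      by (subst bfs_queue_cong[of 1 _ "\<lambda>_. s" _ "(\<lambda>_. 2 * n)(s := 0)"]) (auto simp: row0[of 0, simplified] lab0 bfs_init(1)[OF s(1)])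
    moreover have "bfs_head s 0 1 (\<lambda>i. \<mu>0 (aQ + s * n + i))"
      by (subst bfs_head_cong[of 1 _ "\<lambda>_. s"]) (auto simp: row0[of 0, simplified] bfs_init(2)[OF s(1)])
    ultimately show ?thesis using q0 by (simp add: bfs_state_def)
  qed
  \<comment> \<open>Amortisation: reading \<open>v\<close> off the queue pays for its adjacency
    list. The remaining budget is the weight of the vertices not yet read.\<close>
  define wt where "wt = (\<lambda>v. 60 * degr ep (2 * m) v + 60)"
  have wt_total: "sum wt {..<n} = 120 * m + 60 * n"
    using sum_degr[of "2 * m" ep n] ep_less by (simp add: wt_def sum.distrib flip: sum_distrib_left)
  let ?I = "\<lambda>t \<sigma>1 \<mu>1. row_frame s \<mu> \<mu>1 \<and> bfs_state s (\<sigma>1 27) (\<sigma>1 28) \<mu>1 \<and> \<sigma>1 27 \<le> \<sigma>1 28 \<and>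
     sum wt ({..<n} - (\<lambda>i. \<mu>1 (aQ + s * n + i)) ` {..<\<sigma>1 27}) + 20 \<le> t"
  let ?body = "asg 29 (Cell (Var 26 \<oplus> Var 27)) @ asg 30 (Cell (Var 25 \<oplus> Var 29) \<oplus> Lit 1) @
       asg 31 (Cell (Var 3 \<oplus> Var 29)) @ prog_edges @ asg 27 (Var 27 \<oplus> Lit 1)"
  have loop: "wp w (whl (Var 27 \<prec> Var 28) ?body) (\<lambda>t \<sigma>1 \<mu>1. row_frame s \<mu> \<mu>1 \<and> bfs_state s (\<sigma>1 28) (\<sigma>1 28) \<mu>1 \<and> 10 \<le> t) t \<sigma>0 \<mu>0"
    if t: "120 * m + 60 * n + 20 \<le> t" for t
  proof (rule wp_while[where I = ?I], goal_cases)
    case 1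
    show ?case using t fr0 st0 wt_total by (simp add: \<sigma>0_def)
  next
    case (2 T1 \<sigma>1 \<mu>1)
    define qh where "qh = \<sigma>1 27"
    define qt where "qt = \<sigma>1 28"
    have vw_body: "vw ?body = {27, 28, 29, 30, 31, 32, 33}" by (auto simp: prog_edges_def)
    have f: "\<sigma>1 25 = aD + s * n" "\<sigma>1 26 = aQ + s * n" and env1: "env \<sigma>1"
      using 2(1) unfolding vw_body by (auto simp: \<sigma>0_def intro!: env_frame[OF env])
    note f = f envD[OF env1]
    have I: "row_frame s \<mu> \<mu>1" "bfs_state s qh qt \<mu>1" "qh \<le> qt"
      "sum wt ({..<n} - (\<lambda>i. \<mu>1 (aQ + s * n + i)) ` {..<qh}) + 20 \<le> T1"
      using 2(2) by (auto simp: qh_def qt_def)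
    show ?case
    proof (cases "qh < qt")
      case False
      then show ?thesis using I by (auto simp: qh_def qt_def)
    next
      case True
      define v where "v = \<mu>1 (aQ + s * n + qh)"
      let ?qu = "\<lambda>i. \<mu>1 (aQ + s * n + i)"
      have bq: "bfs_queue s qt ?qu (\<lambda>u. \<mu>1 (aD + s * n + u))" using I by (simp add: bfs_state_def)
      have qtn: "qt \<le> n" using bfs_queue_le[OF bq] .
      have v: "v < n" using bq True by (auto simp: bfs_queue_def v_def)
      have dv: "\<mu>1 (aD + s * n + v) = d s v" using bq True v by (auto simp: bfs_queue_def v_def)
      have vfresh: "v \<notin> ?qu ` {..<qh}"
      proof
        assume "v \<in> ?qu ` {..<qh}"
        then obtain i where i: "i < qh" "?qu i = ?qu qh" by (auto simp: v_def)
        have "inj_on ?qu {..<qt}" using bq by (simp add: bfs_queue_def)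
        from inj_onD[OF this i(2)] show False using i True by simp
      qed
      have dvn: "d s v \<le> 2 * n" using d_le_inf s by blast
      have adj1: "adj_mem \<mu>1" using adj_mem_frame[OF adj I(1) s(1)] .
      have hv: "\<mu>1 (aH + v) = prev ep (2 * m) v" using adj1 v by (simp add: adj_mem_def)
      have set_split: "{..<n} - ?qu ` {..<qh} = insert v ({..<n} - ?qu ` {..<Suc qh})"
        using v vfresh by (auto simp: lessThan_Suc v_def)
      have "v \<notin> {..<n} - ?qu ` {..<Suc qh}" by (auto simp: v_def)
      then have wt_split: "sum wt ({..<n} - ?qu ` {..<qh}) = wt v + sum wt ({..<n} - ?qu ` {..<Suc qh})"
        unfolding set_split by (subst sum.insert) auto
      let ?R = "sum wt ({..<n} - ?qu ` {..<Suc qh}) + 20"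
      have tt: "60 * degr ep (2 * m) v + 2 + (?R + 10) + 25 \<le> T1"
        using I(4) wt_split by (simp add: wt_def)
      have b: "aQ + s * n + n < 2 ^ w" "aD + s * n + v < 2 ^ w" "aH + v < 2 ^ w" "d s v + 1 < 2 ^ w" "qh + 1 < 2 ^ w"
        using word rl v dvn qtn True by (auto simp: layout)
      define \<sigma>2 where "\<sigma>2 = \<sigma>1(29 := v, 30 := d s v + 1, 31 := prev ep (2 * m) v)"
      have env2: "env \<sigma>2" using env1 by (auto simp: \<sigma>2_def intro!: env_frame[OF env1])
      have edges: "wp w prog_edges (\<lambda>t \<sigma>' \<mu>'. ?R + 10 \<le> t \<and> row_frame s \<mu>1 \<mu>' \<and> qh < \<sigma>' 28 \<and> bfs_state s qh (\<sigma>' 28) \<mu>' \<and>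
          (\<forall>i\<le>qh. \<mu>' (aQ + s * n + i) = ?qu i) \<and>
         (\<forall>u. {v, u} \<in> E \<longrightarrow> u \<in> (\<lambda>i. \<mu>' (aQ + s * n + i)) ` {..<\<sigma>' 28})) t \<sigma>2 \<mu>1"
        if "60 * degr ep (2 * m) v + 2 + (?R + 10) \<le> t" for t
        by (rule edges_spec[OF env2 adj1 s(1)])
          (use True I(2) v f that in \<open>auto simp: \<sigma>2_def qt_def v_def\<close>)
      have rest: "wp w (prog_edges @ asg 27 (Var 27 \<oplus> Lit 1)) ?I t \<sigma>2 \<mu>1"
        if "60 * degr ep (2 * m) v + 2 + (?R + 10) \<le> t" for t
      proof (rule wp_append, rule wp_call[OF edges[OF that] le_refl], goal_cases)
        case (1 t' \<sigma>3 \<mu>3)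
        have q: "?R + 10 \<le> t'" "row_frame s \<mu>1 \<mu>3" "qh < \<sigma>3 28" "bfs_state s qh (\<sigma>3 28) \<mu>3"
          "\<forall>i\<le>qh. \<mu>3 (aQ + s * n + i) = ?qu i"
          "\<forall>u. {v, u} \<in> E \<longrightarrow> u \<in> (\<lambda>i. \<mu>3 (aQ + s * n + i)) ` {..<\<sigma>3 28}"
          using 1(5) by auto
        have qhr: "\<sigma>3 27 = qh" using 1(3)[of 27] by (simp add: prog_edges_def \<sigma>2_def qh_def)
        have "bfs_head s (Suc qh) (\<sigma>3 28) (\<lambda>i. \<mu>3 (aQ + s * n + i))"
          using q by (intro bfs_advance) (auto simp: bfs_state_def v_def s(1))
        then have "bfs_state s (qh + 1) (\<sigma>3 28) \<mu>3" using q(4) by (simp add: bfs_state_def flip: Suc_eq_plus1)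
        moreover have "row_frame s \<mu> \<mu>3" using I(1) q(2) by (simp add: row_frame_def)
        moreover have "(\<lambda>i. \<mu>3 (aQ + s * n + i)) ` {..<qh + 1} = ?qu ` {..<Suc qh}"
          using q(5) by (intro image_cong) auto
        ultimately show ?case
          using q(1,3) qhr b one_less_word by (intro wp_asg) simp_all
      qed
      define L where "L = prog_edges @ asg 27 (Var 27 \<oplus> Lit 1)"
      have "wp w (asg 29 (Cell (Var 26 \<oplus> Var 27)) @ asg 30 (Cell (Var 25 \<oplus> Var 29) \<oplus> Lit 1) @
        asg 31 (Cell (Var 3 \<oplus> Var 29)) @ L) ?I (T1 - 4) \<sigma>1 \<mu>1"
        using tt f b True dv hv qtn one_less_word rest
        by (intro wp_append wp_asg) (simp_all add: L_def \<sigma>2_def flip: qh_def v_def)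
      then show ?thesis using True tt by (simp add: L_def qh_def qt_def)
    qed
  qed
  define L where "L = sto (Var 6 \<oplus> Var 24) (Lit 1 \<ominus> (Var 28 \<prec> Var 13))"
  define W where "W = whl (Var 27 \<prec> Var 28) ?body"
  have fin: "wp w (W @ L) (\<lambda>_ \<sigma>' \<mu>'. (\<forall>u<n. \<mu>' (aD + s * n + u) = d s u) \<and> (\<forall>i<n. \<mu>' (aQ + s * n + i) < n) \<and>
     near_row q s (\<lambda>i. \<mu>' (aQ + s * n + i)) (\<mu>' (aU + s)) \<and> (\<exists>\<mu>1. row_frame s \<mu> \<mu>1 \<and> (\<forall>a. a \<noteq> aU + s \<longrightarrow> \<mu>' a = \<mu>1 a))) t \<sigma>0 \<mu>0"
    if t: "120 * m + 60 * n + 20 \<le> t" for t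
    unfolding W_def
  proof (rule wp_append, rule wp_call[OF loop[OF t] le_refl], goal_cases)
    case (1 t' \<sigma>3 \<mu>3)
    have vw_body: "vw (whl (Var 27 \<prec> Var 28) ?body) = {27, 28, 29, 30, 31, 32, 33}" by (auto simp: prog_edges_def)
    have env3: "env \<sigma>3" and r24: "\<sigma>3 24 = s"
      using 1(3) s unfolding vw_body by (auto simp: \<sigma>0_def intro!: env_frame[OF env])
    have st: "row_frame s \<mu> \<mu>3" "bfs_state s (\<sigma>3 28) (\<sigma>3 28) \<mu>3" "10 \<le> t'" using 1(5) by auto
    have bq: "bfs_queue s (\<sigma>3 28) (\<lambda>i. \<mu>3 (aQ + s * n + i)) (\<lambda>u. \<mu>3 (aD + s * n + u))"
      and bh: "bfs_head s (\<sigma>3 28) (\<sigma>3 28) (\<lambda>i. \<mu>3 (aQ + s * n + i))"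
      and bn: "\<forall>i<n. \<mu>3 (aQ + s * n + i) < n"
      using st(2) by (auto simp: bfs_state_def)
    have bU: "aU + s < 2 ^ w" using word s by (auto simp: layout)
    define f where "f = (1 - of_bool (\<sigma>3 28 < q) :: nat)"
    have lab: "(\<mu>3(aU + s := f)) (aD + s * n + u) = d s u" if "u < n" for u
      using bfs_labels[OF bq bh s(1) that] rl that by (auto simp: layout)
    have row: "(\<mu>3(aU + s := f)) (aQ + s * n + i) = \<mu>3 (aQ + s * n + i)" if "i < n" for i
      using rl that by (auto simp: layout)
    have near: "near_row q s (\<lambda>i. (\<mu>3(aU + s := f)) (aQ + s * n + i)) f"
      using bfs_near_row[OF bq bh s(1), of q] q_le row
      by (subst near_row_cong[where qu' = "\<lambda>i. \<mu>3 (aQ + s * n + i)"]) (auto simp: f_def)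
    have q: "(\<forall>u<n. (\<mu>3(aU + s := f)) (aD + s * n + u) = d s u) \<and> (\<forall>i<n. (\<mu>3(aU + s := f)) (aQ + s * n + i) < n) \<and>
      near_row q s (\<lambda>i. (\<mu>3(aU + s := f)) (aQ + s * n + i)) ((\<mu>3(aU + s := f)) (aU + s)) \<and>
      (\<exists>\<mu>1. row_frame s \<mu> \<mu>1 \<and> (\<forall>a. a \<noteq> aU + s \<longrightarrow> (\<mu>3(aU + s := f)) a = \<mu>1 a))"
      using lab row near bn st(1) by (auto intro!: exI[of _ \<mu>3])
    show ?case
      unfolding L_def
    proof (rule wp_sto, goal_cases)
      case 4
      show ?case using q envD[OF env3] r24 by (simp add: f_def)
    qed (use envD[OF env3] r24 bU st one_less_word in simp_all)
  qed
  have "wp w (asg 25 (Var 4 \<oplus> Var 24 \<otimes> Var 0) @ asg 26 (Var 5 \<oplus> Var 24 \<otimes> Var 0) @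
     sto (Var 26) (Var 24) @ sto (Var 25 \<oplus> Var 24) (Lit 0) @ asg 27 (Lit 0) @ asg 28 (Lit 1) @ (W @ L))
     (\<lambda>_ \<sigma>' \<mu>'. (\<forall>u<n. \<mu>' (aD + s * n + u) = d s u) \<and> (\<forall>i<n. \<mu>' (aQ + s * n + i) < n) \<and>
     near_row q s (\<lambda>i. \<mu>' (aQ + s * n + i)) (\<mu>' (aU + s)) \<and> (\<exists>\<mu>1. row_frame s \<mu> \<mu>1 \<and> (\<forall>a. a \<noteq> aU + s \<longrightarrow> \<mu>' a = \<mu>1 a)))
     (120 * m + 60 * n + 60) \<sigma> \<mu>"
  proof -
    define WL where "WL = W @ L"
    have b: "aQ + s * n + n < 2 ^ w" "aD + s * n + s < 2 ^ w" "s * n < 2 ^ w" using word rl s by (auto simp: layout)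
    show ?thesis
      unfolding WL_def[symmetric]
      using b envD[OF env] s one_less_word fin
      by (intro wp_append wp_asg wp_sto) (simp_all add: WL_def \<sigma>0_def \<mu>0_def)
  qed
  then show ?thesis by (simp add: prog_bfs_def W_def L_def)
qed

definition tables :: "(nat \<Rightarrow> nat) \<Rightarrow> bool" where
  "tables \<mu> \<longleftrightarrow> (\<forall>s<n. \<forall>u<n. \<mu> (aD + s * n + u) = d s u) \<and>
     (\<forall>s<n. \<forall>i<n. \<mu> (aQ + s * n + i) < n)"

lemma apsp_spec:
  assumes env: "env \<sigma>"
    and ini: "\<And>e. e < 2 * m \<Longrightarrow> \<mu> e = ep e" "\<And>a. 2 * m \<le> a \<Longrightarrow> \<mu> a = 0"
  shows "wp w prog_apsp (\<lambda>_ \<sigma>' \<mu>'. tables \<mu>' \<and> (\<forall>s<n. near_row q s (\<lambda>i. \<mu>' (aQ + s * n + i)) (\<mu>' (aU + s))))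
     (n * (120 * m + 60 * n + 68) + n * n * 13 + m * 64 + 20) \<sigma> \<mu>"
  unfolding prog_apsp_def
proof (rule wp_append, rule wp_call[OF fill_spec[OF env]], goal_cases)
  case (2 t1 \<sigma>1 \<mu>1)
  have env1: "env \<sigma>1" using 2(3) by (intro env_frame[OF env]) (auto simp: prog_fill_def)
  have m1: "\<mu>1 a = (if aD \<le> a \<and> a < aD + n * n then 2 * n else \<mu> a)" for a using 2(5) by blast
  show ?case
  proof (rule wp_append, rule wp_call[OF adj_spec[OF env1]], goal_cases)
    case (4 t2 \<sigma>2 \<mu>2)
    have env2: "env \<sigma>2" using 4(3) by (intro env_frame[OF env1]) (auto simp: prog_adj_def)
    have adj: "adj_mem \<mu>2" using 4(5) by blast
    have m2: "\<mu>2 a = \<mu>1 a" if "aD \<le> a" for a using 4(5) that by blast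
    let ?I = "\<lambda>j (\<sigma>3 :: nat \<Rightarrow> nat) \<mu>3. adj_mem \<mu>3 \<and> (\<forall>s<n. \<forall>u<n. \<mu>3 (aD + s * n + u) = (if s < j then d s u else 2 * n)) \<and>
      (\<forall>s<n. \<forall>i<n. \<mu>3 (aQ + s * n + i) < n) \<and> (\<forall>s<j. near_row q s (\<lambda>i. \<mu>3 (aQ + s * n + i)) (\<mu>3 (aU + s)))"
    show ?case
    proof (rule wp_for[where I = ?I and N = n and C = "120 * m + 60 * n + 60"], goal_cases)
      case (9 j \<sigma>3 \<mu>3)
      have vwb: "vw prog_bfs = {25, 26, 27, 28, 29, 30, 31, 32, 33}"
        by (auto simp: prog_bfs_def prog_edges_def)
      have env3: "env \<sigma>3" using 9(3) vwb by (intro env_frame[OF env2]) auto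
      have adj3: "adj_mem \<mu>3" and dist3: "\<And>s u. s < n \<Longrightarrow> u < n \<Longrightarrow> \<mu>3 (aD + s * n + u) = (if s < j then d s u else 2 * n)"
        and q3: "\<And>s i. s < n \<Longrightarrow> i < n \<Longrightarrow> \<mu>3 (aQ + s * n + i) < n"
        and near3: "\<And>s. s < j \<Longrightarrow> near_row q s (\<lambda>i. \<mu>3 (aQ + s * n + i)) (\<mu>3 (aU + s))"
        using 9(5) by auto
      show ?case
      proof (rule wp_call[OF bfs_spec[OF env3 adj3 9(1,2)] le_refl], goal_cases)
        case (3 t4 \<sigma>4 \<mu>4)
        then obtain \<mu>5 where b: "\<And>u. u < n \<Longrightarrow> \<mu>4 (aD + j * n + u) = d j u" "\<And>i. i < n \<Longrightarrow> \<mu>4 (aQ + j * n + i) < n"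
          "near_row q j (\<lambda>i. \<mu>4 (aQ + j * n + i)) (\<mu>4 (aU + j))"
          and m5: "row_frame j \<mu>3 \<mu>5" "\<And>a. a \<noteq> aU + j \<Longrightarrow> \<mu>4 a = \<mu>5 a" by auto
        have rj: "j * n + n \<le> n * n" using row_le 9(1) by blast
        have same: "\<mu>4 a = \<mu>3 a" if "\<not> (aD + j * n \<le> a \<and> a < aD + j * n + n)" "\<not> (aQ + j * n \<le> a \<and> a < aQ + j * n + n)"
          "a \<noteq> aU + j" for a
          using m5 that by (auto simp: row_frame_def)
        have other: "s * n + i < j * n \<or> j * n + n \<le> s * n + i" if "s \<noteq> j" "i < n" for s i
        proof (cases "s < j")
          case True
          then have "Suc s * n \<le> j * n" by (intro mult_le_mono1) simp
          then show ?thesis using that by simp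
        next
          case False
          then have "Suc j * n \<le> s * n" using that by (intro mult_le_mono1) simp
          then show ?thesis by simp
        qed
        have sD: "\<mu>4 (aD + s * n + u) = \<mu>3 (aD + s * n + u)" if "s < n" "s \<noteq> j" "u < n" for s u
          using other[OF that(2,3)] row_index_less[OF that(1,3)] rj by (intro same) (auto simp: layout)
        have sQ: "\<mu>4 (aQ + s * n + i) = \<mu>3 (aQ + s * n + i)" if "s < n" "s \<noteq> j" "i < n" for s i
          using other[OF that(2,3)] row_index_less[OF that(1,3)] rj by (intro same) (auto simp: layout)
        have sU: "\<mu>4 (aU + s) = \<mu>3 (aU + s)" if "s < j" for s
          using that rj by (intro same) (auto simp: layout)
        have "near_row q s (\<lambda>i. \<mu>4 (aQ + s * n + i)) (\<mu>4 (aU + s))" if "s < j" for s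
          using near3[OF that] sQ[of s] sU[OF that] that 9(1) q_le
          by (subst near_row_cong[where qu' = "\<lambda>i. \<mu>3 (aQ + s * n + i)"]) auto
        moreover have "adj_mem \<mu>4"
        proof -
          have "\<mu>4 a = \<mu>3 a" if "a < aD" for a using that by (intro same) (auto simp: layout)
          then show ?thesis using adj3 by (auto simp: adj_mem_def layout)
        qed
        moreover have "\<mu>4 (aD + s * n + u) = (if s < Suc j then d s u else 2 * n)" if "s < n" "u < n" for s u
          using sD[of s u] b(1)[of u] dist3[of s u] that by (cases "s = j") auto
        moreover have "\<mu>4 (aQ + s * n + i) < n" if "s < n" "i < n" for s i
          using sQ[of s i] b(2)[of i] q3[of s i] that by (cases "s = j") auto
        ultimately show ?case using b(3) by (simp add: less_Suc_eq)
      qed (use dist3 q3 9(1) in auto)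
    next
      case (8)
      have "\<mu>2 (aD + s * n + u) = 2 * n" if "s < n" "u < n" for s u
        using m2[of "aD + s * n + u"] m1[of "aD + s * n + u"] row_index_less[OF that] by (simp add: layout)
      moreover have "\<mu>2 (aQ + s * n + i) = 0" if "s < n" "i < n" for s i
        using m2[of "aQ + s * n + i"] m1[of "aQ + s * n + i"] ini(2) by (simp add: layout)
      ultimately show ?case using adj n_pos by simp
    next
      case 7
      have "n * (120 * m + 60 * n + 68) + 6 \<le> t2" using 2(1) 4(1) by simp
      then show ?case by (simp add: algebra_simps)
    next
      case (10 t \<sigma>3 \<mu>3)
      then show ?case by (auto simp: tables_def)
    qed (use envD[OF env2] word in \<open>auto simp: prog_bfs_def prog_edges_def\<close>)
  next
    case 1
    then show ?case using m1 ini by (simp add: layout)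
  next
    case 2
    then show ?case using m1 ini by (simp add: layout)
  next
    case 3
    then show ?case using 2(1) by simp
  qed
qed simp

end

section \<open>A greedy hitting set\<close>

definition prog_count :: "instr list" where
  "prog_count = for_loop 24 0 (sto (Var 7 \<oplus> Var 24) (Lit 0)) @
     for_loop 24 0 (ite (Cell (Var 6 \<oplus> Var 24))
       (for_loop 25 13 (asg 29 (Var 7 \<oplus> Cell (Var 5 \<oplus> Var 24 \<otimes> Var 0 \<oplus> Var 25)) @ sto (Var 29) (Cell (Var 29) \<oplus> Lit 1))) [])"

definition prog_max :: "instr list" where
  "prog_max = asg 26 (Lit 0) @ asg 27 (Lit 0) @
     for_loop 24 0 (ite (Var 26 \<prec> Cell (Var 7 \<oplus> Var 24)) (asg 26 (Cell (Var 7 \<oplus> Var 24)) @ asg 27 (Var 24)) [])"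

definition prog_clear :: "instr list" where
  "prog_clear = for_loop 24 0 (for_loop 25 13
     (ite (Cell (Var 5 \<oplus> Var 24 \<otimes> Var 0 \<oplus> Var 25) \<doteq> Var 27) (sto (Var 6 \<oplus> Var 24) (Lit 0)) []))"

text \<open>The flags at base register 6 start as \<open>the row is full\<close> and turn into
  \<open>the row is full and not yet hit\<close>. A short row contains the whole component of its
  vertex, so it is exempt from being hit. Counts are recomputed in every round.\<close>

definition prog_greedy :: "instr list" where
  "prog_greedy = asg 14 (Lit 0) @ asg 28 (Lit 1) @ whl (Var 28) (prog_count @ prog_max @
     ite (Var 26) (sto (Var 8 \<oplus> Var 14) (Var 27) @ asg 14 (Var 14 \<oplus> Lit 1) @ prog_clear) (asg 28 (Lit 0)))"

text \<open>For the injective rows, which are the flagged ones, this is 0 or 1; summed over them it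
  gives the number of rows that \<open>u\<close> would hit.\<close>

definition row_count :: "nat \<Rightarrow> (nat \<Rightarrow> nat \<Rightarrow> nat) \<Rightarrow> nat \<Rightarrow> nat \<Rightarrow> nat" where
  "row_count q rw v u = card {i. i < q \<and> rw v i = u}"

lemma card_Suc_filter: "card {i. i < Suc j \<and> P i} = card {i. i < j \<and> P i} + of_bool (P j)"
proof -
  have "{i. i < Suc j \<and> P i} = (if P j then insert j {i. i < j \<and> P i} else {i. i < j \<and> P i})"
    by (auto simp: less_Suc_eq)
  then show ?thesis by (simp add: of_bool_def)
qed

lemma sum_row_count:
  assumes "\<And>i. i < q \<Longrightarrow> rw v i < n"
  shows "(\<Sum>u<n. row_count q rw v u) = q"
  using assms
proof (induction q)
  case (Suc q)
  have "(\<Sum>u<n. of_bool (rw v q = u)) = (1::nat)" using Suc.prems[of q] by (simp add: of_bool_def)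
  then show ?case using Suc by (simp add: row_count_def card_Suc_filter sum.distrib)
qed (simp add: row_count_def)

lemma row_count_inj:
  assumes "inj_on (rw v) {..<q}"
  shows "row_count q rw v u = of_bool (u \<in> rw v ` {..<q})"
proof (cases "u \<in> rw v ` {..<q}")
  case True
  then obtain i where i: "i < q" "rw v i = u" by auto
  then have "{i. i < q \<and> rw v i = u} = {i}" using assms by (auto simp: inj_on_def)
  then show ?thesis using True by (simp add: row_count_def)
next
  case False
  then have "{i. i < q \<and> rw v i = u} = {}" by auto
  then show ?thesis using False unfolding row_count_def by simp
qed

text \<open>Each greedy choice shrinks the number of unhit rows by the factor \<open>1 - q / n\<close>.\<close>

definition pot :: "nat \<Rightarrow> nat \<Rightarrow> nat \<Rightarrow> real" where
  "pot n q u = (if u = 0 then 0 else real n / real q * (1 + ln (real u)))"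

text \<open>From \<open>ln x \<le> x - 1\<close> the logarithm drops by at least
  \<open>b / u\<close>, which is at least \<open>q / n\<close>. For the choice that hits the last
  rows the logarithm is of no help; the summand 1 in \<open>pot\<close> pays for it, as
  \<open>n / q \<ge> 1\<close>.\<close>

lemma pot_step:
  assumes "1 \<le> q" "q \<le> n" "1 \<le> u" "b \<le> u" "u * q \<le> n * b"
  shows "pot n q (u - b) + 1 \<le> pot n q u"
proof (cases "u = b")
  case True
  have "1 \<le> real n / real q" using assms by simp
  moreover have "0 \<le> ln (real u)" using assms by simp
  ultimately have "1 * 1 \<le> real n / real q * (1 + ln (real u))" by (intro mult_mono) auto
  then show ?thesis using True assms by (simp add: pot_def)
next
  case False
  define v where "v = u - b"
  have v: "1 \<le> v" "real v = real u - real b" using False assms by (auto simp: v_def)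
  have "ln (real v) - ln (real u) = ln (real v / real u)" using v assms by (simp add: ln_div)
  also have "\<dots> \<le> real v / real u - 1" using v assms by (intro ln_le_minus_one) auto
  also have "\<dots> = - (real b / real u)" using assms(3) unfolding v(2) by (simp add: diff_divide_distrib)
  also have "\<dots> \<le> - (real q / real n)"
  proof -
    have "real u * real q \<le> real n * real b" using assms(5) by (metis of_nat_mult of_nat_le_iff)
    then show ?thesis using assms by (simp add: field_simps)
  qed
  finally have "ln (real v) \<le> ln (real u) - real q / real n" by simp
  then have "real n / real q * (1 + ln (real v)) \<le> real n / real q * (1 + (ln (real u) - real q / real n))"
    by (intro mult_left_mono) auto
  also have "\<dots> = real n / real q * (1 + ln (real u)) - 1" using assms by (simp add: field_simps)
  finally show ?thesis using v assms by (simp add: pot_def v_def[symmetric])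
qed

lemma pot_mono: "u \<le> v \<Longrightarrow> pot n q u \<le> pot n q v"
proof (cases "u = 0")
  case True
  then show ?thesis by (simp add: pot_def)
next
  case False
  assume "u \<le> v"
  then have "real n / real q * (1 + ln (real u)) \<le> real n / real q * (1 + ln (real v))"
    using False by (intro mult_left_mono add_left_mono ln_mono) auto
  then show ?thesis using False \<open>u \<le> v\<close> by (simp add: pot_def)
qed

section \<open>Correctness and cost of the greedy program\<close>

context kinst begin

definition "hitters = nat \<lfloor>pot n q n\<rfloor>"

abbreviation "qrow \<mu> v i \<equiv> \<mu> (aQ + v * n + i)"

lemma count_spec:
  assumes env: "env \<sigma>" and rw: "\<And>v i. v < n \<Longrightarrow> i < q \<Longrightarrow> qrow \<mu> v i < n"
  shows "wp w prog_count (\<lambda>_ \<sigma>' \<mu>'. (\<forall>u<n. \<mu>' (aC + u) = (\<Sum>v | v < n \<and> \<mu> (aU + v) \<noteq> 0. row_count q (qrow \<mu>) v u)) \<and>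
     (\<forall>a. \<not> (aC \<le> a \<and> a < aC + n) \<longrightarrow> \<mu>' a = \<mu> a)) (n * (q * 28 + 41) + 12) \<sigma> \<mu>"
  unfolding prog_count_def
proof (rule wp_append, rule wp_for[where N = n and C = 5 and
    I = "\<lambda>j \<sigma>1 \<mu>1. (\<forall>u<j. \<mu>1 (aC + u) = 0) \<and> (\<forall>a. \<not> (aC \<le> a \<and> a < aC + n) \<longrightarrow> \<mu>1 a = \<mu> a)"], goal_cases)
  case (9 j \<sigma>1 \<mu>1)
  then have "\<sigma>1 7 = aC" using envD[OF env] by simp
  then show ?case using 9 word by (intro wp_sto) (auto simp: layout less_Suc_eq)
next
  case (10 t \<sigma>1 \<mu>1)
  have env1: "env \<sigma>1" using 10(4) by (intro env_frame[OF env]) auto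
  have m1: "\<And>u. u < n \<Longrightarrow> \<mu>1 (aC + u) = 0" "\<And>a. \<not> (aC \<le> a \<and> a < aC + n) \<Longrightarrow> \<mu>1 a = \<mu> a" using 10(6) by auto
  let ?cnt = "\<lambda>j u. \<Sum>v | v < j \<and> \<mu> (aU + v) \<noteq> 0. row_count q (qrow \<mu>) v u"
  have cnt_Suc: "?cnt (Suc j) u = ?cnt j u + (if \<mu> (aU + j) \<noteq> 0 then row_count q (qrow \<mu>) j u else 0)" for j u
  proof -
    have "{v. v < Suc j \<and> \<mu> (aU + v) \<noteq> 0} = (if \<mu> (aU + j) \<noteq> 0 then insert j {v. v < j \<and> \<mu> (aU + v) \<noteq> 0} else {v. v < j \<and> \<mu> (aU + v) \<noteq> 0})"
      by (auto simp: less_Suc_eq)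
    then show ?thesis by simp
  qed
  have rc_le: "row_count q' (qrow \<mu>) v u \<le> q'" for q' v u
    unfolding row_count_def using card_mono[of "{..<q'}" "{i. i < q' \<and> qrow \<mu> v i = u}"] by auto
  have cnt_le: "?cnt j u \<le> j * q" for j u
  proof -
    have "?cnt j u \<le> (\<Sum>v | v < j \<and> \<mu> (aU + v) \<noteq> 0. q)" by (intro sum_mono rc_le)
    also have "\<dots> \<le> (\<Sum>v<j. q)" by (intro sum_mono2) auto
    finally show ?thesis by simp
  qed
  show ?case
  proof (rule wp_for[where N = n and C = "q * 28 + 20" and
      I = "\<lambda>j \<sigma>2 \<mu>2. (\<forall>u<n. \<mu>2 (aC + u) = ?cnt j u) \<and> (\<forall>a. \<not> (aC \<le> a \<and> a < aC + n) \<longrightarrow> \<mu>2 a = \<mu> a)"], goal_cases)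
    case 7
    then show ?case using 10(1) by (simp add: algebra_simps)
  next
    case (9 j \<sigma>2 \<mu>2)
    have env2: "env \<sigma>2" using 9(3) by (intro env_frame[OF env1]) auto
    note r = envD[OF env2]
    have m2: "\<And>u. u < n \<Longrightarrow> \<mu>2 (aC + u) = ?cnt j u" "\<And>a. \<not> (aC \<le> a \<and> a < aC + n) \<Longrightarrow> \<mu>2 a = \<mu> a" using 9(5) by auto
    have U: "\<mu>2 (aU + j) = \<mu> (aU + j)" using 9(1) by (intro m2(2)) (auto simp: layout)
    show ?case
    proof (rule wp_ite, goal_cases)
      case 3
      then have U1: "\<mu> (aU + j) \<noteq> 0" using U 9 r by simp
      show ?case
      proof (rule wp_for[where N = q and C = 20 and
          I = "\<lambda>i \<sigma>3 \<mu>3. (\<forall>u<n. \<mu>3 (aC + u) = ?cnt j u + row_count i (qrow \<mu>) j u) \<and> (\<forall>a. \<not> (aC \<le> a \<and> a < aC + n) \<longrightarrow> \<mu>3 a = \<mu> a)"], goal_cases)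
        case (9 i \<sigma>3 \<mu>3)
        have env3: "env \<sigma>3" using 9(3) by (intro env_frame[OF env2]) auto
        note r3 = envD[OF env3]
        have r24: "\<sigma>3 24 = j" "\<sigma>3 25 = i" using 9(2,3) \<open>\<sigma>2 24 = j\<close> by auto
        have m3: "\<And>u. u < n \<Longrightarrow> \<mu>3 (aC + u) = ?cnt j u + row_count i (qrow \<mu>) j u" "\<And>a. \<not> (aC \<le> a \<and> a < aC + n) \<Longrightarrow> \<mu>3 a = \<mu> a" using 9(5) by auto
        have jn: "j < n" and iq: "i < n" using \<open>j < n\<close> 9(1) q_le by auto
        define u where "u = qrow \<mu> j i"
        have u: "u < n" using rw[OF jn 9(1)] by (simp add: u_def)
        have ji: "j * n + i < n * n" using row_index_less[OF jn iq] .
        have mu: "\<mu>3 (aQ + j * n + i) = u" using ji by (subst m3(2)) (auto simp: layout u_def)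
        \<comment> \<open>A counter never exceeds the number of row entries read so far, so
          incrementing it does not overflow.\<close>
        have "j * q \<le> n * n" using jn q_le by (intro mult_le_mono) auto
        then have cb: "\<mu>3 (aC + u) + 1 < 2 ^ w"
          using m3(1)[OF u] cnt_le[of u j] rc_le[of i j u] iq word unfolding distrib_left by linarith
        have b: "aQ + j * n + i < 2 ^ w" "aC + u < 2 ^ w" "j * n < 2 ^ w" using word ji u by (auto simp: layout)
        have "(\<forall>u'<n. (\<mu>3(aC + u := \<mu>3 (aC + u) + 1)) (aC + u') = ?cnt j u' + row_count (Suc i) (qrow \<mu>) j u') \<and>
          (\<forall>a. \<not> (aC \<le> a \<and> a < aC + n) \<longrightarrow> (\<mu>3(aC + u := \<mu>3 (aC + u) + 1)) a = \<mu> a)"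
          using m3 u by (auto simp: row_count_def card_Suc_filter u_def)
        then show ?case
          using r3 r24 mu b cb one_less_word by (intro wp_append wp_asg wp_sto) (simp_all add: u_def)
      next
        case (10 t \<sigma>3 \<mu>3)
        then show ?case using cnt_Suc U1 by simp
      next
        case 7
        show ?case using r 9 by simp
      next
        case 8
        show ?case using m2 by (simp add: row_count_def)
      qed (use r q_le word in auto)
    next
      case 4
      then have "\<mu> (aU + j) = 0" using U 9 r by simp
      then show ?case using m2 cnt_Suc by (intro wp_Nil) simp
    qed (use 9 r word in \<open>auto simp: layout\<close>)
  next
    case (10 t \<sigma>2 \<mu>2)
    then show ?case by simp
  qed (use envD[OF env1] m1 word in auto)
qed (use envD[OF env] word in \<open>auto simp: algebra_simps\<close>)

lemma max_spec:
  assumes env: "env \<sigma>"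
  shows "wp w prog_max (\<lambda>_ \<sigma>' \<mu>'. \<sigma>' 27 < n \<and> (\<forall>u<n. \<mu> (aC + u) \<le> \<sigma>' 26) \<and> (\<sigma>' 26 \<noteq> 0 \<longrightarrow> \<mu> (aC + \<sigma>' 27) = \<sigma>' 26))
     (n * 28 + 10) \<sigma> \<mu>"
  unfolding prog_max_def
proof (intro wp_append wp_asg, goal_cases)
  case 5
  show ?case
  proof (rule wp_for[where N = n and C = 20 and
      I = "\<lambda>j \<sigma>1 \<mu>1. \<sigma>1 27 < n \<and> (\<forall>u<j. \<mu> (aC + u) \<le> \<sigma>1 26) \<and> (\<sigma>1 26 \<noteq> 0 \<longrightarrow> \<mu> (aC + \<sigma>1 27) = \<sigma>1 26)"], goal_cases)
    case (9 j \<sigma>1 \<mu>1)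
    then have r: "\<sigma>1 7 = aC" "\<mu>1 = \<mu>" using envD[OF env] by simp_all
    have b: "aC + j < 2 ^ w" using word 9(1) by (auto simp: layout)
    have I: "\<And>u. u < j \<Longrightarrow> \<mu> (aC + u) \<le> \<sigma>1 26" "\<sigma>1 27 < n" "\<sigma>1 26 \<noteq> 0 \<Longrightarrow> \<mu> (aC + \<sigma>1 27) = \<sigma>1 26" using 9(5) by auto
    show ?case
    proof (cases "\<sigma>1 26 < \<mu> (aC + j)")
      case True
      then have "\<And>u. u < Suc j \<Longrightarrow> \<mu> (aC + u) \<le> \<mu> (aC + j)" using I(1) by (force simp: less_Suc_eq)
      then show ?thesis using r b 9(1,2) True by (intro wp_ite wp_append wp_asg) simp_all
    next
      case False
      then have "\<And>u. u < Suc j \<Longrightarrow> \<mu> (aC + u) \<le> \<sigma>1 26" using I(1) by (force simp: less_Suc_eq)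
      then show ?thesis using r b 9(1,2) False I by (intro wp_ite wp_append wp_asg wp_Nil) simp_all
    qed
  qed (use envD[OF env] word n_pos in auto)
qed auto

lemma clear_spec:
  assumes env: "env \<sigma>"
  shows "wp w prog_clear (\<lambda>_ \<sigma>' \<mu>'. (\<forall>v<n. \<mu>' (aU + v) = (if \<sigma> 27 \<in> qrow \<mu> v ` {..<q} then 0 else \<mu> (aU + v))) \<and>
     (\<forall>a. \<not> (aU \<le> a \<and> a < aU + n) \<longrightarrow> \<mu>' a = \<mu> a)) (n * (q * 28 + 14) + 6) \<sigma> \<mu>"
  unfolding prog_clear_def
proof (rule wp_for[where N = n and C = "q * 28 + 6" and
    I = "\<lambda>j \<sigma>1 \<mu>1. (\<forall>v<n. \<mu>1 (aU + v) = (if v < j \<and> \<sigma> 27 \<in> qrow \<mu> v ` {..<q} then 0 else \<mu> (aU + v))) \<and>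
     (\<forall>a. \<not> (aU \<le> a \<and> a < aU + n) \<longrightarrow> \<mu>1 a = \<mu> a)"], goal_cases)
  case (9 j \<sigma>1 \<mu>1)
  note j = 9
  have env1: "env \<sigma>1" using j(3) by (intro env_frame[OF env]) auto
  show ?case
  proof (rule wp_for[where N = q and C = 20 and
      I = "\<lambda>i \<sigma>2 \<mu>2. (\<forall>v<n. \<mu>2 (aU + v) = (if (v < j \<and> \<sigma> 27 \<in> qrow \<mu> v ` {..<q}) \<or> (v = j \<and> \<sigma> 27 \<in> qrow \<mu> v ` {..<i}) then 0 else \<mu> (aU + v))) \<and>
     (\<forall>a. \<not> (aU \<le> a \<and> a < aU + n) \<longrightarrow> \<mu>2 a = \<mu> a)"], goal_cases)
    case (9 i \<sigma>2 \<mu>2)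
    have env2: "env \<sigma>2" using 9(3) by (intro env_frame[OF env1]) auto
    note r = envD[OF env2]
    have r24: "\<sigma>2 24 = j" "\<sigma>2 25 = i" "\<sigma>2 27 = \<sigma> 27" using 9(2,3) j(2,3) by auto
    have I: "\<And>v. v < n \<Longrightarrow> \<mu>2 (aU + v) = (if (v < j \<and> \<sigma> 27 \<in> qrow \<mu> v ` {..<q}) \<or> (v = j \<and> \<sigma> 27 \<in> qrow \<mu> v ` {..<i}) then 0 else \<mu> (aU + v))"
      "\<And>a. \<not> (aU \<le> a \<and> a < aU + n) \<Longrightarrow> \<mu>2 a = \<mu> a" using 9(5) by auto
    have ji: "j * n + i < n * n" using row_index_less[of j n i] j(1) 9(1) q_le by simp
    have mu: "\<mu>2 (aQ + j * n + i) = qrow \<mu> j i" using ji by (subst I(2)) (auto simp: layout)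
    have b: "aQ + j * n + i < 2 ^ w" "aU + j < 2 ^ w" "j * n < 2 ^ w" using word ji j(1) by (auto simp: layout)
    show ?case
    proof (cases "qrow \<mu> j i = \<sigma> 27")
      case True
      have "(\<forall>v<n. (\<mu>2(aU + j := 0)) (aU + v) = (if (v < j \<and> \<sigma> 27 \<in> qrow \<mu> v ` {..<q}) \<or> (v = j \<and> \<sigma> 27 \<in> qrow \<mu> v ` {..<Suc i}) then 0 else \<mu> (aU + v))) \<and>
         (\<forall>a. \<not> (aU \<le> a \<and> a < aU + n) \<longrightarrow> (\<mu>2(aU + j := 0)) a = \<mu> a)"
        using I True j(1) by (auto simp: lessThan_Suc)
      then show ?thesis using r r24 mu b True one_less_word by (intro wp_ite wp_sto) simp_all
    next
      case False
      then have "(\<forall>v<n. \<mu>2 (aU + v) = (if (v < j \<and> \<sigma> 27 \<in> qrow \<mu> v ` {..<q}) \<or> (v = j \<and> \<sigma> 27 \<in> qrow \<mu> v ` {..<Suc i}) then 0 else \<mu> (aU + v))) \<and>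
         (\<forall>a. \<not> (aU \<le> a \<and> a < aU + n) \<longrightarrow> \<mu>2 a = \<mu> a)"
        using I by (auto simp: lessThan_Suc)
      then show ?thesis using r r24 mu b False one_less_word by (intro wp_ite wp_Nil) simp_all
    qed
  next
    case (10 t \<sigma>2 \<mu>2)
    then show ?case by (auto simp: less_Suc_eq)
  next
    case 8
    then show ?case using j(5) by auto
  qed (use envD[OF env1] q_le word in auto)
next
  case (10 t \<sigma>1 \<mu>1)
  then show ?case by auto
qed (use envD[OF env] word in auto)

lemma vw_greedy_body:
  "vw (prog_count @ prog_max @
     ite (Var 26) (sto (Var 8 \<oplus> Var 14) (Var 27) @ asg 14 (Var 14 \<oplus> Lit 1) @ prog_clear) (asg 28 (Lit 0))) =
   {14, 24, 25, 26, 27, 28, 29}"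
  by (auto simp: prog_count_def prog_max_def prog_clear_def)

text \<open>Double counting: the unhit rows have \<open>q\<close> entries each, spread over
  \<open>n\<close> vertices, so the most frequent vertex occurs in at least the fraction
  \<open>q / n\<close> of them. By injectivity the maximal count \<open>b\<close> is exactly the
  number of rows that it hits.\<close>

lemma greedy_step:
  fixes f :: "nat \<Rightarrow> nat"
  assumes rw: "\<And>v i. v < n \<Longrightarrow> i < q \<Longrightarrow> rw v i < n" and inj: "\<And>v. v < n \<Longrightarrow> f v \<noteq> 0 \<Longrightarrow> inj_on (rw v) {..<q}"
    and b: "\<And>u. u < n \<Longrightarrow> (\<Sum>v | v < n \<and> f v \<noteq> 0. row_count q rw v u) \<le> b"
    and u0: "u0 < n" "b \<noteq> 0 \<Longrightarrow> (\<Sum>v | v < n \<and> f v \<noteq> 0. row_count q rw v u0) = b"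
  shows "card {v. v < n \<and> f v \<noteq> 0} * q \<le> n * b"
    and "b \<noteq> 0 \<Longrightarrow> card {v. v < n \<and> (if u0 \<in> rw v ` {..<q} then 0 else f v) \<noteq> 0} = card {v. v < n \<and> f v \<noteq> 0} - b"
    and "b \<le> card {v. v < n \<and> f v \<noteq> 0}"
proof -
  let ?U = "{v. v < n \<and> f v \<noteq> 0}"
  have fin: "finite ?U" by simp
  have "card ?U * q = (\<Sum>v\<in>?U. \<Sum>u<n. row_count q rw v u)"
    using rw by (simp add: sum_row_count)
  also have "\<dots> = (\<Sum>u<n. \<Sum>v\<in>?U. row_count q rw v u)" by (rule sum.swap)
  also have "\<dots> \<le> (\<Sum>u<n. b)" by (intro sum_mono b) simp
  finally show "card ?U * q \<le> n * b" by simp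
  have hit: "(\<Sum>v\<in>?U. row_count q rw v u0) = card {v\<in>?U. u0 \<in> rw v ` {..<q}}"
  proof -
    have "(\<Sum>v\<in>?U. row_count q rw v u0) = (\<Sum>v\<in>?U. of_bool (u0 \<in> rw v ` {..<q}))"
      using inj by (intro sum.cong) (auto simp: row_count_inj)
    also have "\<dots> = card {v\<in>?U. u0 \<in> rw v ` {..<q}}"
      using fin by (simp add: of_bool_def sum.If_cases Int_def)
    finally show ?thesis .
  qed
  show "b \<le> card ?U"
  proof (cases "b = 0")
    case False
    then have "b = card {v\<in>?U. u0 \<in> rw v ` {..<q}}" using hit u0 by simp
    also have "\<dots> \<le> card ?U" by (intro card_mono fin) auto
    finally show ?thesis .
  qed simp
  assume "b \<noteq> 0"
  then have "card {v\<in>?U. u0 \<in> rw v ` {..<q}} = b" using hit u0 by simp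
  moreover have "{v. v < n \<and> (if u0 \<in> rw v ` {..<q} then 0 else f v) \<noteq> 0} = ?U - {v\<in>?U. u0 \<in> rw v ` {..<q}}"
    by auto
  moreover have "card (?U - {v\<in>?U. u0 \<in> rw v ` {..<q}}) = card ?U - card {v\<in>?U. u0 \<in> rw v ` {..<q}}"
    by (intro card_Diff_subset) (auto intro: finite_subset[OF _ fin])
  ultimately show "card {v. v < n \<and> (if u0 \<in> rw v ` {..<q} then 0 else f v) \<noteq> 0} = card ?U - b" by simp
qed

text \<open>Counting, maximum and clearing add up to \<open>n * (56 * q + 83) + 28\<close>; the rest
  covers the instructions between them.\<close>

definition "greedy_cost = n * (q * 56 + 83) + 80"

text \<open>Two bounds on the size of \<open>S\<close> are carried along. The potential gives the
  one needed for the running time. Size plus number of unhit rows stays at most \<open>n\<close>,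
  since each choice hits a new row; so \<open>S\<close> fits into its \<open>n\<close> cells. The
  extra round in \<open>hitters + 1\<close> is the one that finds the maximum 0.\<close>

lemma greedy_spec:
  assumes env: "env \<sigma>" and rw: "\<And>v i. v < n \<Longrightarrow> i < n \<Longrightarrow> qrow \<mu> v i < n"
    and inj: "\<And>v. v < n \<Longrightarrow> \<mu> (aU + v) \<noteq> 0 \<Longrightarrow> inj_on (qrow \<mu> v) {..<q}"
  shows "wp w prog_greedy (\<lambda>_ \<sigma>' \<mu>'. \<sigma>' 14 \<le> hitters \<and> \<sigma>' 14 \<le> n \<and> (\<forall>j<\<sigma>' 14. \<mu>' (aS + j) < n) \<and>
      (\<forall>v<n. \<mu> (aU + v) \<noteq> 0 \<longrightarrow> (\<exists>j<\<sigma>' 14. \<mu>' (aS + j) \<in> qrow \<mu> v ` {..<q})) \<and> (\<forall>a<aU. \<mu>' a = \<mu> a))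
      ((hitters + 1) * greedy_cost + 10) \<sigma> \<mu>"
proof -
  let ?U = "\<lambda>\<mu>1 :: nat \<Rightarrow> nat. {v. v < n \<and> \<mu>1 (aU + v) \<noteq> 0}"
  let ?I = "\<lambda>t (\<sigma>1 :: nat \<Rightarrow> nat) \<mu>1. \<sigma>1 14 + card (?U \<mu>1) \<le> n \<and> real (\<sigma>1 14) + pot n q (card (?U \<mu>1)) \<le> pot n q n \<and>
     (\<forall>a<aU. \<mu>1 a = \<mu> a) \<and> (\<forall>j<\<sigma>1 14. \<mu>1 (aS + j) < n) \<and>
     (\<forall>v<n. \<mu>1 (aU + v) = \<mu> (aU + v) \<or> (\<mu>1 (aU + v) = 0 \<and> (\<exists>j<\<sigma>1 14. \<mu>1 (aS + j) \<in> qrow \<mu> v ` {..<q}))) \<and>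
     (if \<sigma>1 28 = 0 then ?U \<mu>1 = {} \<and> 2 \<le> t else (hitters - \<sigma>1 14 + 1) * greedy_cost + 2 \<le> t)"
  have bound: "x \<le> hitters" if "real x + pot n q y \<le> pot n q n" for x y
  proof -
    have "0 \<le> pot n q y" by (auto simp: pot_def)
    then have "real x \<le> pot n q n" using that by simp
    then show ?thesis unfolding hitters_def by (simp add: le_nat_floor)
  qed
  define B where "B = prog_count @ prog_max @
     ite (Var 26) (sto (Var 8 \<oplus> Var 14) (Var 27) @ asg 14 (Var 14 \<oplus> Lit 1) @ prog_clear) (asg 28 (Lit 0))"
  have vwB: "vw B = {14, 24, 25, 26, 27, 28, 29}" unfolding B_def by (rule vw_greedy_body)
  have loop: "wp w (whl (Var 28) B) (\<lambda>_ \<sigma>' \<mu>'. \<sigma>' 14 \<le> hitters \<and> \<sigma>' 14 \<le> n \<and> (\<forall>j<\<sigma>' 14. \<mu>' (aS + j) < n) \<and>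
      (\<forall>v<n. \<mu> (aU + v) \<noteq> 0 \<longrightarrow> (\<exists>j<\<sigma>' 14. \<mu>' (aS + j) \<in> qrow \<mu> v ` {..<q})) \<and> (\<forall>a<aU. \<mu>' a = \<mu> a))
      (6 + (hitters + 1) * greedy_cost) (\<sigma>(14 := 0, 28 := 1)) \<mu>"
  proof (rule wp_while[where I = ?I], goal_cases)
    case 1
    have "card (?U \<mu>) \<le> n" using card_mono[of "{..<n}" "?U \<mu>"] by auto
    moreover have "pot n q (card (?U \<mu>)) \<le> pot n q n"
      by (rule pot_mono) (rule calculation)
    ultimately show ?case by simp
  next
    case (2 T1 \<sigma>1 \<mu>1)
    have env1: "env \<sigma>1" using 2(1) unfolding vwB by (intro env_frame[OF env]) auto
    define sz where "sz = \<sigma>1 14"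
    have I: "sz + card (?U \<mu>1) \<le> n" "real sz + pot n q (card (?U \<mu>1)) \<le> pot n q n"
      "\<And>a. a < aU \<Longrightarrow> \<mu>1 a = \<mu> a" "\<And>j. j < sz \<Longrightarrow> \<mu>1 (aS + j) < n"
      "\<And>v. v < n \<Longrightarrow> \<mu>1 (aU + v) = \<mu> (aU + v) \<or> (\<mu>1 (aU + v) = 0 \<and> (\<exists>j<sz. \<mu>1 (aS + j) \<in> qrow \<mu> v ` {..<q}))"
      "\<sigma>1 28 = 0 \<Longrightarrow> ?U \<mu>1 = {} \<and> 2 \<le> T1" "\<sigma>1 28 \<noteq> 0 \<Longrightarrow> (hitters - sz + 1) * greedy_cost + 2 \<le> T1"
      using 2(2) by (auto simp: sz_def split: if_splits)
    have row1: "qrow \<mu>1 v i = qrow \<mu> v i" if "v < n" "i < n" for v i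
      using row_index_less[OF that] by (intro I(3)) (simp add: layout)
    show ?case
    proof (cases "\<sigma>1 28 = 0")
      case True
      have "\<exists>j<sz. \<mu>1 (aS + j) \<in> qrow \<mu> v ` {..<q}" if "v < n" "\<mu> (aU + v) \<noteq> 0" for v
      proof -
        have "\<mu>1 (aU + v) = 0" using I(6)[OF True] that(1) by blast
        then show ?thesis using I(5)[OF that(1)] that(2) by auto
      qed
      then show ?thesis using True I(1,3,4,6) bound[OF I(2)] by (auto simp: sz_def)
    next
      case False
      have T1: "(hitters - sz + 1) * greedy_cost + 2 \<le> T1" using I(7)[OF False] .
      then have T1': "greedy_cost + 2 \<le> T1" unfolding add_mult_distrib by linarith
      define J where "J = ?I"
      have "wp w B ?I (T1 - 2) \<sigma>1 \<mu>1"
        unfolding B_def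
      proof (rule wp_append, rule wp_call[OF count_spec[OF env1]], goal_cases)
        case (1 v i)
        then show ?case using row1[of v i] rw[of v i] q_le by simp
      next
        case 2
        show ?case using T1' by (simp add: greedy_cost_def algebra_simps)
      next
        case (3 t2 \<sigma>2 \<mu>2)
        have env2: "env \<sigma>2" using 3(3) by (intro env_frame[OF env1]) (auto simp: prog_count_def)
        have c2: "\<And>u. u < n \<Longrightarrow> \<mu>2 (aC + u) = (\<Sum>v | v < n \<and> \<mu>1 (aU + v) \<noteq> 0. row_count q (qrow \<mu>1) v u)"
          "\<And>a. \<not> (aC \<le> a \<and> a < aC + n) \<Longrightarrow> \<mu>2 a = \<mu>1 a" using 3(5) by auto
        have r2: "\<sigma>2 14 = sz" "\<sigma>2 28 = \<sigma>1 28" using 3(3) by (auto simp: prog_count_def sz_def)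
        have t2: "n * (q * 28 + 42) + 60 \<le> t2" "T1 - greedy_cost + (n * (q * 28 + 42) + 60) \<le> t2 + 2"
          using 3(1) T1' by (simp_all add: greedy_cost_def algebra_simps)
        show ?case
        proof (rule wp_append, rule wp_call[OF max_spec[OF env2]], goal_cases)
          case 1
          then show ?case using t2 by (simp add: algebra_simps)
        next
          case (2 t3 \<sigma>3 \<mu>3)
          have env3: "env \<sigma>3" using 2(3) by (intro env_frame[OF env2]) (auto simp: prog_max_def)
          have mu3: "\<mu>3 = \<mu>2" using 2(4) by (simp add: prog_max_def)
          define u where "u = \<sigma>3 27"
          define b where "b = \<sigma>3 26"
          have r3: "\<sigma>3 14 = sz" "\<sigma>3 28 = \<sigma>1 28" using 2(3) r2 by (auto simp: prog_max_def)
          have mx: "u < n" "\<And>u. u < n \<Longrightarrow> \<mu>2 (aC + u) \<le> b" "b \<noteq> 0 \<Longrightarrow> \<mu>2 (aC + u) = b"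
            using 2(5) by (auto simp: u_def b_def)
          have t3: "n * (q * 28 + 14) + 50 \<le> t3" "T1 - greedy_cost + (n * (q * 28 + 14) + 50) \<le> t3 + 2"
            using 2(1) t2 by (simp_all add: algebra_simps)
          let ?f = "\<lambda>v. \<mu>1 (aU + v)"
          have gs: "card (?U \<mu>1) * q \<le> n * b"
            "b \<noteq> 0 \<Longrightarrow> card {v. v < n \<and> (if u \<in> qrow \<mu>1 v ` {..<q} then 0 else ?f v) \<noteq> 0} = card (?U \<mu>1) - b"
            "b \<le> card (?U \<mu>1)"
          proof -
            have a1: "qrow \<mu>1 v i < n" if "v < n" "i < q" for v i using row1[of v i] rw[of v i] that q_le by simp
            have a2: "inj_on (qrow \<mu>1 v) {..<q}" if "v < n" "?f v \<noteq> 0" for v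
            proof -
              have "\<mu> (aU + v) \<noteq> 0" using I(5)[OF that(1)] that(2) by auto
              then have "inj_on (qrow \<mu> v) {..<q}" using inj that by blast
              then show ?thesis using row1[OF that(1)] q_le by (subst inj_on_cong[where g = "qrow \<mu> v"]) auto
            qed
            note g = greedy_step[where rw = "qrow \<mu>1" and f = ?f and b = b and ?u0.0 = u]
            show "card (?U \<mu>1) * q \<le> n * b" by (rule g(1)) (use a1 a2 mx c2(1) in auto)
            show "card {v. v < n \<and> (if u \<in> qrow \<mu>1 v ` {..<q} then 0 else ?f v) \<noteq> 0} = card (?U \<mu>1) - b" if "b \<noteq> 0"
              by (rule g(2)) (use a1 a2 mx c2(1) that in auto)
            show "b \<le> card (?U \<mu>1)" by (rule g(3)) (use a1 a2 mx c2(1) in auto)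
          qed
          have U2: "\<mu>2 (aU + v) = \<mu>1 (aU + v)" if "v < n" for v using that by (intro c2(2)) (auto simp: layout)
          have S2: "\<mu>2 (aS + j) = \<mu>1 (aS + j)" for j by (intro c2(2)) (auto simp: layout)
          have lo2: "\<mu>2 a = \<mu> a" if "a < aU" for a using c2(2)[of a] I(3)[OF that] that by (auto simp: layout)
          show ?case
          proof (rule wp_ite, goal_cases)
            case 3
            then have b: "b \<noteq> 0" by (simp add: b_def)
            have cU: "1 \<le> card (?U \<mu>1)" using gs(3) b by simp
            have szn: "sz < n" using I(1) cU by simp
            have bS: "aS + sz < 2 ^ w" "sz + 1 < 2 ^ w" using word szn by (auto simp: layout)
            define \<sigma>4 where "\<sigma>4 = \<sigma>3(14 := sz + 1)"
            define \<mu>4 where "\<mu>4 = \<mu>2(aS + sz := u)"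
            have env4: "env \<sigma>4" unfolding \<sigma>4_def by (intro env_frame[OF env3]) auto
            have row4: "qrow \<mu>4 v i = qrow \<mu> v i" if "v < n" "i < n" for v i
              using row_index_less[OF that] lo2[of "aQ + v * n + i"] by (simp add: \<mu>4_def layout)
            have img4: "qrow \<mu>4 v ` {..<q} = qrow \<mu> v ` {..<q}" "qrow \<mu>1 v ` {..<q} = qrow \<mu> v ` {..<q}" if "v < n" for v
              using row4[OF that] row1[OF that] q_le by (auto intro!: image_cong)
            have U4: "\<mu>4 (aU + v) = \<mu>1 (aU + v)" if "v < n" for v
              using that U2 by (simp add: \<mu>4_def layout)
            have clear: "wp w prog_clear ?I t \<sigma>4 \<mu>4"
              if t: "n * (q * 28 + 14) + 6 \<le> t" "T1 - greedy_cost + (n * (q * 28 + 14) + 6) \<le> t" for t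
            proof (rule wp_call[OF clear_spec[OF env4] t(1)], goal_cases)
              case (1 t5 \<sigma>5 \<mu>5)
              have r5: "\<sigma>5 14 = sz + 1" "\<sigma>5 28 \<noteq> 0" "\<sigma>4 27 = u"
                using 1(3) False r3 by (auto simp: prog_clear_def \<sigma>4_def u_def)
              have f5: "\<mu>5 (aU + v) = (if u \<in> qrow \<mu> v ` {..<q} then 0 else \<mu>1 (aU + v))" if "v < n" for v
                using 1(5) that img4 U4 r5 by auto
              have o5: "\<mu>5 a = \<mu>4 a" if "\<not> (aU \<le> a \<and> a < aU + n)" for a using 1(5) that by auto
              have "?U \<mu>5 = {v. v < n \<and> (if u \<in> qrow \<mu>1 v ` {..<q} then 0 else ?f v) \<noteq> 0}"
                using f5 img4(2) by (intro Collect_cong conj_cong refl) simp_all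
              then have cU5: "card (?U \<mu>5) = card (?U \<mu>1) - b" using gs(2) b by simp
              have p: "pot n q (card (?U \<mu>5)) + 1 \<le> pot n q (card (?U \<mu>1))"
                unfolding cU5 by (rule pot_step) (use gs cU q_pos q_le in auto)
              have S5: "\<mu>5 (aS + j) = (if j = sz then u else \<mu>1 (aS + j))" for j
                using o5[of "aS + j"] S2[of j] by (simp add: \<mu>4_def layout)
              have p5: "real (sz + 1) + pot n q (card (?U \<mu>5)) \<le> pot n q n" using p I(2) by simp
              have hs: "sz + 1 \<le> hitters" using bound[OF p5] .
              have h2: "\<mu>5 (aU + v) = \<mu> (aU + v) \<or> (\<mu>5 (aU + v) = 0 \<and> (\<exists>j<sz + 1. \<mu>5 (aS + j) \<in> qrow \<mu> v ` {..<q}))" if "v < n" for v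
              proof (cases "u \<in> qrow \<mu> v ` {..<q}")
                case True
                then show ?thesis using f5[OF that] S5[of sz] by (intro disjI2 conjI exI[of _ sz]) simp_all
              next
                case F: False
                from I(5)[OF that] show ?thesis
                proof
                  assume "\<mu>1 (aU + v) = 0 \<and> (\<exists>j<sz. \<mu>1 (aS + j) \<in> qrow \<mu> v ` {..<q})"
                  then obtain j where "j < sz" "\<mu>1 (aS + j) \<in> qrow \<mu> v ` {..<q}" "\<mu>1 (aU + v) = 0" by blast
                  then show ?thesis using f5[OF that] S5[of j] by (intro disjI2 conjI exI[of _ j]) auto
                qed (use F f5[OF that] in auto)
              qed
              have "hitters - sz = (hitters - (sz + 1)) + 1" using hs by simp
              then have "(hitters - (sz + 1) + 1) * greedy_cost + greedy_cost = (hitters - sz + 1) * greedy_cost"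
                by (simp only: add_mult_distrib mult_1)
              then have t5: "(hitters - (sz + 1) + 1) * greedy_cost + 2 \<le> t5"
                using T1 1(1) t by linarith
              have lo5: "\<mu>5 a = \<mu> a" if "a < aU" for a
                using o5[of a] lo2[OF that] that by (auto simp: \<mu>4_def layout)
              have S5n: "\<mu>5 (aS + j) < n" if "j < sz + 1" for j
                using S5[of j] I(4)[of j] mx(1) that by auto
              show ?case
                using r5 p5 t5 lo5 S5n h2 cU5 I(1) b gs(3) by auto
            qed
            define PC where "PC = prog_clear"
            show ?case
              using r3 env3 bS clear t3 one_less_word unfolding PC_def[symmetric] mu3
              by (intro wp_append wp_asg wp_sto)
                (simp_all add: envD[OF env3] u_def[symmetric] \<sigma>4_def[symmetric] \<mu>4_def[symmetric])
          next
            case 4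
            then have b0: "b = 0" by (simp add: b_def)
            \<comment> \<open>By the averaging bound, a maximal count of 0 leaves no unhit
              row.\<close>
            then have "card (?U \<mu>1) = 0" using gs(1) q_pos by simp
            then have e: "?U \<mu>1 = {}" by (subst (asm) card_0_eq) auto
            have Ueq: "?U \<mu>2 = ?U \<mu>1" using U2 by auto
            have r4: "(\<sigma>3(28 := 0)) 14 = sz" using r3 by simp
            have "?I (t3 - 4) (\<sigma>3(28 := 0)) \<mu>2"
              unfolding Ueq r4
            proof (intro conjI)
              show "sz + card (?U \<mu>1) \<le> n" "real sz + pot n q (card (?U \<mu>1)) \<le> pot n q n" by (rule I)+
              show "\<forall>a<aU. \<mu>2 a = \<mu> a" using lo2 by blast
              show "\<forall>j<sz. \<mu>2 (aS + j) < n" using I(4) S2 by simp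
              show "\<forall>v<n. \<mu>2 (aU + v) = \<mu> (aU + v) \<or> (\<mu>2 (aU + v) = 0 \<and> (\<exists>j<sz. \<mu>2 (aS + j) \<in> qrow \<mu> v ` {..<q}))"
              proof (intro allI impI)
                fix v assume v: "v < n"
                from I(5)[OF v] show "\<mu>2 (aU + v) = \<mu> (aU + v) \<or> (\<mu>2 (aU + v) = 0 \<and> (\<exists>j<sz. \<mu>2 (aS + j) \<in> qrow \<mu> v ` {..<q}))"
                  unfolding U2[OF v] S2 .
              qed
              show "if (\<sigma>3(28 := 0)) 28 = 0 then ?U \<mu>1 = {} \<and> 2 \<le> t3 - 4 else (hitters - sz + 1) * greedy_cost + 2 \<le> t3 - 4"
                using e t3 by simp
            qed
            then have J: "J (t3 - 4) (\<sigma>3(28 := 0)) \<mu>2" unfolding J_def .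
            show ?case
              unfolding mu3 J_def[symmetric] using J t3 one_less_word by (intro wp_asg) simp_all
          qed (use t3 in simp_all)
        qed
      qed
      then show ?thesis using False T1' by simp
    qed
  qed
  show ?thesis
    unfolding prog_greedy_def B_def[symmetric]
    using loop one_less_word by (intro wp_append wp_asg) simp_all
qed

end

section \<open>Distances to the hitting set\<close>

definition prog_near :: "instr list" where
  "prog_near = for_loop 36 0 (asg 34 (Var 12) @ asg 35 (Lit 0) @
     for_loop 38 14 (asg 39 (Cell (Var 4 \<oplus> Var 36 \<otimes> Var 0 \<oplus> Cell (Var 8 \<oplus> Var 38))) @
       ite (Var 39 \<prec> Var 34) (asg 34 (Var 39) @ asg 35 (Var 38)) []) @
     sto (Var 9 \<oplus> Var 36) (Var 34) @ sto (Var 10 \<oplus> Var 36) (Var 35))"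

context kinst begin

text \<open>The index of the nearest member is below \<open>n\<close> even for vertices that reach
  no member of \<open>S\<close>, where it is the default 0; so it can always be used for
  addressing.\<close>

lemma near_spec:
  assumes env: "env \<sigma>" and sz: "\<sigma> 14 = sz" "sz \<le> n"
    and tab: "\<And>s u. s < n \<Longrightarrow> u < n \<Longrightarrow> \<mu> (aD + s * n + u) = d s u" and S: "\<And>j. j < sz \<Longrightarrow> \<mu> (aS + j) < n"
  shows "wp w prog_near (\<lambda>_ \<sigma>' \<mu>'. (\<forall>a<aDS. \<mu>' a = \<mu> a) \<and> (\<forall>z<n. \<mu>' (aDS + z) \<le> 2 * n \<and> \<mu>' (aPS + z) < n \<and>
      (\<forall>j<sz. \<mu>' (aDS + z) \<le> d z (\<mu> (aS + j))) \<and>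
      (\<mu>' (aDS + z) < 2 * n \<longrightarrow> \<mu>' (aPS + z) < sz \<and> d z (\<mu> (aS + \<mu>' (aPS + z))) = \<mu>' (aDS + z))))
      (n * (sz * 38 + 50) + 6) \<sigma> \<mu>"
proof -
  let ?P = "\<lambda>z j D p. D \<le> 2 * n \<and> p < n \<and> (\<forall>i<j. D \<le> d z (\<mu> (aS + i))) \<and> (D < 2 * n \<longrightarrow> p < j \<and> d z (\<mu> (aS + p)) = D)"
  have "wp w prog_near (\<lambda>_ \<sigma>' \<mu>'. (\<forall>a<aDS. \<mu>' a = \<mu> a) \<and> (\<forall>z<n. ?P z sz (\<mu>' (aDS + z)) (\<mu>' (aPS + z))))
      (n * (sz * 38 + 50) + 6) \<sigma> \<mu>"
    unfolding prog_near_def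
  proof (rule wp_for[where N = n and C = "sz * 38 + 42" and
      I = "\<lambda>z \<sigma>1 \<mu>1. (\<forall>a<aDS. \<mu>1 a = \<mu> a) \<and> (\<forall>z'<z. ?P z' sz (\<mu>1 (aDS + z')) (\<mu>1 (aPS + z')))"], goal_cases)
    case (9 z \<sigma>1 \<mu>1)
    note z = 9
    have env1: "env \<sigma>1" and sz1: "\<sigma>1 14 = sz" using z(3) sz by (auto intro!: env_frame[OF env])
    have I: "\<And>a. a < aDS \<Longrightarrow> \<mu>1 a = \<mu> a" "\<And>z'. z' < z \<Longrightarrow> ?P z' sz (\<mu>1 (aDS + z')) (\<mu>1 (aPS + z'))"
      using z(5) by auto
    define L where "L = sto (Var 9 \<oplus> Var 36) (Var 34) @ sto (Var 10 \<oplus> Var 36) (Var 35)"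
    have fin: "wp w L (\<lambda>t \<sigma>2 \<mu>2. (\<forall>a<aDS. \<mu>2 a = \<mu> a) \<and> (\<forall>z'<Suc z. ?P z' sz (\<mu>2 (aDS + z')) (\<mu>2 (aPS + z')))) t \<sigma>2 \<mu>1"
      if "env \<sigma>2" "\<sigma>2 36 = z" "?P z sz (\<sigma>2 34) (\<sigma>2 35)" "10 \<le> t" for t \<sigma>2
    proof -
      let ?\<mu> = "\<mu>1(aDS + z := \<sigma>2 34, aPS + z := \<sigma>2 35)"
      have b: "aDS + z < 2 ^ w" "aPS + z < 2 ^ w" using word z(1) by (auto simp: layout)
      have "?\<mu> (aDS + z') = (if z' = z then \<sigma>2 34 else \<mu>1 (aDS + z'))"
        "?\<mu> (aPS + z') = (if z' = z then \<sigma>2 35 else \<mu>1 (aPS + z'))" if "z' < Suc z" for z'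
        using that z(1) by (auto simp: layout)
      then have "\<forall>z'<Suc z. ?P z' sz (?\<mu> (aDS + z')) (?\<mu> (aPS + z'))"
        using I(2) that(3) by (auto simp: less_Suc_eq simp del: fun_upd_apply)
      moreover have "\<forall>a<aDS. ?\<mu> a = \<mu> a" using I(1) by (auto simp: layout)
      ultimately show ?thesis
        unfolding L_def using that b envD[OF that(1)] by (intro wp_append wp_sto) simp_all
    qed
    have loop: "wp w (for_loop 38 14 (asg 39 (Cell (Var 4 \<oplus> Var 36 \<otimes> Var 0 \<oplus> Cell (Var 8 \<oplus> Var 38))) @
       ite (Var 39 \<prec> Var 34) (asg 34 (Var 39) @ asg 35 (Var 38)) []))
       (wp w L (\<lambda>t \<sigma>2 \<mu>2. (\<forall>a<aDS. \<mu>2 a = \<mu> a) \<and> (\<forall>z'<Suc z. ?P z' sz (\<mu>2 (aDS + z')) (\<mu>2 (aPS + z')))))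
       t \<sigma>0 \<mu>1" if t: "sz * 38 + 30 \<le> t" and s0: "\<sigma>0 = \<sigma>1(34 := 2 * n, 35 := 0)" for t \<sigma>0
    proof (rule wp_for[where N = sz and C = 30 and I = "\<lambda>j \<sigma>2 \<mu>2. ?P z j (\<sigma>2 34) (\<sigma>2 35)"], goal_cases)
      case (9 j \<sigma>2 \<mu>2)
      have env2: "env \<sigma>2" using 9(3) s0 by (intro env_frame[OF env1]) auto
      have r: "\<sigma>2 36 = z" "\<sigma>2 38 = j" "\<mu>2 = \<mu>1" using 9(2,3,4) z(2) s0 by auto
      have Sj: "\<mu>1 (aS + j) = \<mu> (aS + j)" "\<mu> (aS + j) < n" using I(1)[of "aS + j"] 9(1) sz S by (auto simp: layout)
      have idx: "z * n + \<mu> (aS + j) < n * n" using row_index_less[OF z(1) Sj(2)] .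
      have dz: "\<mu>1 (aD + z * n + \<mu> (aS + j)) = d z (\<mu> (aS + j))"
        using I(1)[of "aD + z * n + \<mu> (aS + j)"] tab[OF z(1) Sj(2)] idx by (auto simp: layout)
      have b: "aS + j < 2 ^ w" "aD + z * n + \<mu> (aS + j) < 2 ^ w" "z * n < 2 ^ w"
        using word idx 9(1) sz by (auto simp: layout)
      have P: "?P z j (\<sigma>2 34) (\<sigma>2 35)" using 9(5) .
      have jn: "j < n" using 9(1) sz by simp
      have d2: "d z (\<mu> (aS + j)) \<le> 2 * n" using d_le_inf z(1) by blast
      show ?case
      proof (cases "d z (\<mu> (aS + j)) < \<sigma>2 34")
        case True
        then have "?P z (Suc j) (d z (\<mu> (aS + j))) j"
          using P jn d2 by (auto simp: less_Suc_eq)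
        then show ?thesis
          using r Sj dz b envD[OF env2] True by (intro wp_append wp_asg wp_ite) simp_all
      next
        case False
        then have "?P z (Suc j) (\<sigma>2 34) (\<sigma>2 35)" using P by (auto simp: less_Suc_eq)
        then show ?thesis
          using r Sj dz b envD[OF env2] False by (intro wp_append wp_asg wp_ite wp_Nil) simp_all
      qed
    next
      case (10 t \<sigma>2 \<mu>2)
      have m: "\<mu>2 = \<mu>1" using 10(5) by simp
      have env2: "env \<sigma>2" using 10(4) s0 by (intro env_frame[OF env1]) auto
      have r: "\<sigma>2 36 = z" using 10(4) z(2) s0 by auto
      show ?case unfolding m by (rule fin) (use env2 r 10 t in auto)
    qed (use sz1 sz n_pos word t s0 in auto)
    show ?case
      unfolding L_def[symmetric]
      by (intro wp_append wp_asg loop) (simp_all add: one_less_word envD[OF env1])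
  next
    case (10 t \<sigma>1 \<mu>1)
    then show ?case by auto
  qed (use envD[OF env] word in auto)
  then show ?thesis by (rule wp_call) auto
qed

end

section \<open>The search program\<close>

text \<open>Each level has four variables of its own, numbered from 40 on to stay clear of all
  others: the chosen vertex, the recorded solution, the candidate counter and the farthest
  vertex.\<close>

definition xr :: "nat \<Rightarrow> nat" where "xr l = 40 + 4 * l"
definition yr :: "nat \<Rightarrow> nat" where "yr l = 41 + 4 * l"
definition cr :: "nat \<Rightarrow> nat" where "cr l = 42 + 4 * l"
definition wr :: "nat \<Rightarrow> nat" where "wr l = 43 + 4 * l"

lemma reg_eq [simp]:
  "xr l = xr l' \<longleftrightarrow> l = l'" "yr l = yr l' \<longleftrightarrow> l = l'" "cr l = cr l' \<longleftrightarrow> l = l'" "wr l = wr l' \<longleftrightarrow> l = l'"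
  by (auto simp: xr_def yr_def cr_def wr_def)

lemma reg_neq [simp]:
  "xr l \<noteq> yr l'" "xr l \<noteq> cr l'" "xr l \<noteq> wr l'" "yr l \<noteq> xr l'" "yr l \<noteq> cr l'" "yr l \<noteq> wr l'"
  "cr l \<noteq> xr l'" "cr l \<noteq> yr l'" "cr l \<noteq> wr l'" "wr l \<noteq> xr l'" "wr l \<noteq> yr l'" "wr l \<noteq> cr l'"
  unfolding xr_def yr_def cr_def wr_def by presburger+

lemma reg_small:
  "a < 40 \<Longrightarrow> xr l \<noteq> a" "a < 40 \<Longrightarrow> yr l \<noteq> a" "a < 40 \<Longrightarrow> cr l \<noteq> a" "a < 40 \<Longrightarrow> wr l \<noteq> a"
  "a < 40 \<Longrightarrow> a \<noteq> xr l" "a < 40 \<Longrightarrow> a \<noteq> yr l" "a < 40 \<Longrightarrow> a \<noteq> cr l" "a < 40 \<Longrightarrow> a \<noteq> wr l"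
  by (auto simp: xr_def yr_def cr_def wr_def)

lemma reg_num [simp]:
  "numeral a < (40::nat) \<Longrightarrow> xr l \<noteq> numeral a" "numeral a < (40::nat) \<Longrightarrow> yr l \<noteq> numeral a"
  "numeral a < (40::nat) \<Longrightarrow> cr l \<noteq> numeral a" "numeral a < (40::nat) \<Longrightarrow> wr l \<noteq> numeral a"
  "numeral a < (40::nat) \<Longrightarrow> numeral a \<noteq> xr l" "numeral a < (40::nat) \<Longrightarrow> numeral a \<noteq> yr l"
  "numeral a < (40::nat) \<Longrightarrow> numeral a \<noteq> cr l" "numeral a < (40::nat) \<Longrightarrow> numeral a \<noteq> wr l"
  by (intro reg_small; assumption)+

lemma reg_num01 [simp]:
  "xr l \<noteq> 0" "yr l \<noteq> 0" "cr l \<noteq> 0" "wr l \<noteq> 0" "0 \<noteq> xr l" "0 \<noteq> yr l" "0 \<noteq> cr l" "0 \<noteq> wr l"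
  "xr l \<noteq> 1" "yr l \<noteq> 1" "cr l \<noteq> 1" "wr l \<noteq> 1" "1 \<noteq> xr l" "1 \<noteq> yr l" "1 \<noteq> cr l" "1 \<noteq> wr l"
  by (auto simp: xr_def yr_def cr_def wr_def)

text \<open>Variable 36 holds the vertex \<open>z\<close>, variable 30 the threshold: is \<open>z\<close> farther than that from the
  first \<open>i\<close> chosen vertices?\<close>

fun unc :: "nat \<Rightarrow> expr" where
  "unc 0 = Lit 1"
| "unc (Suc i) = unc i \<otimes> (Var 30 \<prec> Cell (Var 4 \<oplus> Var (xr i) \<otimes> Var 0 \<oplus> Var 36))"

definition prog_far :: "nat \<Rightarrow> nat \<Rightarrow> instr list" where
  "prog_far i x = asg 34 (Lit 0) @ asg x (Lit 0) @
     for_loop 36 0 (ite (unc i \<otimes> (Var 34 \<prec> Cell (Var 9 \<oplus> Var 36) \<oplus> Lit 1))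
       (asg 34 (Cell (Var 9 \<oplus> Var 36) \<oplus> Lit 1) @ asg x (Var 36)) [])"

fun prog_copy :: "nat \<Rightarrow> instr list" where
  "prog_copy 0 = []"
| "prog_copy (Suc l) = prog_copy l @ asg (yr l) (Var (xr l))"

text \<open>The search goes on after a success and overwrites the chosen vertices, hence the
  copy.\<close>

definition prog_rec :: "nat \<Rightarrow> instr list" where
  "prog_rec i = ite (Var 37) (asg 20 (Lit 1) @ prog_copy i @ asg (yr i) (Var 39)) []"

text \<open>The \<open>q\<close> entries of one row are the candidates, each tested against all
  uncovered vertices: about \<open>n * q\<close> tests.\<close>

definition prog_leaf_far :: "nat \<Rightarrow> instr list" where
  "prog_leaf_far i = for_loop 38 13 (asg 39 (Cell (Var 5 \<oplus> Var 35 \<otimes> Var 0 \<oplus> Var 38)) @ asg 37 (Lit 1) @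
     for_loop 36 0 (ite (unc i \<otimes> (Var 30 \<prec> Cell (Var 4 \<oplus> Var 39 \<otimes> Var 0 \<oplus> Var 36))) (asg 37 (Lit 0)) []) @
     prog_rec i)"

definition prog_leaf_need :: "nat \<Rightarrow> instr list" where
  "prog_leaf_need i = for_loop 38 14 (sto (Var 11 \<oplus> Var 38) (Lit 0)) @
     for_loop 36 0 (ite (unc i) (sto (Var 11 \<oplus> Cell (Var 10 \<oplus> Var 36)) (Lit 1)) [])"

text \<open>The roles are swapped here: all vertices are candidates, but each is tested against
  marked members of \<open>S\<close> only.\<close>

definition prog_leaf_near :: "nat \<Rightarrow> instr list" where
  "prog_leaf_near i = for_loop 39 0 (asg 37 (Lit 1) @
     for_loop 38 14 (ite (Cell (Var 11 \<oplus> Var 38) \<otimes> (Var 16 \<oplus> Var 19 \<prec> Cell (Var 4 \<oplus> Var 39 \<otimes> Var 0 \<oplus> Cell (Var 8 \<oplus> Var 38))))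
       (asg 37 (Lit 0)) []) @
     prog_rec i)"

definition prog_leaf :: "nat \<Rightarrow> instr list" where
  "prog_leaf i = asg 30 (Var 18) @ prog_far i 35 @
     ite (Var 19 \<oplus> Lit 1 \<prec> Var 34) (prog_leaf_far i) (prog_leaf_need i @ prog_leaf_near i)"

text \<open>As \<open>k\<close> is fixed, the recursion is unrolled into nested loops. Candidate
  numbers below the size of \<open>S\<close> select a member of \<open>S\<close>, the others an
  entry of the row of the farthest vertex.\<close>

fun prog_search :: "nat \<Rightarrow> nat \<Rightarrow> instr list" where
  "prog_search i 0 = prog_leaf i"
| "prog_search i (Suc r) = asg 30 (Var 16 \<oplus> Lit (2 * i) \<otimes> Var 17 \<ominus> Var 17) @ prog_far i (wr i) @
     for_loop (cr i) 15 (ite (Var (cr i) \<prec> Var 14) (asg (xr i) (Cell (Var 8 \<oplus> Var (cr i))))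
       (asg (xr i) (Cell (Var 5 \<oplus> Var (wr i) \<otimes> Var 0 \<oplus> (Var (cr i) \<ominus> Var 14)))) @ prog_search (Suc i) r)"

lemma esz_unc: "esz (unc i) = 11 * i + 1"
  by (induction i) auto

lemma vw_copy: "vw (prog_copy i) = yr ` {..<i}"
  by (induction i) (auto simp: lessThan_Suc)

lemma nosto_copy [simp]: "nosto (prog_copy i)"
  by (induction i) auto

lemma vw_rec: "vw (prog_rec i) = insert 20 (yr ` {..<Suc i})"
  by (auto simp: prog_rec_def vw_copy lessThan_Suc)

lemma nosto_rec [simp]: "nosto (prog_rec i)"
  by (auto simp: prog_rec_def)

lemma vw_leaf: "vw (prog_leaf i) \<subseteq> {20, 30, 34, 35, 36, 37, 38, 39} \<union> range yr"
  by (auto simp: prog_leaf_def prog_far_def prog_leaf_far_def prog_leaf_need_def prog_leaf_near_def vw_rec)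

lemma vw_search:
  "vw (prog_search i r) \<subseteq> {20, 30, 34, 35, 36, 37, 38, 39} \<union> range yr \<union> (xr ` {i..} \<union> cr ` {i..} \<union> wr ` {i..})"
proof (induction r arbitrary: i)
  case 0
  then show ?case using vw_leaf[of i] by auto
next
  case (Suc r)
  have "xr ` {Suc i..} \<subseteq> xr ` {i..}" "cr ` {Suc i..} \<subseteq> cr ` {i..}" "wr ` {Suc i..} \<subseteq> wr ` {i..}" by auto
  then show ?case using Suc[of "Suc i"] by (auto simp: prog_far_def)
qed

lemma reg_range [simp]:
  "xr l \<notin> range yr" "cr l \<notin> range yr" "wr l \<notin> range yr" "0 \<notin> range yr" "1 \<notin> range yr"
  "a < 40 \<Longrightarrow> a \<notin> range yr"
  using reg_small(6) by (auto dest: sym)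

section \<open>The precomputed tables as mathematical functions\<close>

locale ksrch = kinst +
  fixes sz :: nat and Sl :: "nat \<Rightarrow> nat" and rw :: "nat \<Rightarrow> nat \<Rightarrow> nat" and dS pS :: "nat \<Rightarrow> nat"
  assumes sz_le: "sz \<le> n"
    and Sl_less: "\<And>j. j < sz \<Longrightarrow> Sl j < n"
    and rw_less: "\<And>v i. v < n \<Longrightarrow> i < q \<Longrightarrow> rw v i < n"
    and dS_inf: "\<And>v. v < n \<Longrightarrow> dS v \<le> 2 * n"
    and dS_le_d: "\<And>v j. v < n \<Longrightarrow> j < sz \<Longrightarrow> dS v \<le> d v (Sl j)"
    and pS_less: "\<And>v. v < n \<Longrightarrow> pS v < n"
    and pS_nearest: "\<And>v. v < n \<Longrightarrow> dS v < 2 * n \<Longrightarrow> pS v < sz \<and> d v (Sl (pS v)) = dS v"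
    and rw_ball: "\<And>v r x. v < n \<Longrightarrow> r < 2 * n \<Longrightarrow> r < dS v \<Longrightarrow> x < n \<Longrightarrow> d v x \<le> r \<Longrightarrow> x \<in> rw v ` {..<q}"
    and dS_zero: "\<And>v. v < n \<Longrightarrow> k = 1 \<Longrightarrow> dS v = 0"
begin

text \<open>Nothing is said about the cells from \<open>aN\<close> on, where the marks of the last
  level are written; so the search preserves this predicate.\<close>

definition data :: "(nat \<Rightarrow> nat) \<Rightarrow> bool" where
  "data \<mu> \<longleftrightarrow> (\<forall>s<n. \<forall>u<n. \<mu> (aD + s * n + u) = d s u) \<and> (\<forall>v<n. \<forall>i<q. \<mu> (aQ + v * n + i) = rw v i) \<and>
     (\<forall>j<sz. \<mu> (aS + j) = Sl j) \<and> (\<forall>z<n. \<mu> (aDS + z) = dS z \<and> \<mu> (aPS + z) = pS z)"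

lemma data_frame:
  assumes "data \<mu>" "\<And>a. a < aN \<Longrightarrow> \<mu>' a = \<mu> a"
  shows "data \<mu>'"
proof -
  have "\<mu>' (aD + s * n + u) = \<mu> (aD + s * n + u)" "\<mu>' (aQ + s * n + u) = \<mu> (aQ + s * n + u)" if "s < n" "u < n" for s u
    using row_index_less[OF that] by (auto intro!: assms(2) simp: layout)
  moreover have "\<mu>' (aS + j) = \<mu> (aS + j)" if "j < sz" for j
    using that sz_le by (auto intro!: assms(2) simp: layout)
  moreover have "\<mu>' (aDS + z) = \<mu> (aDS + z)" "\<mu>' (aPS + z) = \<mu> (aPS + z)" if "z < n" for z
    using that by (auto intro!: assms(2) simp: layout)
  ultimately show ?thesis using assms(1) q_le by (auto simp: data_def)
qed

lemma dataD:
  assumes "data \<mu>"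
  shows "\<And>s u. s < n \<Longrightarrow> u < n \<Longrightarrow> \<mu> (aD + s * n + u) = d s u" "\<And>v i. v < n \<Longrightarrow> i < q \<Longrightarrow> \<mu> (aQ + v * n + i) = rw v i"
    "\<And>j. j < sz \<Longrightarrow> \<mu> (aS + j) = Sl j" "\<And>z. z < n \<Longrightarrow> \<mu> (aDS + z) = dS z" "\<And>z. z < n \<Longrightarrow> \<mu> (aPS + z) = pS z"
  using assms by (auto simp: data_def)

end

section \<open>One round of the search, for a fixed guess of the radius\<close>

locale kround = ksrch +
  fixes R :: nat
  assumes R_less: "R < n"
begin

sublocale ks: ksearch n E k "Sl ` {..<sz}" "\<lambda>v. rw v ` {..<q}" dS R
proof unfold_locales
  show "1 \<le> k" "R < n" by (rule k_pos, rule R_less)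
  show "s < n" if "s \<in> Sl ` {..<sz}" for s using that Sl_less by auto
  show "x < n" if "v < n" "x \<in> rw v ` {..<q}" for v x using that rw_less by auto
  show "rw v ` {..<q} \<noteq> {}" for v using q_pos by (simp add: lessThan_empty_iff)
  show "dS v \<le> d v s" if "v < n" "s \<in> Sl ` {..<sz}" for v s using that dS_le_d by auto
  show "dS v \<le> 2 * n" if "v < n" for v using dS_inf that .
  show "\<exists>s\<in>Sl ` {..<sz}. d v s = dS v" if "v < n" "dS v < 2 * n" for v using pS_nearest[OF that] by auto
  show "x \<in> rw v ` {..<q}" if "v < n" "r < 2 * n" "r < dS v" "x < n" "d v x \<le> r" for v r x using rw_ball that by blast
  show "dS v = 0" if "v < n" "k = 1" for v using dS_zero that by blast
qed

definition pars :: "(nat \<Rightarrow> nat) \<Rightarrow> bool" where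
  "pars \<sigma> \<longleftrightarrow> env \<sigma> \<and> \<sigma> 14 = sz \<and> \<sigma> 15 = sz + q \<and> \<sigma> 16 = R \<and> \<sigma> 17 = ks.h \<and> \<sigma> 18 = ks.D \<and> \<sigma> 19 = ks.rho"

lemma parsD:
  assumes "pars \<sigma>"
  shows "env \<sigma>" "\<sigma> 14 = sz" "\<sigma> 15 = sz + q" "\<sigma> 16 = R" "\<sigma> 17 = ks.h" "\<sigma> 18 = ks.D" "\<sigma> 19 = ks.rho"
  using assms by (auto simp: pars_def)

lemma pars_frame:
  assumes "pars \<sigma>" "\<And>x. x < 20 \<or> x = 23 \<Longrightarrow> \<sigma>' x = \<sigma> x"
  shows "pars \<sigma>'"
  using assms by (simp add: pars_def env_def)

definition sound :: "(nat \<Rightarrow> nat) \<Rightarrow> bool" where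
  "sound \<sigma> \<longleftrightarrow> (\<forall>l<k. \<sigma> (yr l) < n) \<and> (\<forall>z<n. \<exists>l<k. d (\<sigma> (yr l)) z \<le> ks.D)"

text \<open>Variable 20 tells whether a solution has been found; until then the old one is kept.\<close>

definition good :: "(nat \<Rightarrow> nat) \<Rightarrow> (nat \<Rightarrow> nat) \<Rightarrow> bool" where
  "good Y \<sigma> \<longleftrightarrow> (if \<sigma> 20 = 0 then \<forall>l<k. \<sigma> (yr l) = Y l else \<sigma> 20 = 1 \<and> sound \<sigma>)"

lemma good_frame:
  assumes "good Y \<sigma>" "\<sigma>' 20 = \<sigma> 20" "\<And>l. \<sigma>' (yr l) = \<sigma> (yr l)"
  shows "good Y \<sigma>'"
proof -
  have "sound \<sigma>' = sound \<sigma>" using assms(3) by (simp add: sound_def)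
  then show ?thesis using assms by (simp add: good_def)
qed

text \<open>The test \<open>unc i\<close> takes \<open>11 * i + 1\<close> steps; \<open>A\<close>
  bounds such a test together with the bookkeeping of one loop iteration.\<close>

definition "A = 11 * k + 100"

lemma nA_ge: "100 \<le> n * A"
  using mult_le_mono[of 1 n 100 A] n_pos by (simp add: A_def)

lemma unc_eval:
  assumes "\<sigma> 0 = n" "\<sigma> 4 = aD" "\<sigma> 36 < n" "\<And>l. l < i \<Longrightarrow> \<sigma> (xr l) < n" "data \<mu>"
  shows "ok w (unc i) \<sigma> \<mu> \<and> iv (unc i) \<sigma> \<mu> = of_bool (\<forall>l<i. \<sigma> 30 < d (\<sigma> (xr l)) (\<sigma> 36))"
  using assms(4)
proof (induction i)
  case 0
  then show ?case using one_less_word by simp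
next
  case (Suc i)
  have x: "\<sigma> (xr i) < n" using Suc.prems by simp
  have idx: "\<sigma> (xr i) * n + \<sigma> 36 < n * n" using row_index_less[OF x assms(3)] .
  have b: "aD + \<sigma> (xr i) * n + \<sigma> 36 < 2 ^ w" "\<sigma> (xr i) * n < 2 ^ w" using idx word by (auto simp: layout)
  define P where "P = (\<forall>l<i. \<sigma> 30 < d (\<sigma> (xr l)) (\<sigma> 36))"
  define Q where "Q = (\<sigma> 30 < d (\<sigma> (xr i)) (\<sigma> 36))"
  have dist: "\<mu> (aD + \<sigma> (xr i) * n + \<sigma> 36) = d (\<sigma> (xr i)) (\<sigma> 36)" using dataD(1)[OF assms(5) x assms(3)] .
  have IH: "ok w (unc i) \<sigma> \<mu>" "iv (unc i) \<sigma> \<mu> = of_bool P"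
    using Suc.IH Suc.prems by (simp_all add: P_def)
  have e: "(\<forall>l<Suc i. \<sigma> 30 < d (\<sigma> (xr l)) (\<sigma> 36)) \<longleftrightarrow> P \<and> Q" by (auto simp: less_Suc_eq P_def Q_def)
  have s: "of_bool P * of_bool Q < (2::nat) ^ w" using one_less_word by (cases P; cases Q) simp_all
  show ?case
    unfolding e unc.simps ok.simps iv.simps iop.simps safe_op.simps IH(2) assms(1,2) dist Q_def[symmetric]
    using IH(1) s b by (simp only: of_bool_conj simp_thms)
qed

lemma far_spec:
  assumes p: "pars \<sigma>" and X: "\<And>l. l < i \<Longrightarrow> \<sigma> (xr l) < n" and dat: "data \<mu>" and i: "i < k"
    and x: "35 \<le> x" "x \<noteq> 36" "\<And>l. x \<noteq> xr l"
  shows "wp w (prog_far i x) (\<lambda>_ \<sigma>' \<mu>'. ks.farthest i (\<lambda>l. \<sigma> (xr l)) (\<sigma> 30) (\<sigma>' 34) (\<sigma>' x)) (n * A + 10) \<sigma> \<mu>"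
  unfolding prog_far_def
proof (intro wp_append wp_asg, goal_cases)
  case 5
  let ?u = "\<lambda>z. \<forall>l<i. \<sigma> 30 < d (\<sigma> (xr l)) z"
  let ?I = "\<lambda>j (\<sigma>1 :: nat \<Rightarrow> nat) (\<mu>1 :: nat \<Rightarrow> nat). \<sigma>1 x < n \<and> (\<forall>z<j. ?u z \<longrightarrow> dS z < \<sigma>1 34) \<and>
     (\<sigma>1 34 \<noteq> 0 \<longrightarrow> \<sigma>1 34 = dS (\<sigma>1 x) + 1 \<and> ?u (\<sigma>1 x))"
  have x': "x \<noteq> 0" "x \<noteq> 34" "x \<noteq> 30" "x \<noteq> 4" "x \<noteq> 9" "\<And>l. xr l \<noteq> x" using x by force+
  show ?case
  proof (rule wp_for[where N = n and C = "A - 8" and I = ?I], goal_cases)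
    case (9 z \<sigma>1 \<mu>1)
    have fr: "\<sigma>1 y = \<sigma> y" if "y \<noteq> 34" "y \<noteq> 36" "y \<noteq> x" for y using 9(3)[of y] that by simp
    have r: "\<sigma>1 0 = n" "\<sigma>1 4 = aD" "\<sigma>1 9 = aDS" "\<sigma>1 30 = \<sigma> 30" "\<And>l. \<sigma>1 (xr l) = \<sigma> (xr l)" "\<mu>1 = \<mu>"
      using envD[OF parsD(1)[OF p]] x x' 9(4) by (simp_all add: fr)
    have u: "ok w (unc i) \<sigma>1 \<mu>1" "iv (unc i) \<sigma>1 \<mu>1 = of_bool (?u z)"
      using unc_eval[of \<sigma>1 i \<mu>1] r X dat 9(1,2) by simp_all
    have ds: "\<mu>1 (aDS + z) = dS z" "dS z \<le> 2 * n" using dataD(4)[OF dat 9(1)] r dS_inf[OF 9(1)] by auto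
    have b: "aDS + z < 2 ^ w" "dS z + 1 < 2 ^ w" using word 9(1) ds by (auto simp: layout)
    have c: "esz (unc i) + 40 \<le> A" using i by (simp add: esz_unc A_def)
    have I: "\<sigma>1 x < n" "\<And>z'. z' < z \<Longrightarrow> ?u z' \<Longrightarrow> dS z' < \<sigma>1 34"
     "\<sigma>1 34 \<noteq> 0 \<Longrightarrow> \<sigma>1 34 = dS (\<sigma>1 x) + 1 \<and> ?u (\<sigma>1 x)" using 9(5) by auto
    show ?case
    proof (cases "?u z \<and> \<sigma>1 34 < dS z + 1")
      case True
      have "dS z' < dS z + 1" if "z' < Suc z" "?u z'" for z'
        using I(2)[OF _ that(2)] that(1) True by (cases "z' = z") simp_all
      then show ?thesis
        using True u ds b c r 9(1,2) x(2) x' one_less_word by (intro wp_ite wp_append wp_asg) simp_all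
    next
      case False
      have "dS z' < \<sigma>1 34" if "z' < Suc z" "?u z'" for z'
        using I(2)[OF _ that(2)] that False by (cases "z' = z") simp_all
      then have Q: "?I (Suc z) (\<sigma>1(36 := Suc z)) \<mu>1" using I(1,3) x x' by simp
      have e0: "of_bool (?u z) * of_bool (\<sigma>1 34 < dS z + 1) = (0::nat)" using False by auto
      have e1: "of_bool (?u z) * of_bool (\<sigma>1 34 < dS z + 1) < (2::nat) ^ w" using e0 one_less_word by simp
      show ?thesis
      proof (rule wp_ite, goal_cases)
        case 4
        show ?case by (rule wp_Nil) (rule Q)
      next
        case 3
        then have False using u ds r 9(2) False by auto
        then show ?case ..
      qed (use u ds b c r 9(2) e1 one_less_word in simp_all)
    qed
  next
    case (10 t \<sigma>1 \<mu>1)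
    then show ?case by (simp add: ks.farthest_def)
  next
    case 7
    have "A - 8 + 8 = A" by (simp add: A_def)
    then show ?case by simp
  qed (use envD[OF parsD(1)[OF p]] word x x' n_pos in simp_all)
qed (use one_less_word in simp_all)

lemma copy_spec:
  "wp w (prog_copy i) (\<lambda>_ \<sigma>' \<mu>'. \<forall>l<i. \<sigma>' (yr l) = \<sigma> (xr l)) (2 * i) \<sigma> \<mu>"
proof (induction i)
  case 0
  then show ?case by (simp add: wp_Nil)
next
  case (Suc i)
  show ?case
    unfolding prog_copy.simps
  proof (rule wp_append, rule wp_call[OF Suc], goal_cases)
    case (2 t \<sigma>1 \<mu>1)
    have "\<sigma>1 (xr i) = \<sigma> (xr i)" by (rule 2(3)) (auto simp: vw_copy)
    then show ?case using 2(1,5) by (intro wp_asg) (auto simp: less_Suc_eq)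
  qed simp
qed

lemma rec_spec:
  assumes i: "Suc i = k" and X: "\<And>l. l < i \<Longrightarrow> \<sigma> (xr l) < n" and u: "\<sigma> 39 < n" and g: "good Y \<sigma>"
    and c: "\<sigma> 37 \<noteq> 0 \<Longrightarrow> \<forall>z<n. (\<forall>l<i. ks.D < d (\<sigma> (xr l)) z) \<longrightarrow> d (\<sigma> 39) z \<le> ks.D"
  shows "wp w (prog_rec i) (\<lambda>_ \<sigma>' \<mu>'. good Y \<sigma>' \<and> (\<sigma> 20 \<noteq> 0 \<longrightarrow> \<sigma>' 20 \<noteq> 0) \<and> (\<sigma> 37 \<noteq> 0 \<longrightarrow> \<sigma>' 20 \<noteq> 0))
     (2 * k + 10) \<sigma> \<mu>"
  unfolding prog_rec_def
proof (rule wp_ite, goal_cases)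
  case 3
  have c': "(\<exists>l<i. d (\<sigma> (xr l)) z \<le> ks.D) \<or> d (\<sigma> 39) z \<le> ks.D" if "z < n" for z
  proof (cases "\<forall>l<i. ks.D < d (\<sigma> (xr l)) z")
    case True
    then show ?thesis using c 3 that by simp
  next
    case False
    then show ?thesis by (meson not_less)
  qed
  show ?case
  proof (rule wp_append, rule wp_asg, goal_cases)
    case 3
    show ?case
    proof (rule wp_append, rule wp_call[OF copy_spec], goal_cases)
      case 1
      then show ?case using i by simp
    next
      case (2 t \<sigma>1 \<mu>1)
      have r: "\<And>l. l < i \<Longrightarrow> \<sigma>1 (yr l) = \<sigma> (xr l)" using 2(5) by simp
      have r2: "\<sigma>1 20 = 1" "\<sigma>1 39 = \<sigma> 39" by (subst 2(3); auto simp: vw_copy)+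
      define \<sigma>2 where "\<sigma>2 = \<sigma>1(yr i := \<sigma> 39)"
      have y: "\<sigma>2 (yr l) = (if l = i then \<sigma> 39 else \<sigma> (xr l))" if "l < k" for l
        using that r i by (auto simp: \<sigma>2_def)
      have "sound \<sigma>2"
        unfolding sound_def
      proof (intro conjI allI impI)
        fix l assume "l < k"
        then show "\<sigma>2 (yr l) < n" using y[of l] u X i by auto
      next
        fix z assume "z < n"
        from c'[OF this] show "\<exists>l<k. d (\<sigma>2 (yr l)) z \<le> ks.D"
        proof
          assume "\<exists>l<i. d (\<sigma> (xr l)) z \<le> ks.D"
          then obtain l where "l < i" "d (\<sigma> (xr l)) z \<le> ks.D" by blast
          then show ?thesis using y[of l] i by (intro exI[of _ l]) auto
        next
          assume "d (\<sigma> 39) z \<le> ks.D"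
          then show ?thesis using y[of i] i by (intro exI[of _ i]) auto
        qed
      qed
      then have "good Y \<sigma>2" "\<sigma>2 20 \<noteq> 0" using r2 by (auto simp: good_def \<sigma>2_def)
      then show ?case using 2(1) r2 i by (intro wp_asg) (auto simp: \<sigma>2_def)
    qed
  qed (use one_less_word in auto)
next
  case 4
  then show ?case using g by (intro wp_Nil) simp
qed auto

abbreviation "uncov i X z \<equiv> \<forall>l<i. ks.D < d (X l) z"

lemma leaf_far_spec:
  assumes p: "pars \<sigma>" "\<sigma> 30 = ks.D" and X: "\<And>l. l < i \<Longrightarrow> \<sigma> (xr l) < n" and dat: "data \<mu>" and i: "Suc i = k"
    and W: "\<sigma> 35 < n" and g: "good Y \<sigma>"
  defines "X \<equiv> \<lambda>l. \<sigma> (xr l)"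
  shows "wp w (prog_leaf_far i) (\<lambda>_ \<sigma>' \<mu>'. good Y \<sigma>' \<and> (\<sigma> 20 \<noteq> 0 \<longrightarrow> \<sigma>' 20 \<noteq> 0) \<and>
     ((\<exists>u\<in>rw (\<sigma> 35) ` {..<q}. \<forall>z<n. uncov i X z \<longrightarrow> d u z \<le> ks.D) \<longrightarrow> \<sigma>' 20 \<noteq> 0)) (q * (n * A + A) + 6) \<sigma> \<mu>"
  unfolding prog_leaf_far_def
proof (rule wp_for[where N = q and C = "n * A + A - 8" and I = "\<lambda>j \<sigma>1 \<mu>1. good Y \<sigma>1 \<and> (\<sigma> 20 \<noteq> 0 \<longrightarrow> \<sigma>1 20 \<noteq> 0) \<and>
     ((\<exists>u\<in>rw (\<sigma> 35) ` {..<j}. \<forall>z<n. uncov i X z \<longrightarrow> d u z \<le> ks.D) \<longrightarrow> \<sigma>1 20 \<noteq> 0)"], goal_cases)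
  case (9 j \<sigma>1 \<mu>1)
  note j = 9
  have m1: "\<mu>1 = \<mu>" using j(4) by simp
  have fr: "\<sigma>1 y = \<sigma> y" if "y \<notin> {20, 36, 37, 38, 39} \<union> range yr" for y
    using j(3)[of y] that by (auto simp: vw_rec)
  have p1: "pars \<sigma>1" by (rule pars_frame[OF p(1)]) (auto intro!: fr simp: yr_def)
  have r1: "\<sigma>1 30 = ks.D" "\<sigma>1 35 = \<sigma> 35" "\<And>l. \<sigma>1 (xr l) = X l" using p(2) by (auto simp: fr X_def)
  note e1 = envD[OF parsD(1)[OF p1]]
  define u where "u = rw (\<sigma> 35) j"
  have u: "u < n" using rw_less[OF W j(1)] by (simp add: u_def)
  have idx: "\<sigma> 35 * n + j < n * n" using row_index_less[OF W] j(1) q_le by simp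
  have mu: "\<mu> (aQ + \<sigma> 35 * n + j) = u" using dataD(2)[OF dat W j(1)] by (simp add: u_def)
  have b: "aQ + \<sigma> 35 * n + j < 2 ^ w" "\<sigma> 35 * n < 2 ^ w" using word idx by (auto simp: layout)
  define F where "F = for_loop 36 0 (ite (unc i \<otimes> (Var 30 \<prec> Cell (Var 4 \<oplus> Var 39 \<otimes> Var 0 \<oplus> Var 36))) (asg 37 (Lit 0)) [])"
  define \<sigma>2 where "\<sigma>2 = \<sigma>1(39 := u, 37 := 1)"
  have p2: "pars \<sigma>2" by (rule pars_frame[OF p1]) (auto simp: \<sigma>2_def)
  note e2 = envD[OF parsD(1)[OF p2]]
  have r2: "\<sigma>2 30 = ks.D" "\<sigma>2 39 = u" "\<sigma>2 37 = 1" "\<And>l. \<sigma>2 (xr l) = X l" using r1 by (auto simp: \<sigma>2_def)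
  have loop: "wp w F (\<lambda>_ \<sigma>3 \<mu>3. \<sigma>3 37 = of_bool (\<forall>z<n. uncov i X z \<longrightarrow> d u z \<le> ks.D)) (n * A + 6) \<sigma>2 \<mu>"
    unfolding F_def
  proof (rule wp_for[where N = n and C = "A - 8" and I = "\<lambda>j \<sigma>3 \<mu>3. \<sigma>3 37 = of_bool (\<forall>z<j. uncov i X z \<longrightarrow> d u z \<le> ks.D)"], goal_cases)
    case (9 z \<sigma>3 \<mu>3)
    have fr3: "\<sigma>3 y = \<sigma>2 y" if "y \<noteq> 36" "y \<noteq> 37" for y using 9(3)[of y] that by simp
    have r3: "\<sigma>3 0 = n" "\<sigma>3 4 = aD" "\<sigma>3 30 = ks.D" "\<sigma>3 39 = u" "\<And>l. \<sigma>3 (xr l) = X l" "\<mu>3 = \<mu>"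
      using e2 r2 9(4) by (simp_all add: fr3)
    have un: "ok w (unc i) \<sigma>3 \<mu>" "iv (unc i) \<sigma>3 \<mu> = of_bool (uncov i X z)"
      using unc_eval[of \<sigma>3 i \<mu>] r3 X dat 9(1,2) by (simp_all add: X_def)
    have idz: "u * n + z < n * n" using row_index_less[OF u 9(1)] .
    have dz: "\<mu> (aD + u * n + z) = d u z" using dataD(1)[OF dat u 9(1)] .
    have bz: "aD + u * n + z < 2 ^ w" "u * n < 2 ^ w" using word idz by (auto simp: layout)
    have c: "esz (unc i) + 40 \<le> A" using i by (simp add: esz_unc A_def)
    let ?v = "of_bool (uncov i X z) * of_bool (ks.D < d u z) :: nat"
    have v: "?v < 2 ^ w" "?v \<noteq> 0 \<longleftrightarrow> uncov i X z \<and> \<not> d u z \<le> ks.D" using one_less_word by auto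
    show ?case
    proof (rule wp_ite, goal_cases)
      case 3
      then have "uncov i X z \<and> \<not> d u z \<le> ks.D" using v(2) un r3 dz 9(2) by simp
      then show ?case using c one_less_word by (intro wp_asg) (auto simp: less_Suc_eq)
    next
      case 4
      then have "\<not> (uncov i X z \<and> \<not> d u z \<le> ks.D)" using v(2) un r3 dz 9(2) by simp
      then show ?case using 9(5) by (intro wp_Nil) (auto simp: less_Suc_eq)
    qed (use un r3 dz bz c v(1) 9(2) in simp_all)
  next
    case 7
    have "A - 8 + 8 = A" by (simp add: A_def)
    then show ?case by simp
  next
    case (10 t \<sigma>3 \<mu>3)
    then show ?case by simp
  qed (use e2 r2 word in auto)
  have rest: "wp w (F @ prog_rec i) (\<lambda>_ \<sigma>2 \<mu>2. good Y (\<sigma>2(38 := Suc j)) \<and> (\<sigma> 20 \<noteq> 0 \<longrightarrow> (\<sigma>2(38 := Suc j)) 20 \<noteq> 0) \<and>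
     ((\<exists>u\<in>rw (\<sigma> 35) ` {..<Suc j}. \<forall>z<n. uncov i X z \<longrightarrow> d u z \<le> ks.D) \<longrightarrow> (\<sigma>2(38 := Suc j)) 20 \<noteq> 0)) t \<sigma>2 \<mu>"
    if t: "n * A + 6 + (2 * k + 10) \<le> t" for t
  proof (rule wp_append, rule wp_call[OF loop], goal_cases)
    case 1
    then show ?case using t by simp
  next
    case (2 t3 \<sigma>3 \<mu>3)
    have fr3: "\<sigma>3 y = \<sigma>2 y" if "y \<noteq> 36" "y \<noteq> 37" for y using 2(3)[of y] that by (simp add: F_def)
    have g3: "good Y \<sigma>3" by (rule good_frame[OF conjunct1[OF j(5)]]) (simp_all add: fr3 \<sigma>2_def)
    have r20: "\<sigma>3 20 = \<sigma>1 20" by (simp add: fr3 \<sigma>2_def)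
    have x3: "\<And>l. \<sigma>3 (xr l) = X l" "\<sigma>3 39 = u" using r2 by (simp_all add: fr3)
    show ?case
    proof (rule wp_call[OF rec_spec[OF i _ _ g3]], goal_cases)
      case (5 t4 \<sigma>4 \<mu>4)
      have g4: "good Y \<sigma>4" "\<sigma>3 20 \<noteq> 0 \<longrightarrow> \<sigma>4 20 \<noteq> 0" "\<sigma>3 37 \<noteq> 0 \<longrightarrow> \<sigma>4 20 \<noteq> 0" using 5(5) by auto
      have "good Y (\<sigma>4(38 := Suc j))" by (rule good_frame[OF g4(1)]) auto
      moreover have "\<sigma>4 20 \<noteq> 0" if "v \<in> rw (\<sigma> 35) ` {..<Suc j}" "\<forall>z<n. uncov i X z \<longrightarrow> d v z \<le> ks.D" for v
      proof (cases "v = u")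
        case True
        then have "\<sigma>3 37 = 1" using 2(5) that(2) by simp
        then show ?thesis using g4(3) by simp
      next
        case False
        then have "v \<in> rw (\<sigma> 35) ` {..<j}" using that by (auto simp: lessThan_Suc u_def)
        then show ?thesis using j(5) that(2) g4(2) r20 by auto
      qed
      ultimately show ?case using j(5) g4(2) r20 by auto
    next
      case (3)
      then have "\<forall>z<n. uncov i X z \<longrightarrow> d u z \<le> ks.D" unfolding 2(5) of_bool_eq_0_iff not_not .
      then show ?case by (simp add: x3)
    qed (use x3 X u t 2(1) in \<open>auto simp: X_def\<close>)
  qed
  define L where "L = F @ prog_rec i"
  have Ab: "2 * k + 100 \<le> A" by (simp add: A_def)
  show ?case
    unfolding m1 F_def[symmetric] L_def[symmetric]
  proof (rule wp_append, rule wp_asg, goal_cases)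
    case 3
    show ?case
    proof (rule wp_append, rule wp_asg, goal_cases)
      case 3
      have eq: "\<sigma>1(39 := iv (Cell (Var 5 \<oplus> Var 35 \<otimes> Var 0 \<oplus> Var 38)) \<sigma>1 \<mu>, 37 := iv (Lit 1) (\<sigma>1(39 := iv (Cell (Var 5 \<oplus> Var 35 \<otimes> Var 0 \<oplus> Var 38)) \<sigma>1 \<mu>)) \<mu>) = \<sigma>2"
        using e1 r1 mu j(2) by (simp add: \<sigma>2_def)
      show ?case unfolding eq L_def by (rule rest) (use Ab in simp)
    qed (use Ab one_less_word in simp_all)
  qed (use e1 r1 b j(2) Ab in simp_all)
next
  case 7
  have "n * A + A - 8 + 8 = n * A + A" by (simp add: A_def)
  then show ?case by simp
next
  case 8
  then show ?case using good_frame[OF g] by simp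
next
  case (10 t \<sigma>1 \<mu>1)
  then show ?case by simp
qed (use envD[OF parsD(1)[OF p(1)]] word q_le in \<open>auto simp: vw_rec\<close>)

lemma need_spec:
  assumes p: "pars \<sigma>" "\<sigma> 30 = ks.D" and X: "\<And>l. l < i \<Longrightarrow> \<sigma> (xr l) < n" and dat: "data \<mu>" and i: "Suc i = k"
  defines "X \<equiv> \<lambda>l. \<sigma> (xr l)"
  shows "wp w (prog_leaf_need i) (\<lambda>_ \<sigma>' \<mu>'. (\<forall>j<sz. \<mu>' (aN + j) = of_bool (\<exists>z<n. uncov i X z \<and> pS z = j)) \<and>
     (\<forall>a<aN. \<mu>' a = \<mu> a)) (sz * A + n * A + 12) \<sigma> \<mu>"
proof -
  have Ab: "A - 8 + 8 = A" "5 \<le> A - 8" by (auto simp: A_def)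
  note e = envD[OF parsD(1)[OF p(1)]]
  show ?thesis
    unfolding prog_leaf_need_def
  proof (rule wp_append, rule wp_for[where N = sz and C = "A - 8" and
        I = "\<lambda>j \<sigma>1 \<mu>1. (\<forall>j'<j. \<mu>1 (aN + j') = 0) \<and> (\<forall>a<aN. \<mu>1 a = \<mu> a)"], goal_cases)
    case 7
    then show ?case using Ab by simp
  next
    case (9 j \<sigma>1 \<mu>1)
    have r: "\<sigma>1 11 = aN" using 9(3) e by simp
    have "aN + j < 2 ^ w" using word 9(1) sz_le by (auto simp: layout)
    then show ?case using 9(2,5) r Ab by (intro wp_sto) (auto simp: less_Suc_eq)
  next
    case (10 t \<sigma>1 \<mu>1)
    note t1 = 10
    have fr1: "\<sigma>1 y = \<sigma> y" if "y \<noteq> 38" for y using 10(4)[of y] that by simp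
    have t: "n * A + 6 \<le> t" using 10(1) Ab by simp
    show ?case
    proof (rule wp_for[where N = n and C = "A - 8" and
        I = "\<lambda>z0 \<sigma>2 \<mu>2. (\<forall>j<sz. \<mu>2 (aN + j) = of_bool (\<exists>z<z0. uncov i X z \<and> pS z = j)) \<and> (\<forall>a<aN. \<mu>2 a = \<mu> a)"], goal_cases)
      case 7
      then show ?case using Ab t by simp
    next
      case (9 z \<sigma>2 \<mu>2)
      have fr2: "\<sigma>2 y = \<sigma> y" if "y \<noteq> 36" "y \<noteq> 38" for y using 9(3)[of y] fr1[of y] that by simp
      have I: "\<And>j. j < sz \<Longrightarrow> \<mu>2 (aN + j) = of_bool (\<exists>z'<z. uncov i X z' \<and> pS z' = j)" "\<And>a. a < aN \<Longrightarrow> \<mu>2 a = \<mu> a"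
        using 9(5) by auto
      have dat2: "data \<mu>2" by (rule data_frame[OF dat I(2)])
      have r: "\<sigma>2 0 = n" "\<sigma>2 4 = aD" "\<sigma>2 10 = aPS" "\<sigma>2 11 = aN" "\<sigma>2 30 = ks.D" "\<And>l. \<sigma>2 (xr l) = X l"
        using e p(2) by (simp_all add: fr2 X_def)
      have un: "ok w (unc i) \<sigma>2 \<mu>2" "iv (unc i) \<sigma>2 \<mu>2 = of_bool (uncov i X z)"
        using unc_eval[of \<sigma>2 i \<mu>2] r X dat2 9(1,2) by (simp_all add: X_def)
      have ps: "\<mu>2 (aPS + z) = pS z" "pS z < n" using dataD(5)[OF dat2 9(1)] pS_less[OF 9(1)] by auto
      have b: "aPS + z < 2 ^ w" "aN + pS z < 2 ^ w" using word 9(1) ps by (auto simp: layout)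
      have c: "esz (unc i) + 40 \<le> A" using i by (simp add: esz_unc A_def)
      show ?case
      proof (cases "uncov i X z")
        case True
        have "(\<mu>2(aN + pS z := 1)) (aN + j) = of_bool (\<exists>z'<Suc z. uncov i X z' \<and> pS z' = j)" if "j < sz" for j
          using I(1)[OF that] True by (cases "j = pS z") (auto simp: less_Suc_eq)
        then show ?thesis
          using True un r ps b c one_less_word I(2) 9(2) by (intro wp_ite wp_sto) simp_all
      next
        case False
        then have "\<mu>2 (aN + j) = of_bool (\<exists>z'<Suc z. uncov i X z' \<and> pS z' = j)" if "j < sz" for j
          using I(1)[OF that] False by (auto simp: less_Suc_eq)
        then have Q: "(\<forall>j<sz. \<mu>2 (aN + j) = of_bool (\<exists>z'<Suc z. uncov i X z' \<and> pS z' = j)) \<and> (\<forall>a<aN. \<mu>2 a = \<mu> a)"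
          using I(2) by blast
        show ?thesis
        proof (rule wp_ite, goal_cases)
          case 3
          then show ?case using False un by simp
        next
          case 4
          show ?case by (rule wp_Nil) (rule Q)
        qed (use un c in simp_all)
      qed
    next
      case (10 t \<sigma>2 \<mu>2)
      then show ?case by simp
    next
      case 8
      then show ?case using t1 by simp
    qed (use e word fr1 in auto)
  qed (use parsD[OF p(1)] sz_le word in auto)
qed

text \<open>The test through representatives is not exact. It is passed by every vertex that covers
  the rest within \<open>R\<close> (\<open>cpl\<close>), and only by vertices that cover it within
  \<open>D\<close> (\<open>snd\<close>); this gap is all that the approximation allows.\<close>

lemma leaf_near_spec:
  assumes p: "pars \<sigma>" and X: "\<And>l. l < i \<Longrightarrow> \<sigma> (xr l) < n" and dat: "data \<mu>" and i: "Suc i = k" and g: "good Y \<sigma>"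
  defines "X \<equiv> \<lambda>l. \<sigma> (xr l)"
  assumes need: "\<And>j. j < sz \<Longrightarrow> \<mu> (aN + j) = of_bool (\<exists>z<n. uncov i X z \<and> pS z = j)"
    and near: "\<And>z. z < n \<Longrightarrow> uncov i X z \<Longrightarrow> dS z \<le> ks.rho"
  shows "wp w (prog_leaf_near i) (\<lambda>_ \<sigma>' \<mu>'. good Y \<sigma>' \<and> (\<sigma> 20 \<noteq> 0 \<longrightarrow> \<sigma>' 20 \<noteq> 0) \<and>
     ((\<exists>u<n. \<forall>z<n. uncov i X z \<longrightarrow> d z u \<le> R) \<longrightarrow> \<sigma>' 20 \<noteq> 0)) (n * (sz * A + A) + 6) \<sigma> \<mu>"
proof -
  let ?pass = "\<lambda>u. \<forall>j<sz. (\<exists>z<n. uncov i X z \<and> pS z = j) \<longrightarrow> d u (Sl j) \<le> R + ks.rho"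
  have rho_less: "ks.rho < 2 * n"
    unfolding ks.rho_def using R_less div_le_dividend[of "R - ks.h" 2] by linarith
  have pz: "pS z < sz" "d z (Sl (pS z)) \<le> ks.rho" "Sl (pS z) < n" if "z < n" "uncov i X z" for z
    using pS_nearest[OF that(1)] near[OF that] rho_less Sl_less by auto
  have snd: "d u z \<le> ks.D" if "?pass u" "z < n" "uncov i X z" for u z
    using ks.leaf_near_sound[OF that(2) pz(2)[OF that(2,3)]] that pz(1)[OF that(2,3)] by blast
  have cpl: "?pass u" if "u < n" "\<forall>z<n. uncov i X z \<longrightarrow> d z u \<le> R" for u
    using ks.leaf_near_complete[OF that] pz by blast
  have Ab: "2 * k + 100 \<le> A" by (simp add: A_def)
  have main: "wp w (prog_leaf_near i) (\<lambda>_ \<sigma>' \<mu>'. good Y \<sigma>' \<and> (\<sigma> 20 \<noteq> 0 \<longrightarrow> \<sigma>' 20 \<noteq> 0) \<and>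
     ((\<exists>u<n. ?pass u) \<longrightarrow> \<sigma>' 20 \<noteq> 0)) (n * (sz * A + A) + 6) \<sigma> \<mu>"
    unfolding prog_leaf_near_def
  proof (rule wp_for[where N = n and C = "sz * A + A - 8" and I = "\<lambda>u0 \<sigma>1 \<mu>1. good Y \<sigma>1 \<and> (\<sigma> 20 \<noteq> 0 \<longrightarrow> \<sigma>1 20 \<noteq> 0) \<and>
     ((\<exists>u<u0. ?pass u) \<longrightarrow> \<sigma>1 20 \<noteq> 0)"], goal_cases)
    case (9 u \<sigma>1 \<mu>1)
    note j = 9
    have m1: "\<mu>1 = \<mu>" using j(4) by simp
    have fr: "\<sigma>1 y = \<sigma> y" if "y \<notin> {20, 37, 38, 39} \<union> range yr" for y
      using j(3)[of y] that by (auto simp: vw_rec)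
    have p1: "pars \<sigma>1" by (rule pars_frame[OF p]) (auto intro!: fr simp: yr_def)
    have r1: "\<And>l. \<sigma>1 (xr l) = X l" "\<sigma>1 39 = u" using j(2) by (auto simp: fr X_def)
    define F where "F = for_loop 38 14 (ite (Cell (Var 11 \<oplus> Var 38) \<otimes> (Var 16 \<oplus> Var 19 \<prec> Cell (Var 4 \<oplus> Var 39 \<otimes> Var 0 \<oplus> Cell (Var 8 \<oplus> Var 38))))
       (asg 37 (Lit 0)) [])"
    define \<sigma>2 where "\<sigma>2 = \<sigma>1(37 := 1)"
    have p2: "pars \<sigma>2" by (rule pars_frame[OF p1]) (auto simp: \<sigma>2_def)
    note e2 = envD[OF parsD(1)[OF p2]] parsD(2-)[OF p2]
    have r2: "\<sigma>2 39 = u" "\<sigma>2 37 = 1" "\<And>l. \<sigma>2 (xr l) = X l" using r1 by (auto simp: \<sigma>2_def)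
    have loop: "wp w F (\<lambda>_ \<sigma>3 \<mu>3. \<sigma>3 37 = of_bool (?pass u)) (sz * A + 6) \<sigma>2 \<mu>"
      unfolding F_def
    proof (rule wp_for[where N = sz and C = "A - 8" and I = "\<lambda>j0 \<sigma>3 \<mu>3. \<sigma>3 37 = of_bool (\<forall>j<j0. (\<exists>z<n. uncov i X z \<and> pS z = j) \<longrightarrow> d u (Sl j) \<le> R + ks.rho)"], goal_cases)
      case (9 jj \<sigma>3 \<mu>3)
      have fr3: "\<sigma>3 y = \<sigma>2 y" if "y \<noteq> 38" "y \<noteq> 37" for y using 9(3)[of y] that by simp
      have r3: "\<sigma>3 0 = n" "\<sigma>3 4 = aD" "\<sigma>3 8 = aS" "\<sigma>3 11 = aN" "\<sigma>3 16 = R" "\<sigma>3 19 = ks.rho" "\<sigma>3 39 = u" "\<sigma>3 38 = jj" "\<mu>3 = \<mu>"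
        using e2 r2 9(2,4) by (simp_all add: fr3)
      define s where "s = Sl jj"
      have s: "s < n" "\<mu> (aS + jj) = s" using Sl_less[OF 9(1)] dataD(3)[OF dat 9(1)] by (auto simp: s_def)
      define nd where "nd = (\<exists>z<n. uncov i X z \<and> pS z = jj)"
      have nd: "\<mu> (aN + jj) = of_bool nd" using need[OF 9(1)] by (simp add: nd_def)
      have idz: "u * n + s < n * n" using row_index_less[OF j(1) s(1)] .
      have dz: "\<mu> (aD + u * n + s) = d u s" using dataD(1)[OF dat j(1) s(1)] .
      have bz: "aD + u * n + s < 2 ^ w" "u * n < 2 ^ w" "aN + jj < 2 ^ w" "aS + jj < 2 ^ w" "R + ks.rho < 2 ^ w"
        using word idz 9(1) sz_le R_less rho_less by (auto simp: layout)
      have c: "60 \<le> A" by (simp add: A_def)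
      let ?v = "of_bool nd * of_bool (R + ks.rho < d u s) :: nat"
      have v: "?v < 2 ^ w" "?v \<noteq> 0 \<longleftrightarrow> nd \<and> \<not> d u s \<le> R + ks.rho" using one_less_word by auto
      have Suc_eq: "(\<forall>j<Suc jj. (\<exists>z<n. uncov i X z \<and> pS z = j) \<longrightarrow> d u (Sl j) \<le> R + ks.rho) \<longleftrightarrow>
          (\<forall>j<jj. (\<exists>z<n. uncov i X z \<and> pS z = j) \<longrightarrow> d u (Sl j) \<le> R + ks.rho) \<and> (nd \<longrightarrow> d u s \<le> R + ks.rho)"
        unfolding nd_def s_def by (subst All_less_Suc) (rule conj_commute)
      show ?case
        unfolding Suc_eq
      proof (rule wp_ite, goal_cases)
        case 3
        then have "nd \<and> \<not> d u s \<le> R + ks.rho" using v(2) nd r3 dz s by simp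
        then show ?case using c one_less_word by (intro wp_asg) simp_all
      next
        case 4
        then have "\<not> (nd \<and> \<not> d u s \<le> R + ks.rho)" using v(2) nd r3 dz s by simp
        then show ?case using 9(5) by (intro wp_Nil) simp
      qed (use nd r3 dz bz c v(1) s in simp_all)
    next
      case 7
      have "A - 8 + 8 = A" by (simp add: A_def)
      then show ?case by simp
    next
      case (10 t \<sigma>3 \<mu>3)
      then show ?case by blast
    qed (use e2 r2 sz_le word in auto)
    have rest: "wp w (F @ prog_rec i) (\<lambda>_ \<sigma>2 \<mu>2. good Y (\<sigma>2(39 := Suc u)) \<and> (\<sigma> 20 \<noteq> 0 \<longrightarrow> (\<sigma>2(39 := Suc u)) 20 \<noteq> 0) \<and>
       ((\<exists>u'<Suc u. ?pass u') \<longrightarrow> (\<sigma>2(39 := Suc u)) 20 \<noteq> 0)) t \<sigma>2 \<mu>"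
      if t: "sz * A + 6 + (2 * k + 10) \<le> t" for t
    proof (rule wp_append, rule wp_call[OF loop], goal_cases)
      case 1
      then show ?case using t by simp
    next
      case (2 t3 \<sigma>3 \<mu>3)
      have fr3: "\<sigma>3 y = \<sigma>2 y" if "y \<noteq> 38" "y \<noteq> 37" for y using 2(3)[of y] that by (simp add: F_def)
      have g3: "good Y \<sigma>3" by (rule good_frame[OF conjunct1[OF j(5)]]) (simp_all add: fr3 \<sigma>2_def)
      have r20: "\<sigma>3 20 = \<sigma>1 20" by (simp add: fr3 \<sigma>2_def)
      have x3: "\<And>l. \<sigma>3 (xr l) = X l" "\<sigma>3 39 = u" using r2 by (simp_all add: fr3)
      show ?case
      proof (rule wp_call[OF rec_spec[OF i _ _ g3]], goal_cases)
        case (5 t4 \<sigma>4 \<mu>4)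
        have g4: "good Y \<sigma>4" "\<sigma>3 20 \<noteq> 0 \<longrightarrow> \<sigma>4 20 \<noteq> 0" "\<sigma>3 37 \<noteq> 0 \<longrightarrow> \<sigma>4 20 \<noteq> 0" using 5(5) by auto
        have "good Y (\<sigma>4(39 := Suc u))" by (rule good_frame[OF g4(1)]) auto
        moreover have "\<sigma>4 20 \<noteq> 0" if "v < Suc u" "?pass v" for v
        proof (cases "v = u")
          case True
          then have "\<sigma>3 37 = 1" using 2(5) that(2) by simp
          then show ?thesis using g4(3) by simp
        next
          case False
          then have "\<exists>u'<u. ?pass u'" using that by (intro exI[of _ v]) simp
          then show ?thesis using j(5) g4(2) r20 by simp
        qed
        ultimately show ?case using j(5) g4(2) r20 by auto
      next
        case (3)
        then have "?pass u" unfolding 2(5) of_bool_eq_0_iff not_not .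
        then show ?case using snd by (simp add: x3)
      qed (use x3 X j(1) t 2(1) in \<open>auto simp: X_def\<close>)
    qed
    define L where "L = F @ prog_rec i"
    show ?case
      unfolding m1 F_def[symmetric] L_def[symmetric]
    proof (rule wp_append, rule wp_asg, goal_cases)
      case 3
      have eq: "\<sigma>1(37 := iv (Lit 1) \<sigma>1 \<mu>) = \<sigma>2" by (simp add: \<sigma>2_def)
      show ?case unfolding eq L_def by (rule rest) (use Ab in simp)
    qed (use Ab one_less_word in simp_all)
  next
    case 7
    have "sz * A + A - 8 + 8 = sz * A + A" by (simp add: A_def)
    then show ?case by simp
  next
    case 8
    then show ?case using good_frame[OF g] by simp
  next
    case (10 t \<sigma>1 \<mu>1)
    then show ?case by blast
  qed (use envD[OF parsD(1)[OF p]] word in \<open>auto simp: vw_rec\<close>)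
  show ?thesis
    by (rule wp_call[OF main le_refl]) (use cpl in blast)
qed

text \<open>There are \<open>sz + q\<close> candidates per level. The doubling and the summand 4
  absorb the overhead of a node, so that a subtree costs a pure power of \<open>B\<close>.\<close>

definition "B = 2 * (sz + q) + 4"

lemma completable_cong:
  assumes "\<And>l. l < i \<Longrightarrow> X l = X' l"
  shows "ks.completable i X \<longleftrightarrow> ks.completable i X'"
proof -
  have "(\<forall>l<i. t < d (X l) v) = (\<forall>l<i. t < d (X' l) v)" for t v using assms by auto
  then show ?thesis
    unfolding ks.completable_def ks.near_completable_def ks.far_completable_def by simp
qed

lemma leaf_spec:
  assumes p: "pars \<sigma>" and X: "\<And>l. l < i \<Longrightarrow> \<sigma> (xr l) < n" and dat: "data \<mu>" and i: "Suc i = k" and g: "good Y \<sigma>"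
  shows "wp w (prog_leaf i) (\<lambda>_ \<sigma>' \<mu>'. data \<mu>' \<and> good Y \<sigma>' \<and> (\<sigma> 20 \<noteq> 0 \<longrightarrow> \<sigma>' 20 \<noteq> 0) \<and>
     (ks.completable i (\<lambda>l. \<sigma> (xr l)) \<longrightarrow> \<sigma>' 20 \<noteq> 0)) (n * A * B) \<sigma> \<mu>"
proof -
  let ?X = "\<lambda>l. \<sigma> (xr l)"
  note nA_ge
  moreover have "q * A \<le> q * (n * A)" "sz * A \<le> sz * (n * A)" using n_pos by (auto intro!: mult_le_mono2)
  moreover have "n * A * B = 2 * (sz * (n * A)) + 2 * (q * (n * A)) + 4 * (n * A)" by (simp add: B_def algebra_simps)
  moreover have "n * (sz * A + A) = sz * (n * A) + n * A" "q * (n * A + A) = q * (n * A) + q * A" by (simp_all add: algebra_simps)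
  ultimately have T: "(n * A + 10) + (q * (n * A + A) + 6) + 10 \<le> n * A * B"
    "(n * A + 10) + (sz * A + n * A + 12) + (n * (sz * A + A) + 6) + 10 \<le> n * A * B" by linarith+
  have i': "i < k" using i by simp
  define \<sigma>1 where "\<sigma>1 = \<sigma>(30 := ks.D)"
  have p1: "pars \<sigma>1" by (rule pars_frame[OF p]) (auto simp: \<sigma>1_def)
  have X1: "\<And>l. l < i \<Longrightarrow> \<sigma>1 (xr l) < n" using X by (simp add: \<sigma>1_def)
  define L where "L = ite (Var 19 \<oplus> Lit 1 \<prec> Var 34) (prog_leaf_far i) (prog_leaf_need i @ prog_leaf_near i)"
  have main: "wp w (prog_far i 35 @ L) (\<lambda>_ \<sigma>' \<mu>'. data \<mu>' \<and> good Y \<sigma>' \<and> (\<sigma> 20 \<noteq> 0 \<longrightarrow> \<sigma>' 20 \<noteq> 0) \<and>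
     (ks.completable i ?X \<longrightarrow> \<sigma>' 20 \<noteq> 0)) (n * A * B - 2) \<sigma>1 \<mu>"
  proof (rule wp_append, rule wp_call[OF far_spec[OF p1 X1 dat i', of 35]], goal_cases)
    case (6 t \<sigma>2 \<mu>2)
    have t: "n * A * B \<le> t + (n * A + 12)" using 6(1) T by linarith
    have m2: "\<mu>2 = \<mu>" using 6(4) by (simp add: prog_far_def)
    have fr2: "\<sigma>2 y = \<sigma>1 y" if "y \<notin> {34, 35, 36}" for y using 6(3)[of y] that by (simp add: prog_far_def)
    have p2: "pars \<sigma>2" by (rule pars_frame[OF p1]) (auto intro!: fr2)
    have X2: "\<And>l. \<sigma>2 (xr l) = ?X l" "\<sigma>2 30 = ks.D" "\<sigma>2 20 = \<sigma> 20" by (simp_all add: fr2 \<sigma>1_def)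
    have g2: "good Y \<sigma>2" by (rule good_frame[OF g]) (simp_all add: fr2 \<sigma>1_def)
    have far: "ks.farthest i ?X ks.D (\<sigma>2 34) (\<sigma>2 35)" using 6(5) by (simp add: \<sigma>1_def)
    have X2n: "\<And>l. l < i \<Longrightarrow> \<sigma>2 (xr l) < n" using X X2 by simp
    have W: "\<sigma>2 35 < n" using far by (simp add: ks.farthest_def)
    have rb: "ks.rho + 1 < 2 ^ w"
      unfolding ks.rho_def using R_less word div_le_dividend[of "R - ks.h" 2] unfolding distrib_left by linarith
    show ?case
      unfolding L_def m2
    proof (rule wp_ite, goal_cases)
      case 3
      then have b: "ks.rho + 1 < \<sigma>2 34" using parsD[OF p2] by (simp split: if_splits)
      then have far2: "\<forall>l<i. ks.D < d (?X l) (\<sigma>2 35)" "ks.rho < dS (\<sigma>2 35)" using far by (auto simp: ks.farthest_def)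
      show ?case
      proof (rule wp_call[OF leaf_far_spec[OF p2 X2(2) X2n dat i W g2]], goal_cases)
        case 2
        then show ?case using t T(1) by simp
      next
        case (3 t3 \<sigma>3 \<mu>3)
        have "\<mu>3 = \<mu>" using 3(4) by (simp add: prog_leaf_far_def)
        moreover have "\<sigma>3 20 \<noteq> 0" if compl: "ks.completable i ?X"
        proof -
          obtain c where c: "c < n" "\<forall>v<n. uncov i ?X v \<longrightarrow> d v c \<le> R" using ks.completable_leaf[OF compl i] by blast
          from ks.leaf_far_complete[OF c W far2] show ?thesis using 3(5) X2(1) by simp
        qed
        ultimately show ?case using 3(5) X2(3) dat by simp
      qed
    next
      case 4
      then have b: "\<sigma>2 34 \<le> ks.rho + 1" using parsD[OF p2] by (simp split: if_splits)
      have near: "dS z \<le> ks.rho" if "z < n" "uncov i ?X z" for z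
      proof -
        have "dS z < \<sigma>2 34" using far that unfolding ks.farthest_def by blast
        then show ?thesis using b by simp
      qed
      show ?case
      proof (rule wp_append, rule wp_call[OF need_spec[OF p2 X2(2) X2n dat i]], goal_cases)
        case 2
        then show ?case using t T(2) by simp
      next
        case (3 t3 \<sigma>3 \<mu>3)
        have fr3: "\<sigma>3 y = \<sigma>2 y" if "y \<notin> {36, 38}" for y using 3(3)[of y] that by (simp add: prog_leaf_need_def)
        have p3: "pars \<sigma>3" by (rule pars_frame[OF p2]) (auto intro!: fr3)
        have X3: "\<And>l. \<sigma>3 (xr l) = ?X l" "\<sigma>3 20 = \<sigma> 20" using X2 by (simp_all add: fr3)
        have g3: "good Y \<sigma>3" by (rule good_frame[OF g2]) (simp_all add: fr3)
        have m3: "\<And>j. j < sz \<Longrightarrow> \<mu>3 (aN + j) = of_bool (\<exists>z<n. uncov i ?X z \<and> pS z = j)"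
          "\<And>a. a < aN \<Longrightarrow> \<mu>3 a = \<mu> a" using 3(5) X2 by simp_all
        have dat3: "data \<mu>3" by (rule data_frame[OF dat m3(2)])
        show ?case
        proof (rule wp_call[OF leaf_near_spec[OF p3 _ dat3 i g3]], goal_cases)
          case 4
          then show ?case using t 3(1) T(2) by simp
        next
          case (5 t4 \<sigma>4 \<mu>4)
          have "\<mu>4 = \<mu>3" using 5(4) by (simp add: prog_leaf_near_def)
          moreover have "\<sigma>4 20 \<noteq> 0" if "ks.completable i ?X"
            using ks.completable_leaf[OF that i] 5(5) X3(1) by simp
          ultimately show ?case using 5(5) X3(2) dat3 by simp
        qed (use X3 X m3 near in simp_all)
      qed (use t in simp_all)
    qed (use parsD[OF p2] rb t T one_less_word in simp_all)
  next
    case 5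
    then show ?case using T by simp
  qed auto
  show ?thesis
    unfolding prog_leaf_def L_def[symmetric]
  proof (rule wp_append, rule wp_asg, goal_cases)
    case 3
    have eq: "\<sigma>(30 := iv (Var 18) \<sigma> \<mu>) = \<sigma>1" using parsD[OF p] by (simp add: \<sigma>1_def)
    show ?case unfolding eq using main by simp
  qed (use T in simp_all)
qed

text \<open>Soundness does not depend on the prefix and sits in \<open>good\<close>: whatever gets
  recorded covers within \<open>D\<close>. Completeness is the last conjunct; the flag is never
  reset, so one completable branch suffices.\<close>

lemma search_spec:
  assumes "pars \<sigma>" "\<And>l. l < i \<Longrightarrow> \<sigma> (xr l) < n" "data \<mu>" "i + r + 1 = k" "good Y \<sigma>"
  shows "wp w (prog_search i r) (\<lambda>_ \<sigma>' \<mu>'. data \<mu>' \<and> good Y \<sigma>' \<and> (\<sigma> 20 \<noteq> 0 \<longrightarrow> \<sigma>' 20 \<noteq> 0) \<and>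
     (ks.completable i (\<lambda>l. \<sigma> (xr l)) \<longrightarrow> \<sigma>' 20 \<noteq> 0)) (n * A * B ^ Suc r) \<sigma> \<mu>"
  using assms
proof (induction r arbitrary: i \<sigma> \<mu>)
  case 0
  then show ?case using leaf_spec[of \<sigma> i \<mu> Y] by simp
next
  case (Suc r)
  note p = Suc.prems(1) and X = Suc.prems(2) and dat = Suc.prems(3) and ir = Suc.prems(4) and g = Suc.prems(5)
  let ?X = "\<lambda>l. \<sigma> (xr l)"
  let ?t = "R + 2 * i * ks.h - ks.h"
  let ?c = "n * A * B ^ Suc r"
  have i: "i < k" "Suc i < k" using ir by auto
  have hb: "2 * i * ks.h + ks.h \<le> R" using ks.h_bound' i by blast
  have iw: "2 * i < 2 ^ w" "R + 2 * i * ks.h < 2 ^ w" "2 * i * ks.h < 2 ^ w"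
    using i k_le word hb R_less unfolding distrib_left by linarith+
  have B4: "4 \<le> B" by (simp add: B_def)
  note An = nA_ge
  have cA: "n * A * 4 \<le> ?c"
  proof -
    have "4 \<le> B ^ Suc r" using B4 by (metis One_nat_def le_trans one_le_power power_increasing power_one_right Suc_le_mono zero_le numeral_le_iff one_le_numeral semiring_norm(68) le_add1 plus_1_eq_Suc)
    then show ?thesis by (intro mult_le_mono2)
  qed
  have T: "(n * A + 10) + ((sz + q) * (?c + 50 + 8) + 6) + 20 \<le> n * A * B ^ Suc (Suc r)"
  proof -
    have "n * A * B ^ Suc (Suc r) = B * ?c" by (simp add: algebra_simps)
    also have "\<dots> = (sz + q) * ?c + (sz + q) * ?c + 4 * ?c" by (simp add: B_def algebra_simps)
    finally have 1: "n * A * B ^ Suc (Suc r) = (sz + q) * ?c + (sz + q) * ?c + 4 * ?c" .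
    have "(sz + q) * 58 \<le> (sz + q) * ?c" using An cA by (intro mult_le_mono2) linarith
    moreover have "(sz + q) * (?c + 50 + 8) = (sz + q) * ?c + (sz + q) * 58"
      by (simp only: add_mult_distrib2 add.assoc)
    ultimately show ?thesis unfolding 1 using An cA by linarith
  qed
  define Bd where "Bd = ite (Var (cr i) \<prec> Var 14) (asg (xr i) (Cell (Var 8 \<oplus> Var (cr i))))
       (asg (xr i) (Cell (Var 5 \<oplus> Var (wr i) \<otimes> Var 0 \<oplus> (Var (cr i) \<ominus> Var 14)))) @ prog_search (Suc i) r"
  have vwB: "vw Bd \<subseteq> {20, 30, 34, 35, 36, 37, 38, 39} \<union> range yr \<union> (xr ` {i..} \<union> cr ` {Suc i..} \<union> wr ` {Suc i..})"
  proof -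
    have "xr ` {Suc i..} \<subseteq> xr ` {i..}" by auto
    then show ?thesis using vw_search[of "Suc i" r] by (auto simp: Bd_def)
  qed
  have keep: "y \<notin> vw Bd" if "y < 20 \<or> y = 23 \<or> (\<exists>l<i. y = xr l) \<or> y = wr i \<or> y = cr i" for y
    using that vwB by (auto simp: reg_small yr_def xr_def cr_def wr_def dest!: subsetD) presburger+
  define \<sigma>1 where "\<sigma>1 = \<sigma>(30 := ?t)"
  have p1: "pars \<sigma>1" by (rule pars_frame[OF p]) (auto simp: \<sigma>1_def)
  have X1: "\<And>l. l < i \<Longrightarrow> \<sigma>1 (xr l) < n" using X by (simp add: \<sigma>1_def)
  define L where "L = for_loop (cr i) 15 Bd"
  have wr_ok: "35 \<le> wr i" "wr i \<noteq> 36" "\<And>l. wr i \<noteq> xr l" by (simp add: wr_def, simp_all)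
  have main: "wp w (prog_far i (wr i) @ L) (\<lambda>_ \<sigma>' \<mu>'. data \<mu>' \<and> good Y \<sigma>' \<and> (\<sigma> 20 \<noteq> 0 \<longrightarrow> \<sigma>' 20 \<noteq> 0) \<and>
     (ks.completable i ?X \<longrightarrow> \<sigma>' 20 \<noteq> 0)) t \<sigma>1 \<mu>" if t: "(n * A + 10) + ((sz + q) * (?c + 50 + 8) + 6) \<le> t" for t
  proof (rule wp_append, rule wp_call[OF far_spec[OF p1 X1 dat i(1) wr_ok]], goal_cases)
    case 1
    then show ?case .
  next
    case 2
    then show ?case using t by simp
  next
    case (3 t2 \<sigma>2 \<mu>2)
    have m2: "\<mu>2 = \<mu>" using 3(4) by (simp add: prog_far_def)
    have fr2: "\<sigma>2 y = \<sigma>1 y" if "y \<noteq> 34" "y \<noteq> 36" "y \<noteq> wr i" for y using 3(3)[of y] that by (simp add: prog_far_def)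
    have p2: "pars \<sigma>2" by (rule pars_frame[OF p1]) (auto intro!: fr2 simp: wr_def)
    have X2: "\<And>l. \<sigma>2 (xr l) = ?X l" "\<sigma>2 20 = \<sigma> 20" by (simp_all add: fr2 \<sigma>1_def)
    have g2: "good Y \<sigma>2" by (rule good_frame[OF g]) (simp_all add: fr2 \<sigma>1_def)
    define W where "W = \<sigma>2 (wr i)"
    have far: "ks.farthest i ?X ?t (\<sigma>2 34) W" using 3(5) by (simp add: \<sigma>1_def W_def)
    have W: "W < n" using far by (simp add: ks.farthest_def)
    \<comment> \<open>The members of \<open>S\<close> followed by those of \<open>N w\<close>, in
      the order of the loop counter.\<close>
    define cand where "cand = (\<lambda>j. if j < sz then Sl j else rw W (j - sz))"
    have cand_less: "cand j < n" if "j < sz + q" for j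
      using that Sl_less rw_less[OF W] by (auto simp: cand_def)
    show ?case
      unfolding L_def m2
    proof (rule wp_for[where N = "sz + q" and C = "?c + 50" and I = "\<lambda>j \<sigma>3 \<mu>3. data \<mu>3 \<and> good Y \<sigma>3 \<and> (\<sigma> 20 \<noteq> 0 \<longrightarrow> \<sigma>3 20 \<noteq> 0) \<and>
        ((\<exists>j'<j. ks.completable (Suc i) (?X(i := cand j'))) \<longrightarrow> \<sigma>3 20 \<noteq> 0)"], goal_cases)
      case (9 j \<sigma>3 \<mu>3)
      have fr3: "\<sigma>3 y = \<sigma>2 y" if "y < 20 \<or> y = 23 \<or> (\<exists>l<i. y = xr l) \<or> y = wr i" for y
      proof -
        have "y \<noteq> cr i" using that by (auto simp: cr_def xr_def wr_def)
        then show ?thesis using 9(3)[of y] keep[of y] that by blast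
      qed
      have p3: "pars \<sigma>3" by (rule pars_frame[OF p2]) (auto intro!: fr3)
      note e3 = envD[OF parsD(1)[OF p3]] parsD(2-)[OF p3]
      have X3: "\<And>l. l < i \<Longrightarrow> \<sigma>3 (xr l) = ?X l" "\<sigma>3 (wr i) = W" using X2 by (auto simp: fr3 W_def)
      have I3: "data \<mu>3" "good Y \<sigma>3" "\<sigma> 20 \<noteq> 0 \<longrightarrow> \<sigma>3 20 \<noteq> 0"
        "(\<exists>j'<j. ks.completable (Suc i) (?X(i := cand j'))) \<longrightarrow> \<sigma>3 20 \<noteq> 0" using 9(5) by auto
      define \<sigma>4 where "\<sigma>4 = \<sigma>3(xr i := cand j)"
      have p4: "pars \<sigma>4" by (rule pars_frame[OF p3]) (auto simp: \<sigma>4_def xr_def)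
      have g4: "good Y \<sigma>4" by (rule good_frame[OF I3(2)]) (simp_all add: \<sigma>4_def)
      have X4: "\<sigma>4 (xr l) < n" if "l < Suc i" for l
        using that X3 X cand_less[OF 9(1)] by (auto simp: \<sigma>4_def less_Suc_eq)
      have rec: "wp w (prog_search (Suc i) r) (\<lambda>_ \<sigma>' \<mu>'. data \<mu>' \<and> good Y (\<sigma>'(cr i := Suc j)) \<and> (\<sigma> 20 \<noteq> 0 \<longrightarrow> (\<sigma>'(cr i := Suc j)) 20 \<noteq> 0) \<and>
        ((\<exists>j'<Suc j. ks.completable (Suc i) (?X(i := cand j'))) \<longrightarrow> (\<sigma>'(cr i := Suc j)) 20 \<noteq> 0)) t \<sigma>4 \<mu>3"
        if t: "?c \<le> t" for t
      proof (rule wp_call[OF Suc.IH[OF p4 X4 I3(1) _ g4] t], goal_cases)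
        case 1
        then show ?case .
      next
        case 2
        then show ?case using ir by simp
      next
        case (3 t5 \<sigma>5 \<mu>5)
        have c5: "data \<mu>5" "good Y \<sigma>5" "\<sigma>3 20 \<noteq> 0 \<longrightarrow> \<sigma>5 20 \<noteq> 0"
          "ks.completable (Suc i) (\<lambda>l. \<sigma>4 (xr l)) \<longrightarrow> \<sigma>5 20 \<noteq> 0" using 3(5) by (auto simp: \<sigma>4_def)
        have cc: "ks.completable (Suc i) (\<lambda>l. \<sigma>4 (xr l)) = ks.completable (Suc i) (?X(i := cand j))"
          by (rule completable_cong) (auto simp: \<sigma>4_def X3 less_Suc_eq)
        have "good Y (\<sigma>5(cr i := Suc j))" by (rule good_frame[OF c5(2)]) simp_all
        moreover have "\<sigma>5 20 \<noteq> 0" if "j' < Suc j" "ks.completable (Suc i) (?X(i := cand j'))" for j'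
        proof (cases "j' = j")
          case True
          then show ?thesis using that(2) c5(4) cc by simp
        next
          case False
          then show ?thesis using that I3(4) c5(3) by auto
        qed
        ultimately show ?case using c5(1,3) I3(3) by auto
      qed
      show ?case
        unfolding Bd_def
      proof (rule wp_append, rule wp_ite, goal_cases)
        case 3
        then have jsz: "j < sz" using e3 9(2) by (simp split: if_splits)
        have "aS + j < 2 ^ w" using word jsz sz_le by (auto simp: layout)
        moreover have "\<mu>3 (aS + j) = cand j" using dataD(3)[OF I3(1) jsz] jsz by (simp add: cand_def)
        ultimately show ?case using e3 9(2) rec by (intro wp_asg) (simp_all add: \<sigma>4_def)
      next
        case 4
        then have jsz: "\<not> j < sz" using e3 9(2) by (simp split: if_splits)
        then have jq: "j - sz < q" using 9(1) by simp
        have idx: "W * n + (j - sz) < n * n" using row_index_less[OF W] jq q_le by simp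
        have "aQ + W * n + (j - sz) < 2 ^ w" "W * n < 2 ^ w" "j < 2 ^ w"
          using word idx 9(1) sz_le q_le by (auto simp: layout)
        moreover have "\<mu>3 (aQ + W * n + (j - sz)) = cand j" using dataD(2)[OF I3(1) W jq] jsz by (simp add: cand_def)
        ultimately show ?case using e3 9(2) rec jsz X3(2) by (intro wp_asg) (simp_all add: \<sigma>4_def)
      qed simp_all
    next
      case (10 t4 \<sigma>4 \<mu>4)
      have "\<sigma>4 20 \<noteq> 0" if compl: "ks.completable i ?X"
      proof -
        obtain x where x: "x \<in> Sl ` {..<sz} \<union> rw W ` {..<q}" "ks.completable (Suc i) (?X(i := x))"
          using ks.completable_step[OF compl i(2) far] X by blast
        have "\<exists>j<sz + q. x = cand j"
          using x(1)
        proof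
          assume "x \<in> Sl ` {..<sz}"
          then obtain j where "j < sz" "x = Sl j" by auto
          then show ?thesis by (intro exI[of _ j]) (simp add: cand_def)
        next
          assume "x \<in> rw W ` {..<q}"
          then obtain j where "j < q" "x = rw W j" by auto
          then show ?thesis by (intro exI[of _ "sz + j"]) (simp add: cand_def)
        qed
        then show ?thesis using x(2) 10(6) by blast
      qed
      then show ?case using 10(6) by blast
    next
      case 7
      then show ?case using 3(1) t by simp
    next
      case 8
      have "good Y (\<sigma>2(cr i := 0))" by (rule good_frame[OF g2]) simp_all
      then show ?case using dat X2 by simp
    next
      case 5
      then show ?case using keep by blast
    next
      case 6
      then show ?case using keep by simp
    qed (use parsD[OF p2] word sz_le q_le one_less_word in auto)
  qed
  show ?case
    unfolding prog_search.simps Bd_def[symmetric] L_def[symmetric]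
  proof (rule wp_append, rule wp_asg, goal_cases)
    case 3
    have eq: "\<sigma>(30 := iv (Var 16 \<oplus> Lit (2 * i) \<otimes> Var 17 \<ominus> Var 17) \<sigma> \<mu>) = \<sigma>1" using parsD[OF p] by (simp add: \<sigma>1_def)
    show ?case unfolding eq by (rule main) (use T in simp)
  qed (use parsD[OF p] iw hb T in simp_all)
qed

end

section \<open>Binary search and the complete program\<close>

definition prog_round :: "nat \<Rightarrow> instr list" where
  "prog_round k = asg 17 (Var 16 \<oslash> Lit (2 * k - 1)) @ asg 18 (Lit 2 \<otimes> Var 16 \<ominus> Var 17) @
     asg 19 ((Var 16 \<ominus> Var 17) \<oslash> Lit 2) @ asg 20 (Lit 0) @ prog_search 0 (k - 1)"

definition prog_bin :: "nat \<Rightarrow> instr list" where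
  "prog_bin k = asg 21 (Lit 0) @ asg 22 (Var 0) @ whl (Var 21 \<prec> Var 22)
     (asg 16 ((Var 21 \<oplus> Var 22) \<oslash> Lit 2) @ prog_round k @ ite (Var 20) (asg 22 (Var 16)) (asg 21 (Var 16 \<oplus> Lit 1)))"

text \<open>The sum of the equality tests counts coincidences and thus acts as a
  disjunction.\<close>

fun dup :: "nat \<Rightarrow> expr \<Rightarrow> expr" where
  "dup 0 e = Lit 0"
| "dup (Suc j) e = dup j e \<oplus> (e \<doteq> Var (yr j))"

text \<open>The answer must consist of \<open>k\<close> distinct vertices. A repeated one is
  replaced by the first of \<open>0, 1, 2, ...\<close> that does not occur among the earlier
  ones.\<close>

definition prog_fresh :: "nat \<Rightarrow> instr list" where
  "prog_fresh i = asg 24 (Lit 0) @ whl (dup i (Var (yr i))) (asg (yr i) (Var 24) @ asg 24 (Var 24 \<oplus> Lit 1))"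

fun prog_pad :: "nat \<Rightarrow> instr list" where
  "prog_pad 0 = []"
| "prog_pad (Suc i) = prog_pad i @ prog_fresh i"

fun prog_store :: "nat \<Rightarrow> instr list" where
  "prog_store 0 = []"
| "prog_store (Suc l) = prog_store l @ sto (Lit l) (Var (yr l))"

definition prog_out :: "nat \<Rightarrow> instr list" where
  "prog_out k = prog_store k @ ite (Var 22 \<prec> Var 0) (asg 0 (Lit 2 \<otimes> Var 22 \<ominus> Var 22 \<oslash> Lit (2 * k - 1) \<oplus> Lit 1)) (asg 0 (Lit 0))"

text \<open>The rounded-up square root is found by counting upwards, which takes linear time and is
  negligible.\<close>

definition prog_init :: "nat \<Rightarrow> instr list" where
  "prog_init k = asg 2 (Var 1 \<oplus> Var 1) @ asg 3 (Var 2 \<oplus> Var 2) @ asg 4 (Var 3 \<oplus> Var 0) @ asg 23 (Var 0 \<otimes> Var 0) @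
     asg 5 (Var 4 \<oplus> Var 23) @ asg 6 (Var 5 \<oplus> Var 23) @ asg 7 (Var 6 \<oplus> Var 0) @ asg 8 (Var 7 \<oplus> Var 0) @
     asg 9 (Var 8 \<oplus> Var 0) @ asg 10 (Var 9 \<oplus> Var 0) @ asg 11 (Var 10 \<oplus> Var 0) @ asg 12 (Var 0 \<oplus> Var 0) @
     asg 13 (Lit 1) @ (if k = 1 then [] else whl (Var 13 \<otimes> Var 13 \<prec> Var 0) (asg 13 (Var 13 \<oplus> Lit 1)))"

definition prog_main :: "nat \<Rightarrow> instr list" where
  "prog_main k = prog_init k @ prog_apsp @ prog_greedy @ prog_near @ asg 15 (Var 14 \<oplus> Var 13) @
     prog_bin k @ prog_pad k @ prog_out k"

text \<open>For \<open>k = 1\<close> rows of length one make every vertex a member of the hitting set.\<close>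

definition row_len :: "nat \<Rightarrow> nat \<Rightarrow> nat" where
  "row_len k n = (if k = 1 then 1 else LEAST q. n \<le> q * q)"

definition approx_radius :: "nat \<Rightarrow> nat \<Rightarrow> nat" where
  "approx_radius k R = 2 * R - R div (2 * k - 1)"

context kround begin

lemma round_spec:
  assumes env: "env \<sigma>" "\<sigma> 14 = sz" "\<sigma> 15 = sz + q" "\<sigma> 16 = R" and dat: "data \<mu>"
  shows "wp w (prog_round k) (\<lambda>_ \<sigma>' \<mu>'. data \<mu>' \<and>
     (if \<sigma>' 20 = 0 then (\<forall>l<k. \<sigma>' (yr l) = \<sigma> (yr l)) \<and> \<not> k_radius n E k \<le> enat R
      else (\<forall>l<k. \<sigma>' (yr l) < n) \<and> (\<forall>z<n. \<exists>l<k. d (\<sigma>' (yr l)) z \<le> approx_radius k R)))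
     (n * (11 * k + 100) * (2 * (sz + q) + 4) ^ k + 30) \<sigma> \<mu>"
proof -
  define \<sigma>1 where "\<sigma>1 = \<sigma>(17 := ks.h, 18 := ks.D, 19 := ks.rho, 20 := 0)"
  have "env \<sigma>1" by (rule env_frame[OF env(1)]) (auto simp: \<sigma>1_def)
  then have p: "pars \<sigma>1" using env by (simp add: pars_def \<sigma>1_def)
  have g: "good (\<lambda>l. \<sigma> (yr l)) \<sigma>1" by (simp add: good_def \<sigma>1_def)
  have kk: "0 + (k - 1) + 1 = k" "Suc (k - 1) = k" using k_pos by auto
  have D: "ks.D = approx_radius k R" by (simp add: ks.D_def ks.h_def approx_radius_def)
  have hR: "R div (2 * k - 1) \<le> R" "R div (2 * k - 1) \<le> 2 * R"
    using div_le_dividend[of R "2 * k - 1"] by linarith+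
  have b: "2 * k - 1 < 2 ^ w" "2 * R < 2 ^ w"
    using k_le R_less word unfolding distrib_left by linarith+
  define L where "L = prog_search 0 (k - 1)"
  have main: "wp w L (\<lambda>_ \<sigma>' \<mu>'. data \<mu>' \<and>
     (if \<sigma>' 20 = 0 then (\<forall>l<k. \<sigma>' (yr l) = \<sigma> (yr l)) \<and> \<not> k_radius n E k \<le> enat R
      else (\<forall>l<k. \<sigma>' (yr l) < n) \<and> (\<forall>z<n. \<exists>l<k. d (\<sigma>' (yr l)) z \<le> approx_radius k R))) t \<sigma>1 \<mu>"
    if t: "n * A * B ^ k \<le> t" for t
    unfolding L_def
  proof (rule wp_call[OF search_spec[OF p _ dat kk(1) g]], goal_cases)
    case 2
    then show ?case using t kk(2) by simp
  next
    case (3 t' \<sigma>' \<mu>')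
    have "\<not> k_radius n E k \<le> enat R" if "\<sigma>' 20 = 0"
      using 3(5) that ks.completable_0 by blast
    then show ?case using 3(5) by (auto simp: good_def sound_def D)
  qed simp
  have T: "n * (11 * k + 100) * (2 * (sz + q) + 4) ^ k = n * A * B ^ k" by (simp add: A_def B_def)
  show ?thesis
    unfolding prog_round_def L_def[symmetric] T
  proof (intro wp_append wp_asg, goal_cases)
    case 9
    have eq: "iv (Var 16 \<oslash> Lit (2 * k - 1)) \<sigma> \<mu> = ks.h" using env by (simp add: ks.h_def)
    show ?case
      unfolding eq using main by (simp add: env \<sigma>1_def ks.D_def ks.rho_def)
  qed (use env b hR ks.h_def one_less_word word in \<open>simp_all\<close>)
qed

end

lemma vw_round: "vw (prog_round k) \<subseteq> {17, 18, 19, 20, 30, 34, 35, 36, 37, 38, 39} \<union> range yr \<union> (range xr \<union> range cr \<union> range wr)"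
  unfolding prog_round_def using vw_search[of 0 "k - 1"] by auto

lemma not_in_vw_round: "x < 17 \<or> x = 21 \<or> x = 22 \<or> x = 23 \<Longrightarrow> x \<notin> vw (prog_round k)"
  using vw_round[of k] by (auto simp: xr_def yr_def cr_def wr_def dest!: subsetD)

context ksrch begin

definition "round_cost = n * (11 * k + 100) * (2 * (sz + q) + 4) ^ k + 60"

text \<open>Success of a round need not be monotone in \<open>R\<close>. Two certificates suffice:
  failure at \<open>R\<close> proves that the \<open>k\<close>-radius exceeds \<open>R\<close>, and
  success at \<open>R\<close> yields a cover of radius \<open>approx_radius k R\<close>. The initial
  upper end \<open>n\<close> stands for an infinite radius and is never tested.\<close>

lemma bin_spec:
  assumes env: "env \<sigma>" "\<sigma> 14 = sz" "\<sigma> 15 = sz + q" and dat: "data \<mu>" and Y: "\<And>l. l < k \<Longrightarrow> \<sigma> (yr l) < n"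
  shows "wp w (prog_bin k) (\<lambda>_ \<sigma>' \<mu>'. (\<forall>l<k. \<sigma>' (yr l) < n) \<and> \<sigma>' 22 \<le> n \<and> (\<forall>R<\<sigma>' 22. \<not> k_radius n E k \<le> enat R) \<and>
     (\<sigma>' 22 < n \<longrightarrow> (\<forall>z<n. \<exists>l<k. d (\<sigma>' (yr l)) z \<le> approx_radius k (\<sigma>' 22))))
     (floorlog 2 n * round_cost + 20) \<sigma> \<mu>"
proof -
  define Bd where "Bd = asg 16 ((Var 21 \<oplus> Var 22) \<oslash> Lit 2) @ prog_round k @ ite (Var 20) (asg 22 (Var 16)) (asg 21 (Var 16 \<oplus> Lit 1))"
  let ?I = "\<lambda>t (\<sigma>1 :: nat \<Rightarrow> nat) \<mu>1. data \<mu>1 \<and> (\<forall>l<k. \<sigma>1 (yr l) < n) \<and> \<sigma>1 21 \<le> \<sigma>1 22 \<and> \<sigma>1 22 \<le> n \<and>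
     (\<forall>R<\<sigma>1 21. \<not> k_radius n E k \<le> enat R) \<and>
     (\<sigma>1 22 < n \<longrightarrow> (\<forall>z<n. \<exists>l<k. d (\<sigma>1 (yr l)) z \<le> approx_radius k (\<sigma>1 22))) \<and>
     floorlog 2 (\<sigma>1 22 - \<sigma>1 21) * round_cost + 8 \<le> t"
  have loop: "wp w (whl (Var 21 \<prec> Var 22) Bd) (\<lambda>_ \<sigma>' \<mu>'. (\<forall>l<k. \<sigma>' (yr l) < n) \<and> \<sigma>' 22 \<le> n \<and> (\<forall>R<\<sigma>' 22. \<not> k_radius n E k \<le> enat R) \<and>
     (\<sigma>' 22 < n \<longrightarrow> (\<forall>z<n. \<exists>l<k. d (\<sigma>' (yr l)) z \<le> approx_radius k (\<sigma>' 22)))) t (\<sigma>(21 := 0, 22 := n)) \<mu>"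
    if t: "floorlog 2 n * round_cost + 8 \<le> t" for t
  proof (rule wp_while[where I = ?I], goal_cases)
    case 1
    then show ?case using t Y dat by simp
  next
    case (2 t1 \<sigma>1 \<mu>1)
    have vwB: "x \<notin> vw Bd" if "x < 16 \<or> x = 23" for x
      using that not_in_vw_round[of x k] by (auto simp: Bd_def)
    have fr1: "\<sigma>1 x = \<sigma> x" if "x < 16 \<or> x = 23" for x using 2(1)[OF vwB[OF that]] that by auto
    have env1: "env \<sigma>1" by (rule env_frame[OF env(1)]) (auto intro!: fr1)
    have r1: "\<sigma>1 14 = sz" "\<sigma>1 15 = sz + q" using fr1[of 14] fr1[of 15] env by auto
    define lo where "lo = \<sigma>1 21"
    define hi where "hi = \<sigma>1 22"
    have I: "data \<mu>1" "\<And>l. l < k \<Longrightarrow> \<sigma>1 (yr l) < n" "lo \<le> hi" "hi \<le> n" "\<And>R. R < lo \<Longrightarrow> \<not> k_radius n E k \<le> enat R"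
      "hi < n \<Longrightarrow> \<forall>z<n. \<exists>l<k. d (\<sigma>1 (yr l)) z \<le> approx_radius k hi" "floorlog 2 (hi - lo) * round_cost + 8 \<le> t1"
      using 2(2) by (auto simp: lo_def hi_def)
    show ?case
    proof (cases "lo < hi")
      case False
      then show ?thesis using I by (auto simp: lo_def hi_def)
    next
      case True
      define R where "R = (lo + hi) div 2"
      have R: "lo \<le> R" "R < hi" "R - lo \<le> (hi - lo) div 2" "hi - (R + 1) \<le> (hi - lo) div 2" using True by (auto simp: R_def)
      have Rn: "R < n" using R I(4) by simp
      interpret kr: kround n E k es w q sz Sl rw dS pS R by unfold_locales (rule Rn)
      \<comment> \<open>Halving the interval lowers \<open>floorlog\<close> by one, so it counts the
        rounds that remain.\<close>
      have fl: "floorlog 2 (hi - lo) = Suc (floorlog 2 ((hi - lo) div 2))"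
        using True by (subst compute_floorlog) simp
      have rc: "floorlog 2 ((hi - lo) div 2) * round_cost + round_cost + 8 \<le> t1" using I(7) unfolding fl by simp
      have less: "floorlog 2 x * round_cost \<le> floorlog 2 ((hi - lo) div 2) * round_cost" if "x \<le> (hi - lo) div 2" for x
        using that by (intro mult_le_mono1 floorlog_mono)
      define \<sigma>2 where "\<sigma>2 = \<sigma>1(16 := R)"
      have env2: "env \<sigma>2" by (rule env_frame[OF env1]) (auto simp: \<sigma>2_def)
      have r2: "\<sigma>2 14 = sz" "\<sigma>2 15 = sz + q" "\<sigma>2 16 = R" using r1 by (auto simp: \<sigma>2_def)
      define L where "L = ite (Var 20) (asg 22 (Var 16)) (asg 21 (Var 16 \<oplus> Lit 1))"
      have rest: "wp w (prog_round k @ L) ?I t \<sigma>2 \<mu>1" if t: "t1 - 20 \<le> t" for t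
      proof (rule wp_append, rule wp_call[OF kr.round_spec[OF env2 r2 I(1)]], goal_cases)
        case 1
        then show ?case using t rc by (simp add: round_cost_def)
      next
        case (2 t3 \<sigma>3 \<mu>3)
        have fr3: "\<sigma>3 x = \<sigma>2 x" if "x < 17 \<or> x = 21 \<or> x = 22" for x using 2(3)[OF not_in_vw_round[of x k]] that by auto
        have r3: "\<sigma>3 16 = R" "\<sigma>3 21 = lo" "\<sigma>3 22 = hi" by (simp_all add: fr3 \<sigma>2_def lo_def hi_def)
        have t3: "floorlog 2 ((hi - lo) div 2) * round_cost + 18 \<le> t3"
          using 2(1) t rc by (simp add: round_cost_def)
        have d3: "data \<mu>3" using 2(5) by blast
        have b: "R + 1 < 2 ^ w" using Rn word by simp
        show ?case
        proof (cases "\<sigma>3 20 = 0")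
          case True
          have y: "\<And>l. l < k \<Longrightarrow> \<sigma>3 (yr l) = \<sigma>1 (yr l)" "\<not> k_radius n E k \<le> enat R"
            using 2(5) True by (auto simp: \<sigma>2_def)
          have lo': "\<not> k_radius n E k \<le> enat R'" if "R' < R + 1" for R'
          proof
            assume "k_radius n E k \<le> enat R'"
            also have "enat R' \<le> enat R" using that by simp
            finally show False using y(2) by simp
          qed
          have cov: "\<exists>l<k. d (\<sigma>3 (yr l)) z \<le> approx_radius k hi" if "hi < n" "z < n" for z
          proof -
            from I(6)[OF that(1)] obtain l where "l < k" "d (\<sigma>1 (yr l)) z \<le> approx_radius k hi"
              using \<open>z < n\<close> by blast
            then show ?thesis using y(1)[of l] by (intro exI[of _ l]) simp
          qed
          have "?I (t3 - 6) (\<sigma>3(21 := R + 1)) \<mu>3"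
          proof (intro conjI)
            have "floorlog 2 (hi - (R + 1)) * round_cost + 8 \<le> t3 - 6"
              using less[OF R(4)] t3 by linarith
            then show "floorlog 2 ((\<sigma>3(21 := R + 1)) 22 - (\<sigma>3(21 := R + 1)) 21) * round_cost + 8 \<le> t3 - 6"
              using r3 by simp
          qed (use d3 y I(2-4) R r3 lo' cov in auto)
          then have Q: "J (t3 - 6) (\<sigma>3(21 := R + 1)) \<mu>3" if "J = ?I" for J unfolding that .
          show ?thesis
            unfolding L_def
          proof (rule wp_ite, goal_cases)
            case 4
            show ?case
              by (rule wp_asg) (use r3 b t3 one_less_word Q[OF refl] in simp_all)
          qed (use True t3 in simp_all)
        next
          case False
          have y: "\<And>l. l < k \<Longrightarrow> \<sigma>3 (yr l) < n" "\<forall>z<n. \<exists>l<k. d (\<sigma>3 (yr l)) z \<le> approx_radius k R"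
            using 2(5) False by auto
          have "?I (t3 - 4) (\<sigma>3(22 := R)) \<mu>3"
          proof (intro conjI)
            have "floorlog 2 (R - lo) * round_cost + 8 \<le> t3 - 4"
              using less[OF R(3)] t3 by linarith
            then show "floorlog 2 ((\<sigma>3(22 := R)) 22 - (\<sigma>3(22 := R)) 21) * round_cost + 8 \<le> t3 - 4"
              using r3 by simp
          qed (use d3 y I R r3 in auto)
          then have Q: "J (t3 - 4) (\<sigma>3(22 := R)) \<mu>3" if "J = ?I" for J unfolding that .
          show ?thesis
            unfolding L_def
          proof (rule wp_ite, goal_cases)
            case 3
            show ?case
              by (rule wp_asg) (use r3 t3 Q[OF refl] in simp_all)
          qed (use False t3 in simp_all)
        qed
      qed
      have b: "lo + hi < 2 ^ w" using R I(4) word by simp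
      have rc60: "60 \<le> round_cost" by (simp add: round_cost_def)
      have "wp w Bd ?I (t1 - 4) \<sigma>1 \<mu>1"
        unfolding Bd_def L_def[symmetric]
      proof (rule wp_append, rule wp_asg, goal_cases)
        case 3
        have eq: "\<sigma>1(16 := iv ((Var 21 \<oplus> Var 22) \<oslash> Lit 2) \<sigma>1 \<mu>1) = \<sigma>2"
          by (simp add: \<sigma>2_def R_def lo_def hi_def)
        show ?case unfolding eq by (rule rest) simp
      qed (use b rc rc60 one_less_word word in \<open>simp_all add: lo_def hi_def\<close>)
      then show ?thesis using True rc rc60 by (simp add: lo_def hi_def)
    qed
  qed
  show ?thesis
    unfolding prog_bin_def Bd_def[symmetric]
  proof (intro wp_append wp_asg, goal_cases)
    case 5
    have eq: "\<sigma>(21 := iv (Lit 0) \<sigma> \<mu>, 22 := iv (Var 0) (\<sigma>(21 := iv (Lit 0) \<sigma> \<mu>)) \<mu>) = \<sigma>(21 := 0, 22 := n)"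
      using envD[OF env(1)] by simp
    show ?case unfolding eq by (rule loop) simp
  qed simp_all
qed

end

section \<open>Padding, output and initialisation\<close>

context kinst begin

lemma dup_eval:
  assumes "i \<le> n" "ok w e \<sigma> \<mu>"
  shows "ok w (dup i e) \<sigma> \<mu> \<and> iv (dup i e) \<sigma> \<mu> \<le> i \<and>
    (iv (dup i e) \<sigma> \<mu> = 0 \<longleftrightarrow> iv e \<sigma> \<mu> \<notin> (\<lambda>l. \<sigma> (yr l)) ` {..<i})"
  using assms(1)
proof (induction i)
  case 0
  then show ?case by simp
next
  case (Suc i)
  have b: "Suc i < 2 ^ w" using Suc.prems word by simp
  show ?case
    using Suc b assms(2) by (auto simp: lessThan_Suc)
qed

lemma esz_dup: "esz (dup i (Var x)) = 4 * i + 1"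
  by (induction i) auto

text \<open>A center is replaced only if it already belongs to \<open>Z\<close>, so no covering
  vertex gets lost.\<close>

lemma fresh_spec:
  assumes i: "i < k" and Y: "\<sigma> (yr i) < n"
  defines "Z \<equiv> (\<lambda>l. \<sigma> (yr l)) ` {..<i}"
  shows "wp w (prog_fresh i) (\<lambda>_ \<sigma>' \<mu>'. \<sigma>' (yr i) < n \<and> \<sigma>' (yr i) \<notin> Z \<and> \<sigma> (yr i) \<in> insert (\<sigma>' (yr i)) Z)
     ((k + 3) * (4 * k + 20)) \<sigma> \<mu>"
proof -
  let ?c = "4 * k + 20"
  have cZ: "card Z \<le> i" unfolding Z_def using card_image_le[of "{..<i}"] by simp
  have fZ: "finite Z" by (simp add: Z_def)
  \<comment> \<open>Pigeonhole: \<open>Z\<close> has at most \<open>i\<close> elements, so one of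
    \<open>0, ..., i\<close> is free and the loop ends in time.\<close>
  have tb: "t \<le> i" if "\<forall>s<t. s \<in> Z" for t
  proof -
    have "card {..<t} \<le> card Z" by (rule card_mono[OF fZ]) (use that in auto)
    then show ?thesis using cZ by simp
  qed
  let ?I = "\<lambda>t (\<sigma>1 :: nat \<Rightarrow> nat) (\<mu>1 :: nat \<Rightarrow> nat). (i + 2 - \<sigma>1 24) * ?c \<le> t \<and> \<sigma>1 24 \<le> i + 1 \<and> \<sigma>1 (yr i) < n \<and>
     (if \<sigma>1 24 = 0 then \<sigma>1 (yr i) = \<sigma> (yr i) else \<sigma>1 (yr i) = \<sigma>1 24 - 1 \<and> (\<forall>s<\<sigma>1 24 - 1. s \<in> Z) \<and> \<sigma> (yr i) \<in> Z)"
  have loop: "wp w (whl (dup i (Var (yr i))) (asg (yr i) (Var 24) @ asg 24 (Var 24 \<oplus> Lit 1)))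
     (\<lambda>_ \<sigma>' \<mu>'. \<sigma>' (yr i) < n \<and> \<sigma>' (yr i) \<notin> Z \<and> \<sigma> (yr i) \<in> insert (\<sigma>' (yr i)) Z) t (\<sigma>(24 := 0)) \<mu>"
    if t: "(i + 2) * ?c \<le> t" for t
  proof (rule wp_while[where I = ?I], goal_cases)
    case 1
    then show ?case using t Y by simp
  next
    case (2 t1 \<sigma>1 \<mu>1)
    have Z1: "(\<lambda>l. \<sigma>1 (yr l)) ` {..<i} = Z"
      unfolding Z_def by (intro image_cong refl) (subst 2(1); auto)
    have dup: "ok w (dup i (Var (yr i))) \<sigma>1 \<mu>1" "iv (dup i (Var (yr i))) \<sigma>1 \<mu>1 = 0 \<longleftrightarrow> \<sigma>1 (yr i) \<notin> Z"
      using dup_eval[of i "Var (yr i)" \<sigma>1 \<mu>1] i k_le Z1 by auto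
    define s where "s = \<sigma>1 24"
    have I: "(i + 2 - s) * ?c \<le> t1" "s \<le> i + 1" "\<sigma>1 (yr i) < n"
      "if s = 0 then \<sigma>1 (yr i) = \<sigma> (yr i) else \<sigma>1 (yr i) = s - 1 \<and> (\<forall>s'<s - 1. s' \<in> Z) \<and> \<sigma> (yr i) \<in> Z"
      using 2(2) unfolding s_def by blast+
    have "i + 2 - s = Suc (i + 1 - s)" using I(2) by simp
    then have t1: "(i + 1 - s) * ?c + ?c \<le> t1" using I(1) by (simp only: mult_Suc add.commute)
    have e: "esz (dup i (Var (yr i))) + 10 \<le> ?c" using i by (simp add: esz_dup)
    show ?case
    proof (cases "\<sigma>1 (yr i) \<in> Z")
      case False
      then show ?thesis using dup I t1 e by (auto split: if_splits)
    next
      case True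
      have all: "\<forall>s'<s. s' \<in> Z"
      proof (intro allI impI)
        fix s' assume "s' < s"
        then show "s' \<in> Z" using I(4) True by (cases "s' = s - 1") (auto split: if_splits)
      qed
      have s: "s \<le> i" using tb[OF all] .
      have orig: "\<sigma> (yr i) \<in> Z" using I(4) True by (auto split: if_splits)
      have Q: "?I t2 (\<sigma>1(yr i := s, 24 := s + 1)) \<mu>1" if "(i + 1 - s) * ?c \<le> t2" for t2
        using that s all orig i k_le by (simp add: Suc_eq_plus1)
      have b: "s + 1 < 2 ^ w" using s i k_le word by simp
      define J where "J = ?I"
      have Q': "J t2 (\<sigma>1(yr i := s, 24 := s + 1)) \<mu>1" if "(i + 1 - s) * ?c \<le> t2" for t2 using Q[OF that] unfolding J_def .
      have "wp w (asg (yr i) (Var 24) @ asg 24 (Var 24 \<oplus> Lit 1)) J (t1 - (esz (dup i (Var (yr i))) + 1)) \<sigma>1 \<mu>1"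
        using b t1 e one_less_word Q' by (intro wp_append wp_asg) (simp_all flip: s_def)
      then show ?thesis using dup True t1 e unfolding J_def by auto
    qed
  qed
  have T: "(i + 2) * ?c + 2 \<le> (k + 3) * ?c"
  proof -
    have "(i + 2) * ?c \<le> (k + 2) * ?c" using i by (intro mult_le_mono1) simp
    moreover have "(k + 3) * ?c = (k + 2) * ?c + ?c" by (simp add: algebra_simps)
    ultimately show ?thesis by linarith
  qed
  show ?thesis
    unfolding prog_fresh_def
  proof (rule wp_append, rule wp_asg, goal_cases)
    case 3
    show ?case using loop T by simp
  qed (use T in simp_all)
qed

lemma pad_spec:
  assumes "i \<le> k" and Y: "\<And>l. l < k \<Longrightarrow> \<sigma> (yr l) < n"
  shows "wp w (prog_pad i) (\<lambda>_ \<sigma>' \<mu>'. inj_on (\<lambda>l. \<sigma>' (yr l)) {..<i} \<and> (\<forall>l<i. \<sigma>' (yr l) < n) \<and>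
      (\<lambda>l. \<sigma> (yr l)) ` {..<i} \<subseteq> (\<lambda>l. \<sigma>' (yr l)) ` {..<i}) (i * ((k + 3) * (4 * k + 20))) \<sigma> \<mu>"
  using assms(1)
proof (induction i)
  case 0
  then show ?case by (simp add: wp_Nil)
next
  case (Suc i)
  have vwp: "vw (prog_pad i) \<subseteq> insert 24 (yr ` {..<i})" for i
    by (induction i) (auto simp: prog_fresh_def lessThan_Suc)
  show ?case
    unfolding prog_pad.simps
  proof (rule wp_append, rule wp_call[OF Suc.IH], goal_cases)
    case (3 t1 \<sigma>1 \<mu>1)
    have y1: "\<sigma>1 (yr i) = \<sigma> (yr i)" by (rule 3(3)) (use vwp[of i] in auto)
    have ik: "i < k" using Suc.prems by simp
    have I1: "inj_on (\<lambda>l. \<sigma>1 (yr l)) {..<i}" "\<forall>l<i. \<sigma>1 (yr l) < n" "(\<lambda>l. \<sigma> (yr l)) ` {..<i} \<subseteq> (\<lambda>l. \<sigma>1 (yr l)) ` {..<i}"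
      using 3(5) by auto
    show ?case
    proof (rule wp_call[OF fresh_spec[OF ik]], goal_cases)
      case 1
      then show ?case using y1 Y ik by simp
    next
      case 2
      then show ?case using 3(1) by simp
    next
      case (3 t2 \<sigma>2 \<mu>2)
      have y2: "\<sigma>2 (yr l) = \<sigma>1 (yr l)" if "l < i" for l by (rule 3(3)) (use that in \<open>auto simp: prog_fresh_def\<close>)
      have im: "(\<lambda>l. \<sigma>2 (yr l)) ` {..<i} = (\<lambda>l. \<sigma>1 (yr l)) ` {..<i}" using y2 by (intro image_cong) auto
      have "inj_on (\<lambda>l. \<sigma>2 (yr l)) {..<i}" using I1(1) y2 by (subst inj_on_cong[where g = "\<lambda>l. \<sigma>1 (yr l)"]) auto
      then have "inj_on (\<lambda>l. \<sigma>2 (yr l)) {..<Suc i}" unfolding lessThan_Suc using 3(5) im by simp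
      moreover have "\<forall>l<Suc i. \<sigma>2 (yr l) < n" using y2 I1(2) 3(5) by (auto simp: less_Suc_eq)
      moreover have "(\<lambda>l. \<sigma> (yr l)) ` {..<Suc i} \<subseteq> (\<lambda>l. \<sigma>2 (yr l)) ` {..<Suc i}"
        unfolding lessThan_Suc image_insert im using I1(3) 3(5) y1 by auto
      ultimately show ?case by blast
    qed
  qed (use Suc.prems in simp_all)
qed

lemma store_spec:
  assumes "i \<le> k"
  shows "wp w (prog_store i) (\<lambda>_ \<sigma>' \<mu>'. \<forall>l<i. \<mu>' l = \<sigma> (yr l)) (i * 3) \<sigma> \<mu>"
  using assms
proof (induction i)
  case 0
  then show ?case by (simp add: wp_Nil)
next
  case (Suc i)
  have vws: "vw (prog_store i) = {}" for i by (induction i) auto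
  have b: "i < 2 ^ w" using Suc.prems k_le word by simp
  show ?case
    unfolding prog_store.simps
  proof (rule wp_append, rule wp_call[OF Suc.IH], goal_cases)
    case (3 t \<sigma>1 \<mu>1)
    have "\<sigma>1 = \<sigma>" using 3(3) vws by auto
    then show ?case using 3(1,5) b by (intro wp_sto) (auto simp: less_Suc_eq)
  qed (use Suc.prems in simp_all)
qed

lemma out_spec:
  assumes r: "\<sigma> 0 = n" "\<sigma> 22 \<le> n"
  shows "wp w (prog_out k) (\<lambda>_ \<sigma>' \<mu>'. (\<forall>l<k. \<mu>' l = \<sigma> (yr l)) \<and>
      \<sigma>' 0 = (if \<sigma> 22 < n then Suc (approx_radius k (\<sigma> 22)) else 0)) (k * 3 + 30) \<sigma> \<mu>"
  unfolding prog_out_def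
proof (rule wp_append, rule wp_call[OF store_spec[OF le_refl]], goal_cases)
  case (2 t \<sigma>1 \<mu>1)
  have vws: "vw (prog_store i) = {}" for i by (induction i) auto
  have s1: "\<sigma>1 = \<sigma>" using 2(3) vws by auto
  have d: "\<sigma> 22 div (2 * k - 1) \<le> 2 * \<sigma> 22" using div_le_dividend[of "\<sigma> 22" "2 * k - 1"] by linarith
  have "2 * \<sigma> 22 + 1 < 2 ^ w" using r(2) word by simp
  then have b: "2 * \<sigma> 22 < 2 ^ w" "2 * \<sigma> 22 - \<sigma> 22 div (2 * k - 1) + 1 < 2 ^ w" "2 * k - 1 < 2 ^ w"
    using k_le word by (linarith, linarith, simp)
  have b2: "2 < (2::nat) ^ w" using word by simp
  show ?case
    unfolding s1 using 2(1,5) r d b b2 one_less_word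
    by (intro wp_ite wp_asg) (auto simp: approx_radius_def)
qed simp

end

lemma row_len_bounds:
  assumes "1 \<le> n"
  shows "1 \<le> row_len k n" "row_len k n \<le> n" "k \<noteq> 1 \<Longrightarrow> n \<le> row_len k n * row_len k n"
    "k \<noteq> 1 \<Longrightarrow> (row_len k n - 1) * (row_len k n - 1) < n"
proof -
  have ex: "n \<le> n * n" using assms by simp
  have a: "n \<le> row_len k n * row_len k n" if "k \<noteq> 1"
    unfolding row_len_def using LeastI[of "\<lambda>q. n \<le> q * q", OF ex] that by simp
  then show "k \<noteq> 1 \<Longrightarrow> n \<le> row_len k n * row_len k n" .
  show 1: "1 \<le> row_len k n"
  proof (cases "k = 1")
    case False
    then have "row_len k n \<noteq> 0" using a assms by (metis mult_0 le_zero_eq not_one_le_zero)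
    then show ?thesis by simp
  qed (simp add: row_len_def)
  show "row_len k n \<le> n"
    unfolding row_len_def using Least_le[of "\<lambda>q. n \<le> q * q", OF ex] assms by simp
  show "(row_len k n - 1) * (row_len k n - 1) < n" if "k \<noteq> 1"
  proof (rule ccontr)
    assume "\<not> ?thesis"
    then have "row_len k n \<le> row_len k n - 1"
      unfolding row_len_def using that Least_le[of "\<lambda>q. n \<le> q * q" "row_len k n - 1"] by (simp add: row_len_def)
    then show False using 1 by simp
  qed
qed

context kinst begin

lemma init_spec:
  assumes q: "q = row_len k n" and r: "\<sigma> 0 = n" "\<sigma> 1 = m"
  shows "wp w (prog_init k) (\<lambda>_ \<sigma>' \<mu>'. env \<sigma>') (n * 20 + 100) \<sigma> \<mu>"
proof -
  define L where "L = (if k = 1 then [] else whl (Var 13 \<otimes> Var 13 \<prec> Var 0) (asg 13 (Var 13 \<oplus> Lit 1)))"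
  define \<sigma>1 where "\<sigma>1 = \<sigma>(2 := 2 * m, 3 := aH, 4 := aD, 23 := n * n, 5 := aQ, 6 := aU, 7 := aC, 8 := aS, 9 := aDS,
     10 := aPS, 11 := aN, 12 := 2 * n, 13 := 1)"
  have env1: "env (\<sigma>1(13 := q))" using r by (simp add: env_def \<sigma>1_def)
  have loop: "wp w L (\<lambda>_ \<sigma>' \<mu>'. env \<sigma>') t \<sigma>1 \<mu>" if t: "n * 20 + 20 \<le> t" for t
  proof (cases "k = 1")
    case True
    then have "q = 1" using q by (simp add: row_len_def)
    then have "env \<sigma>1" using env1 by (simp add: \<sigma>1_def)
    then show ?thesis using True by (simp add: L_def wp_Nil)
  next
    case False
    have L: "L = whl (Var 13 \<otimes> Var 13 \<prec> Var 0) (asg 13 (Var 13 \<oplus> Lit 1))" using False by (simp add: L_def)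
    note ql = row_len_bounds[OF n_pos, of k, folded q]
    have small: "p * p < n" if "p < q" for p
    proof -
      have "p * p \<le> (q - 1) * (q - 1)" using that by (intro mult_le_mono) auto
      then show ?thesis using ql(4)[OF False] by simp
    qed
    show ?thesis
      unfolding L
    proof (rule wp_while[where I = "\<lambda>t \<sigma>2 \<mu>2. \<sigma>2 13 \<le> q \<and> (n - \<sigma>2 13) * 20 + 20 \<le> t"], goal_cases)
      case 1
      then show ?case using t q_pos by (simp add: \<sigma>1_def)
    next
      case (2 t2 \<sigma>2 \<mu>2)
      define p where "p = \<sigma>2 13"
      have fr: "\<sigma>2 x = \<sigma>1 x" if "x \<noteq> 13" for x using 2(1)[of x] that by simp
      have I: "p \<le> q" "(n - p) * 20 + 20 \<le> t2" using 2(2) by (auto simp: p_def)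
      have "\<sigma>2 0 = n" using r by (simp add: fr \<sigma>1_def)
      have pp: "p * p \<le> n * n" "p \<le> n" using I(1) q_le by (auto intro!: mult_le_mono)
      then have b: "p * p < 2 ^ w" "p + 1 < 2 ^ w" using word by auto
      show ?case
      proof (cases "p < q")
        case True
        then have pn: "p < n" using q_le by simp
        then have "(n - p) * 20 = (n - (p + 1)) * 20 + 20" by simp
        then have "wp w (asg 13 (Var 13 \<oplus> Lit 1)) (\<lambda>t \<sigma>2 \<mu>2. \<sigma>2 13 \<le> q \<and> (n - \<sigma>2 13) * 20 + 20 \<le> t) (t2 - 6) \<sigma>2 \<mu>2"
          using I True b one_less_word by (intro wp_asg) (simp_all flip: p_def)
        then show ?thesis using small[OF True] I b \<open>\<sigma>2 0 = n\<close> by (simp flip: p_def)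
      next
        case False
        then have pq: "p = q" using I by simp
        have "env \<sigma>2"
        proof (rule env_frame[OF env1])
          fix x :: nat
          show "\<sigma>2 x = (\<sigma>1(13 := q)) x" using fr[of x] pq by (auto simp: p_def)
        qed
        moreover have "\<not> p * p < n" using ql(3)[OF \<open>k \<noteq> 1\<close>] pq by simp
        ultimately show ?thesis using I b \<open>\<sigma>2 0 = n\<close> by (simp flip: p_def)
      qed
    qed
  qed
  have b: "aN < 2 ^ w" "n * n < 2 ^ w" "2 * n < 2 ^ w" using word by (auto simp: layout)
  then have bs: "2 * m < 2 ^ w" "aH < 2 ^ w" "aD < 2 ^ w" "aQ < 2 ^ w" "aU < 2 ^ w" "aC < 2 ^ w" "aS < 2 ^ w" "aDS < 2 ^ w" "aPS < 2 ^ w"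
    by (auto simp: layout)
  have eqs: "m + m = 2 * m" "2 * m + 2 * m = aH" "aH + n = aD" "aD + n * n = aQ" "aQ + n * n = aU" "aU + n = aC"
    "aC + n = aS" "aS + n = aDS" "aDS + n = aPS" "aPS + n = aN" "n + n = 2 * n"
    by (auto simp: layout)
  show ?thesis
    unfolding prog_init_def L_def[symmetric]
    using r b bs one_less_word loop
    by (intro wp_append wp_asg) (simp_all add: eqs \<sigma>1_def)
qed

end

section \<open>Correctness of the whole program\<close>

text \<open>With \<open>p = 2 * k - 1\<close>, rounding down loses little:
  \<open>R div p \<ge> (R + 1) / p - 1\<close>. This is where the additive term
  \<open>1 - 1 / p\<close> comes from.\<close>

lemma approx_radius_le:
  assumes "1 \<le> k" "R \<le> r"
  shows "real (approx_radius k R) \<le> (2 - 1 / (2 * real k - 1)) * real r + (1 - 1 / (2 * real k - 1))"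
proof -
  define p where "p = 2 * k - 1"
  have p: "1 \<le> p" "real p = 2 * real k - 1" using assms(1) by (auto simp: p_def)
  have "R < p * (R div p) + p" using p mult_div_mod_eq[of p R] mod_less_divisor[of p R] by linarith
  then have "R + 1 \<le> p * (R div p) + p" by simp
  then have "real R + 1 \<le> real p * real (R div p) + real p"
    by (metis of_nat_1 of_nat_add of_nat_le_iff of_nat_mult)
  then have 1: "(real R + 1) / real p \<le> real (R div p) + 1" using p(1) by (simp add: field_simps)
  have "R div p \<le> 2 * R" using div_le_dividend[of R p] by linarith
  then have "real (approx_radius k R) = 2 * real R - real (R div p)"
    by (simp add: approx_radius_def p_def of_nat_diff)
  also have "\<dots> \<le> 2 * real R - (real R + 1) / real p + 1" using 1 by simp
  also have "\<dots> = (2 - 1 / real p) * real R + (1 - 1 / real p)" by (simp add: field_simps add_divide_distrib)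
  also have "\<dots> \<le> (2 - 1 / real p) * real r + (1 - 1 / real p)"
    using p assms(2) by (intro add_right_mono mult_left_mono) (auto simp: field_simps)
  finally show ?thesis by (simp add: p(2))
qed

context kgraph begin

text \<open>A finite distance is at most \<open>n - 1\<close>; hence a lower bound that excludes all
  guesses below \<open>n\<close> proves the radius infinite.\<close>

lemma k_radius_less_or_inf: "k_radius n E k \<le> enat (n - 1) \<or> k_radius n E k = \<infinity>"
proof (cases "k_radius n E k = \<infinity>")
  case False
  then have "k_radius n E k < \<infinity>" by simp
  then obtain C where C: "C \<subseteq> {..<n}" "card C = k" "(SUP v\<in>{..<n}. set_gdist E v C) < \<infinity>"
    unfolding k_radius_def INF_less_iff by blast
  have "set_gdist E v C \<le> enat (n - 1)" if "v \<in> {..<n}" for v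
  proof -
    have "set_gdist E v C \<le> (SUP v\<in>{..<n}. set_gdist E v C)" using that by (rule SUP_upper)
    then have "set_gdist E v C < \<infinity>" using C(3) by (rule le_less_trans)
    then obtain c where c: "c \<in> C" "gdist E v c < \<infinity>" unfolding set_gdist_def INF_less_iff by blast
    then obtain j where j: "gdist E v c = enat j" by (cases "gdist E v c") auto
    have "j < n" using gdist_finite_less[OF _ j] that by simp
    then have "gdist E v c \<le> enat (n - 1)" using j by simp
    then show ?thesis unfolding set_gdist_def using c(1) by (rule INF_lower2[rotated])
  qed
  then have "(SUP v\<in>{..<n}. set_gdist E v C) \<le> enat (n - 1)" by (rule SUP_least)
  then have "k_radius n E k \<le> enat (n - 1)"
    unfolding k_radius_def using C(1,2) by (intro INF_lower2[of C]) auto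
  then show ?thesis ..
qed simp

text \<open>All guesses below \<open>hi\<close> fail, so \<open>hi\<close> is at most the true
  radius, and the error bound at \<open>hi\<close> is at most the one at that radius. The value
  \<open>hi = n\<close> means an infinite radius.\<close>

lemma approx_from_search:
  fixes hi k :: nat and C :: "nat set"
  assumes k: "1 \<le> k" and C: "C \<subseteq> {..<n}" "card C = k"
    and low: "\<And>R. R < hi \<Longrightarrow> \<not> k_radius n E k \<le> enat R" and hi: "hi \<le> n"
    and cov: "hi < n \<Longrightarrow> \<forall>z<n. \<exists>c\<in>C. d c z \<le> approx_radius k hi"
  shows "k_center_approx (2 - 1 / (2 * real k - 1)) (1 - 1 / (2 * real k - 1)) n E k
    (case (if hi < n then Suc (approx_radius k hi) else 0) of 0 \<Rightarrow> \<infinity> | Suc r \<Rightarrow> enat r) C"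
proof -
  \<comment> \<open>Positivity of the factor keeps its product with an infinite radius
    infinite.\<close>
  have al: "0 < 2 - 1 / (2 * real k - 1)"
    using k by (simp add: field_simps)
  show ?thesis
  proof (cases "hi < n")
    case True
    let ?D = "approx_radius k hi"
    have D: "?D < 2 * n" using True by (simp add: approx_radius_def)
    have c: "set_gdist E v C \<le> enat ?D" if "v < n" for v
    proof -
      obtain c where "c \<in> C" "d c v \<le> ?D" using cov[OF True] \<open>v < n\<close> by blast
      then have "gdist E v c \<le> enat ?D" using d_gdist_le[OF that D, of c] d_commute[of c v] by simp
      then show ?thesis unfolding set_gdist_def using \<open>c \<in> C\<close> by (rule INF_lower2[rotated])
    qed
    have rad: "k_radius n E k \<le> enat ?D"
      unfolding k_radius_def using C c by (intro INF_lower2[of C] SUP_least) auto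
    then obtain r where r: "k_radius n E k = enat r" by (cases "k_radius n E k") auto
    have "hi \<le> r"
    proof (rule ccontr)
      assume "\<not> hi \<le> r"
      then show False using low[of r] r by simp
    qed
    from approx_radius_le[OF k this]
    have "ereal_of_enat (enat ?D) \<le> ereal (2 - 1 / (2 * real k - 1)) * ereal_of_enat (k_radius n E k) + ereal (1 - 1 / (2 * real k - 1))"
      by (simp add: r)
    then show ?thesis using True C c rad by (simp add: k_center_approx_def)
  next
    case False
    then have "\<not> k_radius n E k \<le> enat (n - 1)" using low[of "n - 1"] hi n_pos by simp
    then have "k_radius n E k = \<infinity>" using k_radius_less_or_inf[of k] by blast
    then show ?thesis using False C al by (simp add: k_center_approx_def)
  qed
qed

end

context kinst begin

text \<open>The actual size of \<open>S\<close> is known only at run time; its bound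
  \<open>hitters\<close> takes its place.\<close>

definition "main_cost = (n * 20 + 100) + (n * (120 * m + 60 * n + 68) + n * n * 13 + m * 64 + 20) +
  ((hitters + 1) * greedy_cost + 10) + (n * (hitters * 38 + 50) + 6) + 10 +
  (floorlog 2 n * (n * (11 * k + 100) * (2 * (hitters + q) + 4) ^ k + 60) + 20) +
  k * ((k + 3) * (4 * k + 20)) + (k * 3 + 30)"

lemma main_spec:
  assumes q: "q = row_len k n" and r: "\<sigma> 0 = n" "\<sigma> 1 = m" "\<And>l. \<sigma> (yr l) = 0"
    and ini: "\<And>e. e < 2 * m \<Longrightarrow> \<mu> e = ep e" "\<And>a. 2 * m \<le> a \<Longrightarrow> \<mu> a = 0"
  shows "wp w (prog_main k) (\<lambda>_ \<sigma>' \<mu>'. k_center_approx (2 - 1 / (2 * real k - 1)) (1 - 1 / (2 * real k - 1)) n E k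
    (case \<sigma>' 0 of 0 \<Rightarrow> \<infinity> | Suc r \<Rightarrow> enat r) (\<mu>' ` {..<k})) main_cost \<sigma> \<mu>"
proof -
  define c1 where "c1 = n * 20 + 100"
  define c2 where "c2 = n * (120 * m + 60 * n + 68) + n * n * 13 + m * 64 + 20"
  define c3 where "c3 = (hitters + 1) * greedy_cost + 10"
  define c4 where "c4 = n * (hitters * 38 + 50) + 6"
  define c5 where "c5 = floorlog 2 n * (n * (11 * k + 100) * (2 * (hitters + q) + 4) ^ k + 60) + 20"
  define c6 where "c6 = k * ((k + 3) * (4 * k + 20))"
  define c7 where "c7 = k * 3 + 30"
  have mc: "main_cost = c1 + c2 + c3 + c4 + 10 + c5 + c6 + c7"
    by (simp only: main_cost_def c1_def c2_def c3_def c4_def c5_def c6_def c7_def)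
  have y_not: "\<And>l. yr l \<notin> vw (prog_init k)" "\<And>l. yr l \<notin> vw prog_apsp" "\<And>l. yr l \<notin> vw prog_greedy" "\<And>l. yr l \<notin> vw prog_near"
    by (auto simp: prog_init_def prog_apsp_def prog_fill_def prog_adj_def prog_bfs_def prog_edges_def prog_greedy_def
        prog_count_def prog_max_def prog_clear_def prog_near_def)
  let ?Q = "\<lambda>\<sigma>' :: nat \<Rightarrow> nat. \<lambda>\<mu>'. k_center_approx (2 - 1 / (2 * real k - 1)) (1 - 1 / (2 * real k - 1)) n E k
    (case \<sigma>' 0 of 0 \<Rightarrow> \<infinity> | Suc r \<Rightarrow> enat r) (\<mu>' ` {..<k})"
  show ?thesis
    unfolding prog_main_def
  proof (rule wp_append, rule wp_call[OF init_spec[OF q r(1,2)]], goal_cases)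
    case 1
    then show ?case by (simp add: mc c1_def)
  next
    case (2 t1 \<sigma>1 \<mu>1)
    have t1: "c2 + c3 + c4 + 10 + c5 + c6 + c7 \<le> t1" using 2(1) by (simp add: mc c1_def)
    have m1: "\<mu>1 = \<mu>" using 2(4) by (simp add: prog_init_def)
    have y1: "\<sigma>1 (yr l) = 0" for l using 2(3)[OF y_not(1)] r(3) by simp
    have env1: "env \<sigma>1" using 2(5) .
    show ?case
      unfolding m1
    proof (rule wp_append, rule wp_call[OF apsp_spec[OF env1 ini]], goal_cases)
      case 3
      then show ?case using t1 by (simp add: c2_def)
    next
      case (4 t2 \<sigma>2 \<mu>2)
      have t2: "c3 + c4 + 10 + c5 + c6 + c7 \<le> t2" using 4(1) t1 by (simp add: c2_def)
      have y2: "\<sigma>2 (yr l) = 0" for l using 4(3)[OF y_not(2)] y1 by simp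
      have env2: "env \<sigma>2"
        by (rule env_frame[OF env1]) (rule 4(3), auto simp: prog_apsp_def prog_fill_def prog_adj_def prog_bfs_def prog_edges_def)
      have tab: "\<And>s u. s < n \<Longrightarrow> u < n \<Longrightarrow> \<mu>2 (aD + s * n + u) = d s u" "\<And>s i. s < n \<Longrightarrow> i < n \<Longrightarrow> qrow \<mu>2 s i < n"
        and near: "\<And>s. s < n \<Longrightarrow> near_row q s (qrow \<mu>2 s) (\<mu>2 (aU + s))"
        using 4(5) by (auto simp: tables_def)
      have inj: "inj_on (qrow \<mu>2 v) {..<q}" if "v < n" "\<mu>2 (aU + v) \<noteq> 0" for v
        using near[OF that(1)] that(2) by (simp add: near_row_def)
      show ?case
      proof (rule wp_append, rule wp_call[OF greedy_spec[OF env2 tab(2) inj]], goal_cases)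
        case 5
        then show ?case using t2 by (simp add: c3_def)
      next
        case (6 t3 \<sigma>3 \<mu>3)
        have t3: "c4 + 10 + c5 + c6 + c7 \<le> t3" using 6(1) t2 by (simp add: c3_def)
        have y3: "\<sigma>3 (yr l) = 0" for l using 6(3)[OF y_not(3)] y2 by simp
        have env3: "env \<sigma>3"
          by (rule env_frame[OF env2]) (rule 6(3), auto simp: prog_greedy_def prog_count_def prog_max_def prog_clear_def)
        define sz where "sz = \<sigma>3 14"
        have S: "sz \<le> hitters" "sz \<le> n" "\<And>j. j < sz \<Longrightarrow> \<mu>3 (aS + j) < n"
          "\<And>v. v < n \<Longrightarrow> \<mu>2 (aU + v) \<noteq> 0 \<Longrightarrow> \<exists>j<sz. \<mu>3 (aS + j) \<in> qrow \<mu>2 v ` {..<q}" "\<And>a. a < aU \<Longrightarrow> \<mu>3 a = \<mu>2 a"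
          using 6(5) by (auto simp: sz_def)
        have tab3: "\<mu>3 (aD + s * n + u) = d s u" "qrow \<mu>3 s u = qrow \<mu>2 s u" if "s < n" "u < n" for s u
          using row_index_less[OF that] tab(1)[OF that] S(5)[of "aD + s * n + u"] S(5)[of "aQ + s * n + u"]
          by (auto simp: layout)
        have T4: "n * (sz * 38 + 50) + 6 \<le> c4" unfolding c4_def using S(1) by (intro add_mono mult_le_mono) auto
        show ?case
        proof (rule wp_append, rule wp_call[OF near_spec[OF env3 sz_def[symmetric] S(2) tab3(1) S(3)]], goal_cases)
          case 4
          then show ?case using t3 T4 by linarith
        next
          case (5 t4 \<sigma>4 \<mu>4)
          have t4: "10 + c5 + c6 + c7 \<le> t4" using 5(1) t3 T4 by linarith
          have y4: "\<sigma>4 (yr l) = 0" for l using 5(3)[OF y_not(4)] y3 by simp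
          have env4: "env \<sigma>4" by (rule env_frame[OF env3]) (rule 5(3), auto simp: prog_near_def)
          have s14: "\<sigma>4 14 = sz" using 5(3)[of 14] by (simp add: prog_near_def sz_def)
          define Sl where "Sl = (\<lambda>j. \<mu>3 (aS + j))"
          define rw where "rw = qrow \<mu>2"
          define dS where "dS = (\<lambda>z. \<mu>4 (aDS + z))"
          define pS where "pS = (\<lambda>z. \<mu>4 (aPS + z))"
          have D4: "\<And>z. z < n \<Longrightarrow> dS z \<le> 2 * n" "\<And>z. z < n \<Longrightarrow> pS z < n" "\<And>z j. z < n \<Longrightarrow> j < sz \<Longrightarrow> dS z \<le> d z (Sl j)"
            "\<And>z. z < n \<Longrightarrow> dS z < 2 * n \<Longrightarrow> pS z < sz \<and> d z (Sl (pS z)) = dS z" "\<And>a. a < aDS \<Longrightarrow> \<mu>4 a = \<mu>3 a"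
            using 5(5) by (auto simp: dS_def pS_def Sl_def)
          have hit: "\<exists>i<q. \<exists>j<sz. Sl j = rw v i" if "v < n" "\<mu>2 (aU + v) \<noteq> 0" for v
            using S(4)[OF that] by (auto simp: Sl_def rw_def)
          \<comment> \<open>If the row missed a vertex of the ball, it would be full and lie inside
            the ball. Being hit by \<open>S\<close>, it would then put a member of \<open>S\<close>
            within \<open>rr\<close> of \<open>v\<close>, contrary to
            \<open>rr < dS v\<close>.\<close>
          have ball: "x \<in> rw v ` {..<q}" if v: "v < n" and rr: "rr < 2 * n" "rr < dS v" and x: "x < n" "d v x \<le> rr" for v rr x
          proof -
            have "(\<forall>x<n. d v x \<le> rr \<longrightarrow> x \<in> rw v ` {..<q}) \<or> (\<mu>2 (aU + v) \<noteq> 0 \<and> (\<forall>i<q. d v (rw v i) \<le> rr))"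
              using near[OF v] rr(1) unfolding near_row_def rw_def by blast
            moreover have False if f: "\<mu>2 (aU + v) \<noteq> 0" and all: "\<forall>i<q. d v (rw v i) \<le> rr"
            proof -
              obtain i j where ij: "i < q" "j < sz" "Sl j = rw v i" using hit[OF v f] by blast
              then have "d v (Sl j) \<le> rr" using all by simp
              then show False using D4(3)[OF v ij(2)] rr(2) by simp
            qed
            ultimately show ?thesis using x by blast
          qed
          \<comment> \<open>A row of length one consists of \<open>v\<close> itself and is full,
            hence hit; so \<open>v\<close> belongs to \<open>S\<close>.\<close>
          have zero: "dS v = 0" if v: "v < n" and k1: "k = 1" for v
          proof -
            have q1: "q = 1" using q k1 by (simp add: row_len_def)
            then have f: "\<mu>2 (aU + v) \<noteq> 0" using near[OF v] by (simp add: near_row_def)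
            have "(\<forall>x<n. d v x \<le> 0 \<longrightarrow> x \<in> rw v ` {..<q}) \<or> (\<forall>i<q. d v (rw v i) \<le> 0)"
            proof -
              have nr: "\<forall>r<2 * n. (\<forall>x<n. d v x \<le> r \<longrightarrow> x \<in> rw v ` {..<q}) \<or> (\<mu>2 (aU + v) \<noteq> 0 \<and> (\<forall>i<q. d v (rw v i) \<le> r))"
                using near[OF v] unfolding near_row_def rw_def by blast
              have "0 < 2 * n" using n_pos by simp
              from mp[OF spec[OF nr] this] show ?thesis by blast
            qed
            moreover have "rw v 0 = v" if "\<forall>x<n. d v x \<le> 0 \<longrightarrow> x \<in> rw v ` {..<q}"
              using that v q1 by (force simp: lessThan_Suc One_nat_def)
            moreover have "rw v 0 = v" if "\<forall>i<q. d v (rw v i) \<le> 0"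
              using that v q1 d_eq_0[OF v] by simp
            ultimately have "rw v 0 = v" by blast
            moreover obtain i j where "i < q" "j < sz" "Sl j = rw v i" using hit[OF v f] by blast
            ultimately show ?thesis using D4(3)[OF v \<open>j < sz\<close>] q1 by simp
          qed
          interpret ksrch n E k es w q sz Sl rw dS pS
            by unfold_locales (use S(2,3) tab(2) D4 ball zero q_le in \<open>auto simp: Sl_def rw_def\<close>)
          have dat: "data \<mu>4"
            unfolding data_def
          proof (intro conjI allI impI)
            fix s u assume su: "s < n" "u < n"
            show "\<mu>4 (aD + s * n + u) = d s u"
              using tab3(1)[OF su] D4(5)[of "aD + s * n + u"] row_index_less[OF su] by (auto simp: layout)
          next
            fix v i assume vi: "v < n" "i < q"
            then have "i < n" using q_le by simp
            then show "\<mu>4 (aQ + v * n + i) = rw v i"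
              using tab3(2)[OF vi(1) \<open>i < n\<close>] D4(5)[of "aQ + v * n + i"] row_index_less[OF vi(1) \<open>i < n\<close>] by (auto simp: layout rw_def)
          next
            fix j assume "j < sz"
            then show "\<mu>4 (aS + j) = Sl j" using D4(5)[of "aS + j"] S(2) by (auto simp: layout Sl_def)
          qed (auto simp: dS_def pS_def)
          define \<sigma>5 where "\<sigma>5 = \<sigma>4(15 := sz + q)"
          have env5: "env \<sigma>5" by (rule env_frame[OF env4]) (auto simp: \<sigma>5_def)
          have r5: "\<sigma>5 14 = sz" "\<sigma>5 15 = sz + q" "\<And>l. \<sigma>5 (yr l) = 0" using s14 y4 by (auto simp: \<sigma>5_def)
          have T5: "floorlog 2 n * round_cost + 20 \<le> c5"
            unfolding c5_def round_cost_def using S(1) by (intro add_mono mult_le_mono power_mono) auto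
          define L where "L = prog_bin k @ prog_pad k @ prog_out k"
          have main: "wp w L (\<lambda>_. ?Q) t \<sigma>5 \<mu>4" if t: "c5 + c6 + c7 \<le> t" for t
            unfolding L_def
          proof (rule wp_append, rule wp_call[OF bin_spec[OF env5 r5(1,2) dat]], goal_cases)
            \<comment> \<open>Before the first success the solution variables are 0, a legal vertex.
              If the radius is infinite, the padded form of this default may be what is
              output.\<close>
            case 1
            then show ?case using r5(3) n_pos by simp
          next
            case 2
            then show ?case using t T5 by linarith
          next
            case (3 t6 \<sigma>6 \<mu>6)
            have t6: "c6 + c7 \<le> t6" using 3(1) t T5 by linarith
            define hi where "hi = \<sigma>6 22"
            have H: "\<And>l. l < k \<Longrightarrow> \<sigma>6 (yr l) < n" "hi \<le> n" "\<And>R. R < hi \<Longrightarrow> \<not> k_radius n E k \<le> enat R"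
              "hi < n \<Longrightarrow> \<forall>z<n. \<exists>l<k. d (\<sigma>6 (yr l)) z \<le> approx_radius k hi"
              using 3(5) by (auto simp: hi_def)
            have "0 \<notin> vw (prog_bin k)" using not_in_vw_round[of 0 k] by (auto simp: prog_bin_def)
            then have r6: "\<sigma>6 0 = n" using 3(3)[of 0] envD[OF env5] by simp
            show ?case
            proof (rule wp_append, rule wp_call[OF pad_spec[where \<sigma> = \<sigma>6, OF le_refl H(1)]], goal_cases)
              case 2
              then show ?case using t6 by (simp add: c6_def)
            next
              case (3 t7 \<sigma>7 \<mu>7)
              have vwp: "vw (prog_pad i) \<subseteq> insert 24 (yr ` {..<i})" for i
                by (induction i) (auto simp: prog_fresh_def lessThan_Suc)
              have "0 \<notin> vw (prog_pad k)" "22 \<notin> vw (prog_pad k)" using vwp[of k] by auto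
              then have r7: "\<sigma>7 0 = n" "\<sigma>7 22 = hi" using 3(3) r6 by (auto simp: hi_def)
              define C where "C = (\<lambda>l. \<sigma>7 (yr l)) ` {..<k}"
              have P: "inj_on (\<lambda>l. \<sigma>7 (yr l)) {..<k}" "C \<subseteq> {..<n}" "(\<lambda>l. \<sigma>6 (yr l)) ` {..<k} \<subseteq> C"
                using 3(5) by (auto simp: C_def)
              have card: "card C = k" unfolding C_def using card_image[OF P(1)] by simp
              have cov: "\<forall>z<n. \<exists>c\<in>C. d c z \<le> approx_radius k hi" if "hi < n"
              proof (intro allI impI)
                fix z assume "z < n"
                then obtain l where "l < k" "d (\<sigma>6 (yr l)) z \<le> approx_radius k hi" using H(4)[OF \<open>hi < n\<close>] by blast
                moreover have "\<sigma>6 (yr l) \<in> C" using P(3) \<open>l < k\<close> by blast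
                ultimately show "\<exists>c\<in>C. d c z \<le> approx_radius k hi" by blast
              qed
              show ?case
              proof (rule wp_call[OF out_spec], goal_cases)
                case 3
                then show ?case using 3 t6 \<open>t6 - k * ((k + 3) * (4 * k + 20)) \<le> t7\<close> by (simp add: c6_def c7_def)
              next
                case (4 t8 \<sigma>8 \<mu>8)
                have "\<mu>8 ` {..<k} = C" unfolding C_def using 4(5) by (intro image_cong) auto
                moreover have "\<sigma>8 0 = (if hi < n then Suc (approx_radius k hi) else 0)" using 4(5) r7 by simp
                ultimately show ?case
                  using approx_from_search[OF k_pos P(2) card H(3) H(2) cov] by simp
              qed (use r7 H in simp_all)
            qed
          qed
          have b: "sz + q < 2 ^ w" using S(2) q_le word by simp
          show ?case
            unfolding L_def[symmetric]
          proof (rule wp_append, rule wp_asg, goal_cases)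
            case 3
            have eq: "\<sigma>4(15 := iv (Var 14 \<oplus> Var 13) \<sigma>4 \<mu>4) = \<sigma>5" using s14 envD[OF env4] by (simp add: \<sigma>5_def)
            show ?case unfolding eq by (rule main) (use t4 in simp)
          qed (use b t4 s14 envD[OF env4] in simp_all)
        qed
      qed
    qed
  qed
qed

end

section \<open>Running time\<close>

lemma floorlog_le_log: "1 \<le> n \<Longrightarrow> real (floorlog 2 n) \<le> 1 + log 2 (real n)"
proof -
  assume n: "1 \<le> n"
  have f: "floorlog 2 n = nat \<lfloor>log 2 (real n)\<rfloor> + 1" using n by (simp add: floorlog_def)
  have "0 \<le> log 2 (real n)" using n by simp
  then show ?thesis unfolding f by simp
qed

lemma ln_le_log2: "1 \<le> (x::real) \<Longrightarrow> ln x \<le> log 2 x"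
proof -
  assume x: "1 \<le> x"
  have "ln 2 \<le> (1::real)" using ln_le_minus_one[of 2] by simp
  moreover have "0 < ln (2::real)" by simp
  ultimately have "1 \<le> 1 / ln (2::real)" by (simp add: field_simps)
  then have "ln x * 1 \<le> ln x * (1 / ln 2)" using x by (intro mult_left_mono) auto
  then show ?thesis by (simp add: log_def)
qed

lemma power_half: "1 \<le> n \<Longrightarrow> real n * sqrt (real n) ^ k = real n powr (real k / 2 + 1)"
proof -
  assume n: "1 \<le> n"
  have "sqrt (real n) ^ k = (real n powr (1 / 2)) powr real k"
    using n by (simp add: powr_half_sqrt powr_realpow)
  also have "\<dots> = real n powr (real k / 2)" by (simp add: powr_powr)
  finally show ?thesis using n by (simp add: powr_add)
qed

context kinst begin

lemma hitters_le: "real hitters \<le> real n / real q * (1 + log 2 (real n))"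
proof -
  have "0 \<le> pot n q n" by (auto simp: pot_def)
  then have "real hitters \<le> pot n q n" unfolding hitters_def by simp
  also have "\<dots> = real n / real q * (1 + ln (real n))" using n_pos by (simp add: pot_def)
  also have "\<dots> \<le> real n / real q * (1 + log 2 (real n))"
    using n_pos ln_le_log2[of "real n"] by (intro mult_left_mono) auto
  finally show ?thesis .
qed

definition "cost_factor = 1200 + (11 * k + 100) * 10 ^ k + k * ((k + 3) * (4 * k + 20)) + k * 3"

text \<open>Each summand is compared with \<open>P\<close>. The search costs about
  \<open>n * (s * L) ^ k\<close> per round, with \<open>s\<close> about \<open>sqrt n\<close>, and
  the number of rounds contributes one more factor \<open>L\<close>; hence the exponent
  \<open>k + 1\<close>.\<close>

lemma main_cost_le:
  assumes q: "q = row_len k n" and nm: "n \<le> m + 1"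
  shows "real main_cost \<le> real cost_factor * (real m * real n + real n powr (real k / 2 + 1)) * (1 + log 2 (real n)) ^ (k + 1)"
proof -
  define F where "F = real m * real n + real n powr (real k / 2 + 1)"
  define L where "L = 1 + log 2 (real n)"
  define H where "H = real hitters"
  have n1: "1 \<le> real n" "1 \<le> real q" "real q \<le> real n" using n_pos q_pos q_le by auto
  have L1: "1 \<le> L" using n_pos by (simp add: L_def)
  have np: "real n \<le> real n powr (real k / 2 + 1)"
    using n1(1) powr_mono[of 1 "real k / 2 + 1" "real n"] by simp
  \<comment> \<open>The assumption that there are at least \<open>n - 1\<close> edges is used
    here.\<close>
  have nn: "real n * real n \<le> F"
  proof -
    have "real n * real n \<le> (real m + 1) * real n" using nm by (intro mult_right_mono) auto
    then show ?thesis using np by (simp add: F_def algebra_simps)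
  qed
  have n_nn: "real n \<le> real n * real n" using n1 by simp
  have nF: "real n \<le> F" using n_nn nn by linarith
  have F1: "1 \<le> F" using nF n1 by linarith
  have mn: "real m * real n \<le> F" by (simp add: F_def)
  have mF: "real m \<le> F"
  proof -
    have "real m * 1 \<le> real m * real n" using n1 by (intro mult_left_mono) auto
    then show ?thesis using mn by simp
  qed
  define P where "P = F * L ^ (k + 1)"
  have Lp: "1 \<le> L ^ j" for j using L1 by (rule one_le_power)
  have LP: "L \<le> L ^ (k + 1)" using power_increasing[of 1 "k + 1" L] L1 by simp
  have FP: "F \<le> P" unfolding P_def using F1 mult_left_mono[OF Lp[of "k + 1"], of F] by simp
  have FLP: "F * L \<le> P" unfolding P_def using F1 LP by (intro mult_left_mono) auto
  have P1: "1 \<le> P" using F1 FP by linarith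
  have Hn: "H \<le> real n / real q * L" using hitters_le by (simp add: H_def L_def)
  have Hq: "H * real q \<le> real n * L" using Hn n1 by (simp add: field_simps)
  have H0: "0 \<le> H" by (simp add: H_def)
  have HnL: "H \<le> real n * L"
  proof -
    have "H * 1 \<le> H * real q" using H0 n1 by (intro mult_left_mono) auto
    then show ?thesis using Hq by simp
  qed
  have nnL: "real n * (real n * L) \<le> P"
  proof -
    have "real n * real n * L \<le> F * L" using nn L1 by (intro mult_right_mono) auto
    then show ?thesis using FLP by (simp add: mult.assoc)
  qed
  \<comment> \<open>The row length cancels: there are about \<open>(n / q) * L\<close> greedy rounds
    of about \<open>n * q\<close> steps each.\<close>
  have greedy: "(H + 1) * real greedy_cost \<le> 438 * P"
  proof -
    have "real greedy_cost = 56 * (real n * real q) + 83 * real n + 80" by (simp add: greedy_cost_def algebra_simps)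
    moreover have "real n * 1 \<le> real n * real q" "1 * 1 \<le> real n * real q" using n1 by (intro mult_mono; simp)+
    ultimately have g: "real greedy_cost \<le> 219 * (real n * real q)" by simp
    have "(H + 1) * real greedy_cost \<le> (H + 1) * (219 * (real n * real q))" using g H0 by (intro mult_left_mono) auto
    also have "\<dots> = 219 * (real n * (H * real q)) + 219 * (real n * real q)" by (simp add: algebra_simps)
    also have "\<dots> \<le> 219 * (real n * (real n * L)) + 219 * (real n * real n)"
      using Hq n1 by (intro add_mono mult_left_mono) auto
    also have "\<dots> \<le> 219 * P + 219 * P" using nnL nn FP by linarith
    finally show ?thesis by simp
  qed
  have near: "real n * (H * 38 + 50) \<le> 88 * P"
  proof -
    have "real n * H \<le> real n * (real n * L)" using HnL by (intro mult_left_mono) auto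
    then have "real n * H \<le> P" using nnL by simp
    then show ?thesis using nF FP by (simp add: algebra_simps)
  qed
  have bin: "real (floorlog 2 n) * (real n * (11 * real k + 100) * (2 * (H + real q) + 4) ^ k + 60) \<le> ((11 * real k + 100) * 10 ^ k + 60) * P"
  proof -
    \<comment> \<open>A common bound, up to a factor 2, for \<open>q\<close> and
      \<open>n / q\<close>. For \<open>k = 1\<close> the row length is 1 and \<open>s\<close> must
      be \<open>n\<close>; then \<open>n * s ^ k = n * n\<close>, still within
      \<open>F\<close>.\<close>
    define s where "s = (if k = 1 then real n else sqrt (real n))"
    have sqrt1: "1 \<le> sqrt (real n)" using n1 by simp
    have s1: "1 \<le> s" using n1 sqrt1 by (simp add: s_def)
    have q2: "real q \<le> 2 * s"
    proof (cases "k = 1")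
      case True
      then show ?thesis using q n1 by (simp add: row_len_def s_def)
    next
      case False
      have "(q - 1) * (q - 1) < n" using row_len_bounds(4)[OF n_pos False] q by simp
      then have "real (q - 1) ^ 2 \<le> real n" by (metis of_nat_le_iff of_nat_mult less_imp_le power2_eq_square)
      then have "real (q - 1) \<le> sqrt (real n)" by (rule real_le_rsqrt)
      moreover have "real (q - 1) = real q - 1" using q_pos by (simp add: of_nat_diff)
      ultimately have "real q \<le> 2 * sqrt (real n)" using sqrt1 by linarith
      then show ?thesis using False by (simp add: s_def)
    qed
    have nq: "real n / real q \<le> s"
    proof (cases "k = 1")
      case True
      then show ?thesis using n1 by (simp add: s_def divide_le_eq)
    next
      case False
      have "n \<le> q * q" using row_len_bounds(3)[OF n_pos False] q by simp
      then have "real n \<le> real q ^ 2" by (metis of_nat_le_iff of_nat_mult power2_eq_square)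
      then have "sqrt (real n) \<le> real q" using n1 by (intro real_le_lsqrt) auto
      then have "sqrt (real n) * sqrt (real n) \<le> sqrt (real n) * real q" by (intro mult_left_mono) auto
      then show ?thesis using False n1 by (simp add: s_def divide_le_eq)
    qed
    have Hs: "H \<le> s * L"
    proof -
      have "real n / real q * L \<le> s * L" using nq L1 by (intro mult_right_mono) auto
      then show ?thesis using Hn by linarith
    qed
    have "s * 1 \<le> s * L" using s1 L1 by (intro mult_left_mono) auto
    then have sL: "s \<le> s * L" by simp
    have sL1: "1 \<le> s * L" using s1 sL by linarith
    have "2 * H + 2 * real q + 4 \<le> 2 * (s * L) + 4 * s + 4" using Hs q2 by simp
    also have "\<dots> \<le> 10 * (s * L)" using sL sL1 by linarith
    finally have "2 * (H + real q) + 4 \<le> 10 * (s * L)" by simp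
    then have base: "2 * (H + real q) + 4 \<le> 10 * s * L" by (simp only: mult.assoc)
    have "(2 * (H + real q) + 4) ^ k \<le> (10 * s * L) ^ k" using base H0 by (intro power_mono) auto
    also have "\<dots> = 10 ^ k * (s ^ k * L ^ k)" by (simp add: power_mult_distrib)
    finally have pw: "(2 * (H + real q) + 4) ^ k \<le> 10 ^ k * (s ^ k * L ^ k)" .
    have ns: "real n * s ^ k \<le> F"
    proof (cases "k = 1")
      case True
      then show ?thesis using nn by (simp add: s_def)
    next
      case False
      then show ?thesis using power_half[OF n_pos, of k] by (simp add: s_def F_def)
    qed
    have "real n * (11 * real k + 100) * (2 * (H + real q) + 4) ^ k \<le> real n * (11 * real k + 100) * (10 ^ k * (s ^ k * L ^ k))"
      using pw by (intro mult_left_mono) auto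
    also have "\<dots> = (11 * real k + 100) * 10 ^ k * (real n * s ^ k * L ^ k)" by (simp add: algebra_simps)
    also have "\<dots> \<le> (11 * real k + 100) * 10 ^ k * (F * L ^ k)"
      using ns L1 by (intro mult_left_mono mult_right_mono) auto
    finally have 1: "real n * (11 * real k + 100) * (2 * (H + real q) + 4) ^ k \<le> (11 * real k + 100) * 10 ^ k * (F * L ^ k)" .
    have FL: "1 \<le> F * L ^ k" using F1 Lp[of k] mult_mono[of 1 F 1 "L ^ k"] by simp
    have fl: "real (floorlog 2 n) \<le> L" using floorlog_le_log[OF n_pos] by (simp add: L_def)
    have "real (floorlog 2 n) * (real n * (11 * real k + 100) * (2 * (H + real q) + 4) ^ k + 60) \<le>
        L * ((11 * real k + 100) * 10 ^ k * (F * L ^ k) + 60 * (F * L ^ k))"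
    proof (rule mult_mono[OF fl add_mono[OF 1]])
      show "60 \<le> 60 * (F * L ^ k)" using FL by linarith
    qed (use L1 H0 in auto)
    also have "\<dots> = ((11 * real k + 100) * 10 ^ k + 60) * P" unfolding P_def power_add power_one_right by (simp add: algebra_simps)
    finally show ?thesis .
  qed
  have kc: "real (k * ((k + 3) * (4 * k + 20)) + k * 3) \<le> real (k * ((k + 3) * (4 * k + 20)) + k * 3) * P"
    using P1 mult_left_mono[of 1 P "real (k * ((k + 3) * (4 * k + 20)) + k * 3)"] by simp
  have "real main_cost = 20 * real n + 120 * (real m * real n) + 60 * (real n * real n) + 68 * real n + 13 * (real n * real n) + 64 * real m +
      (H + 1) * real greedy_cost + real n * (H * 38 + 50) +
      real (floorlog 2 n) * (real n * (11 * real k + 100) * (2 * (H + real q) + 4) ^ k + 60) +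
      real (k * ((k + 3) * (4 * k + 20)) + k * 3) + 196"
    by (simp add: main_cost_def H_def algebra_simps)
  also have "\<dots> \<le> 20 * P + 120 * P + 60 * P + 68 * P + 13 * P + 64 * P + 438 * P + 88 * P +
      ((11 * real k + 100) * 10 ^ k + 60) * P + real (k * ((k + 3) * (4 * k + 20)) + k * 3) * P + 196 * P"
    using greedy near bin kc nF nn mn mF FP P1 by (intro add_mono) linarith+
  also have "\<dots> = (1127 + (11 * real k + 100) * 10 ^ k + real (k * ((k + 3) * (4 * k + 20)) + k * 3)) * P"
    by (simp add: algebra_simps)
  also have "\<dots> \<le> real cost_factor * P"
    using P1 by (intro mult_right_mono) (simp_all add: cost_factor_def)
  finally show ?thesis by (simp add: P_def F_def L_def mult.assoc)
qed

end

lemma card_edges_le: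
  assumes "simple_graph n E"
  shows "card E \<le> n * n"
proof -
  have "E \<subseteq> (\<lambda>(u, v). {u, v}) ` ({..<n} \<times> {..<n})"
    using assms by (fastforce simp: simple_graph_def)
  then have "card E \<le> card ((\<lambda>(u, v). {u, v}) ` ({..<n} \<times> {..<n}))" by (intro card_mono) auto
  also have "\<dots> \<le> card ({..<n} \<times> {..<n})" by (intro card_image_le) auto
  finally show ?thesis by (simp add: card_cartesian_product)
qed

text \<open>Of the twelve factors \<open>2 ^ floorlog 2 n\<close>, two exceed \<open>n * n\<close>;
  the other ten give \<open>2 ^ 10 \<ge> 400\<close>, even for \<open>n = 1\<close>, where
  \<open>floorlog\<close> is 1.\<close>

lemma word_large:
  assumes "1 \<le> n"
  shows "400 * (n * n) \<le> 2 ^ (12 * floorlog 2 n)"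
proof -
  define b where "b = (2::nat) ^ floorlog 2 n"
  have "n < b" unfolding b_def using floorlog_bounds[of n 2] assms by simp
  then have "n * n \<le> b ^ 2" "2 \<le> b" using assms by (auto simp: power2_eq_square intro!: mult_le_mono)
  moreover have "2 ^ 10 \<le> b ^ 10" using \<open>2 \<le> b\<close> by (intro power_mono) auto
  ultimately have "2 ^ 10 * (n * n) \<le> b ^ 10 * b ^ 2" by (intro mult_le_mono)
  also have "\<dots> = 2 ^ (12 * floorlog 2 n)"
    unfolding b_def by (simp add: power_mult[symmetric] power_add[symmetric] mult.commute)
  finally show ?thesis by simp
qed

theorem mainTheorem9:
  fixes k :: nat
  assumes "k \<ge> 1"
  shows "\<exists>(P :: instr list) (\<kappa> :: nat) (T :: nat \<Rightarrow> nat \<Rightarrow> nat) (c :: real).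
    \<kappa> \<ge> 2 \<and> c > 0 \<and>
    T \<in> soft_O (\<lambda>n m. real m * real n + real n powr (real k / 2 + 1)) \<and>
    solves_k_center_whp P \<kappa> T c k
      (2 - 1 / (2 * real k - 1)) (1 - 1 / (2 * real k - 1))"
proof -
  define a where "a = 1200 + (11 * k + 100) * 10 ^ k + k * ((k + 3) * (4 * k + 20)) + k * 3"
  define f where "f = (\<lambda>n m. real m * real n + real n powr (real k / 2 + 1))"
  \<comment> \<open>The bound itself, rounded down, serves as running time: the program may halt
    earlier, since \<open>run\<close> leaves a halted configuration as it is.\<close>
  define T where "T = (\<lambda>n m. nat \<lfloor>real a * f n m * (1 + log 2 (real n)) ^ (k + 1)\<rfloor>)"
  have "T \<in> soft_O f"
    unfolding soft_O_def
  proof (rule CollectI, rule exI[of _ a], rule exI[of _ "k + 1"], intro allI impI)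
    fix n m :: nat assume "1 \<le> n"
    then have "0 \<le> real a * f n m * (1 + log 2 (real n)) ^ (k + 1)"
      by (intro mult_nonneg_nonneg zero_le_power) (auto simp: f_def)
    then show "real (T n m) \<le> real a * f n m * (1 + log 2 (real n)) ^ (k + 1)"
      unfolding T_def by simp
  qed
  moreover have "solves_k_center_whp (prog_main k) 12 T 1 k (2 - 1 / (2 * real k - 1)) (1 - 1 / (2 * real k - 1))"
    unfolding solves_k_center_whp_def
  proof (intro allI impI)
    fix n E es
    assume asm: "simple_graph n E \<and> k \<le> n \<and> n \<le> card E + 1 \<and> edge_listing E es"
    define w :: nat where "w = 12 * floorlog 2 n"
    define q where "q = row_len k n"
    have n1: "1 \<le> n" using asm assms by simp
    have len: "length es = card E"
      using asm distinct_card[of "map (\<lambda>(u, v). {u, v}) es"] by (simp add: edge_listing_def)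
    have "100 * (n * n + n + length es + 1) \<le> 400 * (n * n)"
    proof -
      have "n \<le> n * n" "card E \<le> n * n" using n1 card_edges_le[of n E] asm by simp_all
      then show ?thesis using n1 unfolding len distrib_left by linarith
    qed
    then have word: "100 * (n * n + n + length es + 1) \<le> 2 ^ w"
      using word_large[OF n1] unfolding w_def by linarith
    interpret kinst n E k es w q
    proof unfold_locales
      show "simple_graph n E" "1 \<le> n" "1 \<le> k" "k \<le> n" "edge_listing E es"
        using asm assms n1 by auto
      show "100 * (n * n + n + length es + 1) \<le> 2 ^ w" by (rule word)
      show "1 \<le> q" "q \<le> n" using row_len_bounds[OF n1, of k] by (auto simp: q_def)
    qed
    define \<sigma> :: "nat \<Rightarrow> nat" where "\<sigma> = (\<lambda>x. if x = 0 then n else if x = 1 then length es else 0)"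
    define r where "r = input_state n es"
    have s: "sim r \<sigma> (mem r)"
      by (auto simp: sim_def r_def input_state_def \<sigma>_def vreg_def)
    have "wp w (prog_main k) (\<lambda>_ \<sigma>' \<mu>'. k_center_approx (2 - 1 / (2 * real k - 1)) (1 - 1 / (2 * real k - 1)) n E k
      (case \<sigma>' 0 of 0 \<Rightarrow> \<infinity> | Suc r \<Rightarrow> enat r) (\<mu>' ` {..<k})) main_cost \<sigma> (mem r)"
      by (rule main_spec) (auto simp: q_def \<sigma>_def r_def input_state_def ep_def)
    then obtain t \<sigma>' \<mu>' where t: "t \<le> main_cost"
      and ok: "k_center_approx (2 - 1 / (2 * real k - 1)) (1 - 1 / (2 * real k - 1)) n E k
        (case \<sigma>' 0 of 0 \<Rightarrow> \<infinity> | Suc r \<Rightarrow> enat r) (\<mu>' ` {..<k})"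
      and ex: "\<And>r K. sim r \<sigma> (mem (input_state n es)) \<Longrightarrow> \<exists>r'. sim r' \<sigma>' \<mu>' \<and> run w t (prog_main k @ K, r) = return_pmf (K, r')"
      unfolding wp_def r_def by blast
    obtain r' where r': "sim r' \<sigma>' \<mu>'" "run w t (prog_main k @ [], r) = return_pmf ([], r')"
      using ex[of r "[]"] s by (auto simp: r_def)
    have "real main_cost \<le> real a * f n (card E) * (1 + log 2 (real n)) ^ (k + 1)"
      using main_cost_le asm len by (simp add: q_def a_def f_def cost_factor_def)
    then have "main_cost \<le> T n (card E)" unfolding T_def by (rule le_nat_floor)
    then have tT: "T n (card E) = t + (T n (card E) - t)" using t by simp
    have D: "run w (T n (card E)) (prog_main k, input_state n es) = return_pmf ([], r')"
      by (subst tT, rule run_trans[OF _ run_halted]) (use r' in \<open>simp add: r_def\<close>)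
    have "reg r' 0 = \<sigma>' 0" "mem r' = \<mu>'" using r'(1) by (auto simp: sim_def vreg_def dest: spec[of _ 0])
    then have "output_value ([], r') = (case \<sigma>' 0 of 0 \<Rightarrow> \<infinity> | Suc r \<Rightarrow> enat r)" "output_centers k ([], r') = \<mu>' ` {..<k}"
      by (simp_all add: output_value_def output_centers_def)
    then show "let D = run (12 * floorlog 2 n) (T n (card E)) (prog_main k, input_state n es) in
        (\<forall>cf\<in>set_pmf D. halted cf) \<and>
        measure_pmf.prob D {cf. k_center_approx (2 - 1 / (2 * real k - 1)) (1 - 1 / (2 * real k - 1)) n E k
          (output_value cf) (output_centers k cf)} \<ge> 1 - 1 / real n powr 1"
      using D ok unfolding w_def by (simp add: halted_def)
  qed
  \<comment> \<open>The final distribution is a point mass on a correct answer, so the success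
    probability is 1; the exponent 1 is a convenient witness.\<close>
  ultimately show ?thesis
    unfolding f_def by (intro exI[of _ "prog_main k"] exI[of _ 12] exI[of _ T] exI[of _ 1]) simp
qed

end
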